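(* Let $\mathscr{F}$ be a distribution of dimension $2$ and degree zero on $\mathbb{P}^n$, $n\ge3$. Then either $\mathscr{F}$ is integrable and tangent to a linear rational projection $\mathbb{P}^n\dashrightarrow\mathbb{P}^{n-2}$, or $n=3$ and $\mathscr{F}$ is a contact structure on $\mathbb{P}^3$.
   Context: A (saturated, singular, holomorphic) distribution $\mathscr{F}$ of dimension $s$ on $\mathbb{P}^n$ is an exact sequence $0\to T\mathscr{F}\to T\mathbb{P}^n\to N\mathscr{F}\to0$ with $N\mathscr{F}$ torsion free of rank $n-s\ge1$; its degree is $\deg(\mathscr{F})=s-c_1(T\mathscr{F})$. It is integrable if $[T\mathscr{F},T\mathscr{F}]\subset T\mathscr{F}$. "Tangent to a linear projection" means that $T\mathscr{F}$ is the relative tangent sheaf (the leaves are the fibres) of a linear projection $\mathbb{P}^n\dashrightarrow\mathbb{P}^{n-2}$. A contact structure on $\mathbb{P}^3$ is a distribution given by $0\to N(1)\to T\mathbb{P}^3\to\mathcal{O}_{\mathbb{P}^3}(2)\to0$ with $N$ a null-correlation bundle; equivalently, a non-singular, everywhere non-integrable codimension one distribution of degree zero. *)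

theory Defs
  imports "HOL-Analysis.Analysis"
begin

text \<open>
  Complex projective space of dimension \<open>CARD('n) - 1\<close>: nonzero vectors of
  \<open>complex ^ 'n\<close> up to nonzero scalars, with the quotient topology.
\<close>

definition proportional :: "complex ^ 'n \<Rightarrow> complex ^ 'n \<Rightarrow> bool" where
  "proportional x y \<longleftrightarrow> x \<noteq> 0 \<and> y \<noteq> 0 \<and> (\<exists>c. c \<noteq> 0 \<and> y = c *s x)"

lemma part_equivp_proportional: "part_equivp (proportional :: complex ^ 'n \<Rightarrow> _)"
proof (rule part_equivpI)
  show "\<exists>x :: complex ^ 'n. proportional x x"
    by (rule exI[of _ "\<chi> i. 1"])
      (auto simp: proportional_def vec_eq_iff intro!: exI[of _ "1::complex"])
  show "symp (proportional :: complex ^ 'n \<Rightarrow> _)"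
  proof (rule sympI)
    fix x y :: "complex ^ 'n"
    assume "proportional x y"
    then obtain c where "x \<noteq> 0" "y \<noteq> 0" "c \<noteq> 0" "y = c *s x"
      by (auto simp: proportional_def)
    then show "proportional y x"
      by (auto simp: proportional_def vector_smult_assoc intro!: exI[of _ "inverse c"])
  qed
  show "transp (proportional :: complex ^ 'n \<Rightarrow> _)"
  proof (rule transpI)
    fix x y z :: "complex ^ 'n"
    assume "proportional x y" "proportional y z"
    then obtain c d where "x \<noteq> 0" "z \<noteq> 0" "c \<noteq> 0" "d \<noteq> 0" "z = (d * c) *s x"
      by (auto simp: proportional_def vector_smult_assoc)
    then show "proportional x z"
      by (auto simp: proportional_def intro!: exI[of _ "d * c"])
  qed
qed

quotient_type (overloaded) 'n proj = "complex ^ ('n::finite)" / partial: proportional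
  by (rule part_equivp_proportional)

text \<open>\<open>cone U\<close> is the preimage of \<open>U\<close> under \<open>x \<mapsto> [x]\<close>; \<open>abs_proj 0\<close> is a junk value.\<close>

definition cone :: "('n::finite) proj set \<Rightarrow> (complex ^ 'n) set" where
  "cone U = {x. x \<noteq> 0 \<and> abs_proj x \<in> U}"

instantiation proj :: (finite) topological_space
begin

definition open_proj :: "'a proj set \<Rightarrow> bool" where
  "open_proj U \<longleftrightarrow> open (cone U)"

instance
proof
  have "cone (UNIV :: 'a proj set) = - {0}"
    by (auto simp: cone_def)
  then show "open (UNIV :: 'a proj set)"
    by (simp add: open_proj_def open_Compl)
next
  fix S T :: "'a proj set"
  assume "open S" "open T"
  moreover have "cone (S \<inter> T) = cone S \<inter> cone T"
    by (auto simp: cone_def)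
  ultimately show "open (S \<inter> T)"
    by (simp add: open_proj_def open_Int)
next
  fix K :: "'a proj set set"
  assume "\<forall>S\<in>K. open S"
  moreover have "cone (\<Union>K) = (\<Union>S\<in>K. cone S)"
    by (auto simp: cone_def)
  ultimately show "open (\<Union>K)"
    by (auto simp: open_proj_def)
qed

end

text \<open>Complex Frechet differentiability at every point of \<open>S\<close>; used for open \<open>S\<close>.\<close>

definition cholomorphic_on :: "(complex ^ 'n \<Rightarrow> complex) \<Rightarrow> (complex ^ 'n) set \<Rightarrow> bool" where
  "cholomorphic_on f S \<longleftrightarrow>
     (\<forall>x\<in>S. \<exists>D. (f has_derivative D) (at x) \<and> (\<forall>c v. D (c *s v) = c * D v))"

text \<open>
  \<open>hol U\<close> is the ring of holomorphic functions on an open \<open>U\<close>. Its elements are total functions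
  with arbitrary values off \<open>U\<close>, so they are only meaningful up to equality on \<open>U\<close>.
\<close>

definition hol :: "('n::finite) proj set \<Rightarrow> ('n proj \<Rightarrow> complex) set" where
  "hol U = {f. cholomorphic_on (\<lambda>x. f (abs_proj x)) (cone U)}"

definition hol_at :: "('n::finite) proj \<Rightarrow> ('n proj \<Rightarrow> complex) \<Rightarrow> bool" where
  "hol_at p f \<longleftrightarrow> (\<exists>V. open V \<and> p \<in> V \<and> f \<in> hol V)"

text \<open>
  Sections of \<open>O(k)\<close> over \<open>U\<close>: holomorphic functions on the cone over \<open>U\<close>, homogeneous of degree
  \<open>k\<close>, extended by \<open>0\<close> so that equality of sections is equality of functions.
\<close>

definition twist :: "int \<Rightarrow> ('n::finite) proj set \<Rightarrow> (complex ^ 'n \<Rightarrow> complex) set" where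
  "twist k U = {g. cholomorphic_on g (cone U) \<and>
     (\<forall>x\<in>cone U. \<forall>c. c \<noteq> 0 \<longrightarrow> g (c *s x) = c powi k * g x) \<and>
     (\<forall>x. x \<notin> cone U \<longrightarrow> g x = 0)}"

definition twist_res :: "('n::finite) proj set \<Rightarrow> (complex ^ 'n \<Rightarrow> complex) \<Rightarrow> complex ^ 'n \<Rightarrow> complex" where
  "twist_res V g = (\<lambda>x. if x \<in> cone V then g x else 0)"

text \<open>
  A tangent vector at \<open>p\<close> is a derivation of the ring of germs at \<open>p\<close>. It is set to \<open>0\<close> on
  functions without a germ in that ring, so that it is determined by its action on germs.
\<close>

definition tangent_vector :: "('n::finite) proj \<Rightarrow> (('n proj \<Rightarrow> complex) \<Rightarrow> complex) \<Rightarrow> bool" where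
  "tangent_vector p v \<longleftrightarrow>
     (\<forall>f. \<not> hol_at p f \<longrightarrow> v f = 0) \<and>
     (\<forall>f g. hol_at p f \<and> hol_at p g \<longrightarrow>
        ((\<forall>\<^sub>F q in nhds p. f q = g q) \<longrightarrow> v f = v g) \<and>
        v (\<lambda>q. f q + g q) = v f + v g \<and>
        (\<forall>c. v (\<lambda>q. c * f q) = c * v f) \<and>
        v (\<lambda>q. f q * g q) = v f * g p + f p * v g)"

type_synonym 'n vfield = "'n proj \<Rightarrow> ('n proj \<Rightarrow> complex) \<Rightarrow> complex"

definition TP :: "('n::finite) proj set \<Rightarrow> 'n vfield set" where
  "TP U = {X. (\<forall>p\<in>U. tangent_vector p (X p)) \<and>
              (\<forall>p. p \<notin> U \<longrightarrow> X p = (\<lambda>f. 0)) \<and>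
              (\<forall>V f. open V \<and> V \<subseteq> U \<and> f \<in> hol V \<longrightarrow> (\<lambda>p. X p f) \<in> hol V)}"

definition vadd :: "('n::finite) vfield \<Rightarrow> 'n vfield \<Rightarrow> 'n vfield" where
  "vadd X Y = (\<lambda>p f. X p f + Y p f)"

definition vdiff :: "('n::finite) vfield \<Rightarrow> 'n vfield \<Rightarrow> 'n vfield" where
  "vdiff X Y = (\<lambda>p f. X p f - Y p f)"

definition vzero :: "('n::finite) vfield" where
  "vzero = (\<lambda>p f. 0)"

definition vscale :: "('n::finite proj \<Rightarrow> complex) \<Rightarrow> 'n vfield \<Rightarrow> 'n vfield" where
  "vscale h X = (\<lambda>p f. h p * X p f)"

definition vres :: "('n::finite) proj set \<Rightarrow> 'n vfield \<Rightarrow> 'n vfield" where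
  "vres V X = (\<lambda>p f. if p \<in> V then X p f else 0)"

definition lincomb :: "('n::finite proj \<Rightarrow> complex) list \<Rightarrow> 'n vfield list \<Rightarrow> 'n vfield" where
  "lincomb hs Xs = (\<lambda>p f. \<Sum>i<length Xs. (hs ! i) p * (Xs ! i) p f)"

text \<open>
  The guard is needed because \<open>\<lambda>q. Y q f\<close> may be holomorphic at \<open>p\<close> although \<open>f\<close> is not.
\<close>

definition lie :: "('n::finite) vfield \<Rightarrow> 'n vfield \<Rightarrow> 'n vfield" where
  "lie X Y = (\<lambda>p f. if hol_at p f then X p (\<lambda>q. Y q f) - Y p (\<lambda>q. X q f) else 0)"

type_synonym 'n subsheaf = "'n proj set \<Rightarrow> 'n vfield set"

text \<open>Only the values on open sets matter.\<close>

definition subsheaf_TP :: "('n::finite) subsheaf \<Rightarrow> bool" where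
  "subsheaf_TP T \<longleftrightarrow>
     (\<forall>U. open U \<longrightarrow>
        T U \<subseteq> TP U \<and> vzero \<in> T U \<and>
        (\<forall>X\<in>T U. \<forall>Y\<in>T U. vadd X Y \<in> T U) \<and>
        (\<forall>h\<in>hol U. \<forall>X\<in>T U. vscale h X \<in> T U) \<and>
        (\<forall>V. open V \<and> V \<subseteq> U \<longrightarrow> (\<forall>X\<in>T U. vres V X \<in> T V)) \<and>
        (\<forall>X\<in>TP U. (\<forall>p\<in>U. \<exists>V. open V \<and> p \<in> V \<and> V \<subseteq> U \<and> vres V X \<in> T V) \<longrightarrow> X \<in> T U))"

text \<open>
  For a subsheaf of the tangent sheaf, finite type is the same as coherence, because the
  structure sheaf is coherent (Oka).
\<close>

definition finite_type :: "('n::finite) subsheaf \<Rightarrow> bool" where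
  "finite_type T \<longleftrightarrow>
     (\<forall>p. \<exists>U Xs. open U \<and> p \<in> U \<and> set Xs \<subseteq> T U \<and>
        (\<forall>V X q. open V \<and> V \<subseteq> U \<and> X \<in> T V \<and> q \<in> V \<longrightarrow>
           (\<exists>W hs. open W \<and> q \<in> W \<and> W \<subseteq> V \<and> length hs = length Xs \<and> set hs \<subseteq> hol W \<and>
              vres W X = vres W (lincomb hs Xs))))"

definition germs_independent :: "('n::finite) proj \<Rightarrow> 'n proj set \<Rightarrow> 'n vfield list \<Rightarrow> bool" where
  "germs_independent p U Xs \<longleftrightarrow>
     (\<forall>V hs. open V \<and> p \<in> V \<and> V \<subseteq> U \<and> length hs = length Xs \<and> set hs \<subseteq> hol V \<and>
        vres V (lincomb hs Xs) = vzero \<longrightarrow>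
        (\<forall>h\<in>set hs. \<forall>\<^sub>F q in nhds p. h q = 0))"

definition has_independent_germs :: "('n::finite) subsheaf \<Rightarrow> 'n proj \<Rightarrow> nat \<Rightarrow> bool" where
  "has_independent_germs T p r \<longleftrightarrow>
     (\<exists>U Xs. open U \<and> p \<in> U \<and> length Xs = r \<and> set Xs \<subseteq> T U \<and> germs_independent p U Xs)"

definition has_rank :: "('n::finite) subsheaf \<Rightarrow> nat \<Rightarrow> bool" where
  "has_rank T r \<longleftrightarrow> (\<forall>p. has_independent_germs T p r \<and> \<not> has_independent_germs T p (Suc r))"

definition torsion_free_quotient :: "('n::finite) subsheaf \<Rightarrow> bool" where
  "torsion_free_quotient T \<longleftrightarrow>
     (\<forall>U p X h. open U \<and> p \<in> U \<and> X \<in> TP U \<and> h \<in> hol U \<and>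
        \<not> (\<forall>\<^sub>F q in nhds p. h q = 0) \<and> vscale h X \<in> T U \<longrightarrow>
        (\<exists>V. open V \<and> p \<in> V \<and> V \<subseteq> U \<and> vres V X \<in> T V))"

text \<open>
  A distribution of dimension \<open>s\<close> is given by its tangent sheaf \<open>T\<close>; its normal sheaf is the
  quotient, of rank \<open>CARD('n) - 1 - s\<close>.
\<close>

definition distribution :: "nat \<Rightarrow> ('n::finite) subsheaf \<Rightarrow> bool" where
  "distribution s T \<longleftrightarrow>
     subsheaf_TP T \<and> finite_type T \<and> has_rank T s \<and> s + 1 \<le> CARD('n) - 1 \<and>
     torsion_free_quotient T"

definition integrable_dist :: "('n::finite) subsheaf \<Rightarrow> bool" where
  "integrable_dist T \<longleftrightarrow> (\<forall>U. open U \<longrightarrow> (\<forall>X\<in>T U. \<forall>Y\<in>T U. lie X Y \<in> T U))"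

text \<open>
  Sections over \<open>U\<close> of the sheaf \<open>Hom(\<Lambda>\<^sup>s T, O)\<close>: families, indexed by the open \<open>V \<subseteq> U\<close>, of
  \<open>hol V\<close>-multilinear alternating maps \<open>(T V)\<^sup>s \<rightarrow> hol V\<close> that commute with restriction.
  The values outside the intended domain are \<open>0\<close>, so equality of sections is equality.
\<close>

type_synonym 'n altform = "'n proj set \<Rightarrow> 'n vfield list \<Rightarrow> 'n proj \<Rightarrow> complex"

definition alt_forms :: "nat \<Rightarrow> ('n::finite) subsheaf \<Rightarrow> 'n proj set \<Rightarrow> 'n altform set" where
  "alt_forms s T U = {A.
     (\<forall>V Xs p. \<not> (open V \<and> V \<subseteq> U \<and> length Xs = s \<and> set Xs \<subseteq> T V \<and> p \<in> V) \<longrightarrow> A V Xs p = 0) \<and>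
     (\<forall>V Xs. open V \<and> V \<subseteq> U \<and> length Xs = s \<and> set Xs \<subseteq> T V \<longrightarrow>
        A V Xs \<in> hol V \<and>
        (\<forall>i<s. \<forall>X\<in>T V. \<forall>Y\<in>T V. \<forall>p\<in>V.
           A V (Xs[i := vadd X Y]) p = A V (Xs[i := X]) p + A V (Xs[i := Y]) p) \<and>
        (\<forall>i<s. \<forall>h\<in>hol V. \<forall>p\<in>V. A V (Xs[i := vscale h (Xs ! i)]) p = h p * A V Xs p) \<and>
        (\<forall>i<s. \<forall>j<s. i \<noteq> j \<and> Xs ! i = Xs ! j \<longrightarrow> (\<forall>p\<in>V. A V Xs p = 0)) \<and>
        (\<forall>W. open W \<and> W \<subseteq> V \<longrightarrow> (\<forall>p\<in>W. A W (map (vres W) Xs) p = A V Xs p)))}"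

definition altform_res :: "('n::finite) proj set \<Rightarrow> 'n altform \<Rightarrow> 'n altform" where
  "altform_res V A = (\<lambda>W Xs p. if W \<subseteq> V then A W Xs p else 0)"

text \<open>
  \<open>c\<^sub>1(T) = c\<close> for \<open>T\<close> of rank \<open>s\<close>. By definition \<open>c\<^sub>1(T) = c\<^sub>1(det T)\<close> where
  \<open>det T = (\<Lambda>\<^sup>s T)\<^sup>*\<^sup>*\<close>, and line bundles on projective space are classified by their first Chern
  class, so this says \<open>det T \<cong> O(c)\<close>. As \<open>(\<Lambda>\<^sup>s T)\<^sup>*\<close> is already reflexive, this is
  \<open>Hom(\<Lambda>\<^sup>s T, O) = (det T)\<^sup>* \<cong> O(-c)\<close>; \<open>\<Phi>\<close> is an isomorphism of sheaves of modules.
\<close>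

definition has_c1 :: "nat \<Rightarrow> ('n::finite) subsheaf \<Rightarrow> int \<Rightarrow> bool" where
  "has_c1 s T c \<longleftrightarrow>
     (\<exists>\<Phi> :: 'n proj set \<Rightarrow> (complex ^ 'n \<Rightarrow> complex) \<Rightarrow> 'n altform.
        \<forall>U. open U \<longrightarrow>
          bij_betw (\<Phi> U) (twist (- c) U) (alt_forms s T U) \<and>
          (\<forall>g\<in>twist (- c) U. \<forall>g'\<in>twist (- c) U.
             \<Phi> U (\<lambda>x. g x + g' x) = (\<lambda>V Xs p. \<Phi> U g V Xs p + \<Phi> U g' V Xs p)) \<and>
          (\<forall>h\<in>hol U. \<forall>g\<in>twist (- c) U.
             \<Phi> U (\<lambda>x. h (abs_proj x) * g x) = (\<lambda>V Xs p. h p * \<Phi> U g V Xs p)) \<and>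
          (\<forall>V. open V \<and> V \<subseteq> U \<longrightarrow>
             (\<forall>g\<in>twist (- c) U. \<Phi> V (twist_res V g) = altform_res V (\<Phi> U g))))"

definition has_degree :: "nat \<Rightarrow> ('n::finite) subsheaf \<Rightarrow> int \<Rightarrow> bool" where
  "has_degree s T d \<longleftrightarrow> (\<exists>c. has_c1 s T c \<and> d = int s - c)"

text \<open>
  A surjective linear map \<open>A\<close> induces the rational map \<open>[x] \<mapsto> [A x]\<close>, undefined on
  \<open>proj_center A\<close>, where \<open>lin_proj A\<close> takes junk values.
\<close>

definition proj_center :: "complex ^ ('n::finite) ^ ('m::finite) \<Rightarrow> 'n proj set" where
  "proj_center A = {p. A *v rep_proj p = 0}"

definition lin_proj :: "complex ^ ('n::finite) ^ ('m::finite) \<Rightarrow> 'n proj \<Rightarrow> 'm proj" where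
  "lin_proj A p = abs_proj (A *v rep_proj p)"

text \<open>Vector fields killed by the differential of the projection wherever the latter is defined.\<close>

definition relative_tangent :: "complex ^ ('n::finite) ^ ('m::finite) \<Rightarrow> 'n subsheaf" where
  "relative_tangent A U = {X \<in> TP U.
     \<forall>p\<in>U - proj_center A. \<forall>V g. open V \<and> lin_proj A p \<in> V \<and> g \<in> hol V \<longrightarrow>
       X p (\<lambda>q. g (lin_proj A q)) = 0}"

definition tangent_to_projection ::
    "('n::finite) subsheaf \<Rightarrow> complex ^ 'n ^ ('m::finite) \<Rightarrow> bool" where
  "tangent_to_projection T A \<longleftrightarrow>
     surj (\<lambda>x. A *v x) \<and> (\<forall>U. open U \<longrightarrow> T U = relative_tangent A U)"

text \<open>
  The distribution is non-singular if its normal sheaf is locally free: the classes of \<open>Ys\<close> form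
  a basis of the normal sheaf over \<open>U\<close>.
\<close>

definition nonsingular_dist :: "nat \<Rightarrow> ('n::finite) subsheaf \<Rightarrow> bool" where
  "nonsingular_dist s T \<longleftrightarrow>
     (\<forall>p. \<exists>U Ys. open U \<and> p \<in> U \<and> length Ys = CARD('n) - 1 - s \<and> set Ys \<subseteq> TP U \<and>
        (\<forall>V. open V \<and> V \<subseteq> U \<longrightarrow>
           (\<forall>X\<in>TP V. \<exists>hs. length hs = length Ys \<and> set hs \<subseteq> hol V \<and>
              vdiff X (vres V (lincomb hs Ys)) \<in> T V) \<and>
           (\<forall>hs. length hs = length Ys \<and> set hs \<subseteq> hol V \<and> vres V (lincomb hs Ys) \<in> T V \<longrightarrow>
              (\<forall>h\<in>set hs. \<forall>q\<in>V. h q = 0))))"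

definition fibre_at :: "('n::finite) subsheaf \<Rightarrow> 'n proj \<Rightarrow> (('n proj \<Rightarrow> complex) \<Rightarrow> complex) set" where
  "fibre_at T p = {Z p | Z V. open V \<and> p \<in> V \<and> Z \<in> T V}"

definition everywhere_nonintegrable :: "('n::finite) subsheaf \<Rightarrow> bool" where
  "everywhere_nonintegrable T \<longleftrightarrow>
     (\<forall>p. \<exists>U X Y. open U \<and> p \<in> U \<and> X \<in> T U \<and> Y \<in> T U \<and> lie X Y p \<notin> fibre_at T p)"

definition contact_structure :: "('n::finite) subsheaf \<Rightarrow> bool" where
  "contact_structure T \<longleftrightarrow>
     CARD('n) = 4 \<and> distribution 2 T \<and> has_degree 2 T 0 \<and>
     nonsingular_dist 2 T \<and> everywhere_nonintegrable T"

end

theory Submission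
  imports Defs "HOL-Complex_Analysis.Conformal_Mappings"
begin

text \<open>
  Degree zero means \<open>det T = O(2)\<close>, so the dual of \<open>\<Lambda>\<^sup>2 T\<close> is \<open>O(-2)\<close>. Restricting the 2-forms
  \<open>d(x\<^sub>i/x\<^sub>k) \<and> d(x\<^sub>j/x\<^sub>k)\<close> to \<open>T\<close> yields sections of \<open>O(-2)\<close>; multiplied by \<open>x\<^sub>k\<^sup>3\<close> they become the
  components of a trivector on the cone, homogeneous of degree 1. By Liouville's theorem this
  trivector is linear in \<open>x\<close>, and since its wedge product with \<open>x\<close> vanishes, it equals \<open>x \<and> \<omega>\<close> for a
  constant bivector \<open>\<omega>\<close>. As \<open>T\<close> has rank 2 and a torsion free quotient, a vector field with lift \<open>\<zeta>\<close>
  to the cone belongs to \<open>T\<close> iff \<open>\<zeta> \<and> x \<and> \<omega> = 0\<close>.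

  At generic points \<open>x \<and> \<omega>\<close> is decomposable, so \<open>x \<and> \<omega> \<and> \<omega> = 0\<close> for all \<open>x\<close>. Hence either
  \<open>\<omega> = a \<and> b\<close>, and the leaves are the fibres of the linear projection with kernel spanned by \<open>a\<close>
  and \<open>b\<close>, or \<open>\<omega> \<and> \<omega> \<noteq> 0\<close>. The latter forces \<open>n = 3\<close>, and \<open>T\<close> is then the kernel of the contact form
  \<open>\<eta>(x, \<zeta>) = \<zeta> \<and> x \<and> \<omega>\<close>, where \<open>\<eta>\<close> is a nondegenerate alternating form.
\<close>

section \<open>Holomorphic functions of several variables\<close>

text \<open>\<open>T\<close> is not known to be locally free: two sections with independent germs
  may become dependent at some points. Hence \<open>T\<close> and \<omega> are compared on germs,
  where nonzero factors cancel, and torsion freeness of the quotient leads back from a multiple of a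
  field to the field itself. The isomorphism with O(-2) is abstract. Its surjectivity turns a 2-form
  on a chart into a function on the cone; its injectivity turns identities of forms into identities
  of functions.

  The exponent 3 arises because the form of a pair i, j takes on fields with lifts \<xi>, \<eta> the
  value \<open>(x \<and> \<xi> \<and> \<eta>)\<close> at i, j, k divided by the cube of the k-th
  coordinate. The relation x \<and> x \<and> \<xi> \<and> \<eta> = 0 serves twice: it glues the
  charts, and it makes the trivector divisible by x.

  Holomorphy is only complex Frechet differentiability at each point, so Cauchy's formula has to
  supply the continuity of derivatives before Hadamard's lemma is available for derivations.\<close>

lemma linear_smult_left: "bounded_linear (\<lambda>c::complex. c *s (v :: complex ^ 'n))"
  by (auto intro!: linearI simp: linear_conv_bounded_linear[symmetric] vec_eq_iff algebra_simps)

lemma linear_smult_right: "bounded_linear (\<lambda>v :: complex ^ 'n. c *s v)"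
  by (auto intro!: linearI simp: linear_conv_bounded_linear[symmetric] vec_eq_iff algebra_simps)

lemma scaleR_eq_smult: "r *\<^sub>R (v :: complex ^ 'n) = complex_of_real r *s v"
  by (simp add: vec_eq_iff scaleR_conv_of_real[symmetric])

lemma continuous_on_smult [continuous_intros]:
  assumes "continuous_on S c" "continuous_on S v"
  shows "continuous_on S (\<lambda>x. c x *s (v x :: complex ^ 'n))"
  using assms unfolding vector_scalar_mult_def by (intro continuous_intros) auto

lemma norm_smult: "norm (c *s (v :: complex ^ 'n)) = norm c * norm v"
  by (simp add: norm_vec_def L2_set_def norm_mult power_mult_distrib sum_distrib_left[symmetric] real_sqrt_mult)

definition has_cderiv :: "(complex ^ 'n \<Rightarrow> complex) \<Rightarrow> (complex ^ 'n \<Rightarrow> complex) \<Rightarrow> complex ^ 'n \<Rightarrow> bool" where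
  "has_cderiv f D x \<longleftrightarrow> (f has_derivative D) (at x) \<and> (\<forall>c v. D (c *s v) = c * D v)"

lemma cholomorphic_on_iff: "cholomorphic_on f S \<longleftrightarrow> (\<forall>x\<in>S. \<exists>D. has_cderiv f D x)"
  by (simp add: cholomorphic_on_def has_cderiv_def)

lemma has_cderiv_smult: "has_cderiv f D x \<Longrightarrow> D (c *s v) = c * D v"
  by (simp add: has_cderiv_def)

lemma has_cderiv_linear: "has_cderiv f D x \<Longrightarrow> linear D"
  by (auto simp: has_cderiv_def dest: has_derivative_linear)

lemma has_cderiv_add_arg: "has_cderiv f D x \<Longrightarrow> D (u + v) = D u + D v"
  by (simp add: has_cderiv_linear linear_add)

lemma has_cderiv_expand:
  assumes "has_cderiv f D x"
  shows "D v = (\<Sum>i\<in>UNIV. v $ i * D (axis i 1))"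
proof -
  have "D v = D (\<Sum>i\<in>UNIV. v $ i *s axis i 1)"
    by (simp add: basis_expansion)
  also have "\<dots> = (\<Sum>i\<in>UNIV. D (v $ i *s axis i 1))"
    by (rule linear_sum[OF has_cderiv_linear[OF assms]])
  finally show ?thesis
    by (simp add: has_cderiv_smult[OF assms])
qed

lemma has_cderiv_unique: "has_cderiv f D x \<Longrightarrow> has_cderiv f D' x \<Longrightarrow> D = D'"
  by (auto simp: has_cderiv_def intro: has_derivative_unique)

lemma has_cderiv_cong:
  assumes "has_cderiv f D x" "open S" "x \<in> S" "\<And>y. y \<in> S \<Longrightarrow> f y = g y"
  shows "has_cderiv g D x"
  using assms has_derivative_transform_within_open[of f D x UNIV S g] by (auto simp: has_cderiv_def)

lemma has_cderiv_const: "has_cderiv (\<lambda>x. a) (\<lambda>v. 0) x"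
  by (simp add: has_cderiv_def)

lemma has_cderiv_component: "has_cderiv (\<lambda>x. x $ i) (\<lambda>v. v $ i) x"
  by (auto simp: has_cderiv_def intro!: bounded_linear_imp_has_derivative bounded_linear_vec_nth)

lemma has_cderiv_add:
  "has_cderiv f D x \<Longrightarrow> has_cderiv g E x \<Longrightarrow> has_cderiv (\<lambda>x. f x + g x) (\<lambda>v. D v + E v) x"
  by (auto simp: has_cderiv_def algebra_simps intro!: derivative_eq_intros)

lemma has_cderiv_diff:
  "has_cderiv f D x \<Longrightarrow> has_cderiv g E x \<Longrightarrow> has_cderiv (\<lambda>x. f x - g x) (\<lambda>v. D v - E v) x"
  by (auto simp: has_cderiv_def algebra_simps intro!: derivative_eq_intros)

lemma has_cderiv_minus:
  "has_cderiv f D x \<Longrightarrow> has_cderiv (\<lambda>x. - f x) (\<lambda>v. - D v) x"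
  by (auto simp: has_cderiv_def algebra_simps intro!: derivative_eq_intros)

lemma has_cderiv_mult:
  "has_cderiv f D x \<Longrightarrow> has_cderiv g E x \<Longrightarrow>
    has_cderiv (\<lambda>x. f x * g x) (\<lambda>v. f x * E v + D v * g x) x"
  by (auto simp: has_cderiv_def algebra_simps intro!: derivative_eq_intros)

lemma has_cderiv_sum:
  "(\<And>i. i \<in> I \<Longrightarrow> has_cderiv (f i) (D i) x) \<Longrightarrow>
    has_cderiv (\<lambda>x. \<Sum>i\<in>I. f i x) (\<lambda>v. \<Sum>i\<in>I. D i v) x"
  by (auto simp: has_cderiv_def algebra_simps sum_distrib_left intro!: derivative_eq_intros sum.cong)

lemma has_cderiv_inverse:
  "has_cderiv f D x \<Longrightarrow> f x \<noteq> 0 \<Longrightarrow>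
    has_cderiv (\<lambda>x. inverse (f x)) (\<lambda>v. - (D v / (f x)\<^sup>2)) x"
  by (auto simp: has_cderiv_def field_simps power2_eq_square intro!: derivative_eq_intros)

lemma has_cderiv_divide:
  assumes "has_cderiv f D x" "has_cderiv g E x" "g x \<noteq> 0"
  shows "has_cderiv (\<lambda>x. f x / g x) (\<lambda>v. (D v * g x - f x * E v) / (g x)\<^sup>2) x"
proof -
  have "(\<lambda>v. f x * - (E v / (g x)\<^sup>2) + D v * inverse (g x)) =
        (\<lambda>v. (D v * g x - f x * E v) / (g x)\<^sup>2)"
    using assms(3) by (auto simp: field_simps power2_eq_square)
  with has_cderiv_mult[OF assms(1) has_cderiv_inverse[OF assms(2,3)]] show ?thesis
    by (simp add: divide_inverse)
qed

lemma has_cderiv_compose: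
  assumes "(h has_derivative H) (at x)" "\<And>c v. H (c *s v) = c *s H v" "has_cderiv f D (h x)"
  shows "has_cderiv (\<lambda>x. f (h x)) (\<lambda>v. D (H v)) x"
proof -
  have "((f \<circ> h) has_derivative (D \<circ> H)) (at x)"
    using assms by (intro diff_chain_at) (auto simp: has_cderiv_def)
  then show ?thesis
    using assms by (auto simp: has_cderiv_def o_def)
qed

lemma has_cderiv_affine:
  assumes "has_cderiv f D (a + c *s x)"
  shows "has_cderiv (\<lambda>x. f (a + c *s x)) (\<lambda>v. c * D v) x"
proof -
  have "((\<lambda>x. a + c *s x) has_derivative (\<lambda>v. c *s v)) (at x)"
    by (auto intro!: derivative_eq_intros bounded_linear_imp_has_derivative linear_smult_right)
  then have "has_cderiv (\<lambda>x. f (a + c *s x)) (\<lambda>v. D (c *s v)) x"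
    by (rule has_cderiv_compose) (auto simp: assms vector_smult_assoc mult.commute)
  then show ?thesis
    by (simp add: has_cderiv_smult[OF assms])
qed

lemma has_cderiv_vec:
  fixes h :: "complex ^ 'n \<Rightarrow> complex ^ 'm"
  assumes "\<And>i. has_cderiv (\<lambda>x. h x $ i) (H i) x" "has_cderiv f D (h x)"
  shows "has_cderiv (\<lambda>x. f (h x)) (\<lambda>v. D (\<chi> i. H i v)) x"
proof (rule has_cderiv_compose[of h _ x f D])
  have "(h has_derivative (\<lambda>v. \<chi> i. H i v)) (at x)"
  proof (subst has_derivative_componentwise_within, intro ballI)
    fix b :: "complex ^ 'm"
    assume "b \<in> Basis"
    then obtain i e where b: "b = axis i e" "e \<in> Basis"
      by (auto simp: Basis_vec_def)
    have "((\<lambda>x. h x $ i) has_derivative H i) (at x)"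
      using assms(1) by (auto simp: has_cderiv_def)
    then have "((\<lambda>x. h x $ i \<bullet> e) has_derivative (\<lambda>v. H i v \<bullet> e)) (at x)"
      by (auto intro!: derivative_eq_intros)
    then show "((\<lambda>x. h x \<bullet> b) has_derivative (\<lambda>v. (\<chi> i. H i v) \<bullet> b)) (at x)"
      by (simp add: b inner_axis)
  qed
  then show "(h has_derivative (\<lambda>v. \<chi> i. H i v)) (at x)" .
qed (use assms in \<open>auto simp: has_cderiv_def vec_eq_iff\<close>)

lemma has_cderiv_line:
  assumes "has_cderiv f D (x + t *s y)"
  shows "((\<lambda>t. f (x + t *s y)) has_field_derivative D y) (at t)"
proof -
  have "((\<lambda>t. x + t *s y) has_derivative (\<lambda>t. t *s y)) (at t)"
    by (auto intro!: derivative_eq_intros bounded_linear_imp_has_derivative linear_smult_left)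
  then have "((f \<circ> (\<lambda>t. x + t *s y)) has_derivative (D \<circ> (\<lambda>t. t *s y))) (at t)"
    using assms by (intro diff_chain_at) (auto simp: has_cderiv_def)
  moreover have "D \<circ> (\<lambda>t. t *s y) = (*) (D y)"
    by (rule ext) (simp add: has_cderiv_smult[OF assms])
  ultimately show ?thesis
    by (simp only: has_field_derivative_def o_def)
qed

lemma cholomorphic_on_subset: "cholomorphic_on f S \<Longrightarrow> T \<subseteq> S \<Longrightarrow> cholomorphic_on f T"
  by (auto simp: cholomorphic_on_def)

lemma cholomorphic_on_cong:
  "open S \<Longrightarrow> (\<And>x. x \<in> S \<Longrightarrow> f x = g x) \<Longrightarrow> cholomorphic_on f S \<longleftrightarrow> cholomorphic_on g S"
  unfolding cholomorphic_on_iff using has_cderiv_cong[of f _ _ S g] has_cderiv_cong[of g _ _ S f]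
  by (intro ball_cong refl iffI) (metis (full_types))+

lemma cholomorphic_on_local:
  "(\<And>x. x \<in> S \<Longrightarrow> \<exists>W. x \<in> W \<and> cholomorphic_on f W) \<Longrightarrow> cholomorphic_on f S"
  by (auto simp: cholomorphic_on_iff)

lemma cholomorphic_on_continuous: "cholomorphic_on f S \<Longrightarrow> continuous_on S f"
  unfolding cholomorphic_on_def
  by (meson continuous_at_imp_continuous_on has_derivative_continuous)

lemma cholomorphic_const: "cholomorphic_on (\<lambda>x. c) S"
  unfolding cholomorphic_on_iff by (fast intro: has_cderiv_const)

lemma cholomorphic_component: "cholomorphic_on (\<lambda>x. x $ i) S"
  unfolding cholomorphic_on_iff by (fast intro: has_cderiv_component)

lemma cholomorphic_add: "cholomorphic_on f S \<Longrightarrow> cholomorphic_on g S \<Longrightarrow> cholomorphic_on (\<lambda>x. f x + g x) S"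
  unfolding cholomorphic_on_iff by (fast intro: has_cderiv_add)

lemma cholomorphic_diff: "cholomorphic_on f S \<Longrightarrow> cholomorphic_on g S \<Longrightarrow> cholomorphic_on (\<lambda>x. f x - g x) S"
  unfolding cholomorphic_on_iff by (fast intro: has_cderiv_diff)

lemma cholomorphic_mult: "cholomorphic_on f S \<Longrightarrow> cholomorphic_on g S \<Longrightarrow> cholomorphic_on (\<lambda>x. f x * g x) S"
  unfolding cholomorphic_on_iff by (fast intro: has_cderiv_mult)

lemma cholomorphic_minus: "cholomorphic_on f S \<Longrightarrow> cholomorphic_on (\<lambda>x. - f x) S"
  unfolding cholomorphic_on_iff by (fast intro: has_cderiv_minus)

lemma cholomorphic_divide: "cholomorphic_on f S \<Longrightarrow> cholomorphic_on g S \<Longrightarrow> (\<And>x. x \<in> S \<Longrightarrow> g x \<noteq> 0)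
    \<Longrightarrow> cholomorphic_on (\<lambda>x. f x / g x) S"
  unfolding cholomorphic_on_iff by (fast intro: has_cderiv_divide)

lemma cholomorphic_power: "cholomorphic_on f S \<Longrightarrow> cholomorphic_on (\<lambda>x. f x ^ k) S"
  by (induction k) (auto intro: cholomorphic_const cholomorphic_mult)

lemma cholomorphic_sum:
  "(\<And>i. i \<in> I \<Longrightarrow> cholomorphic_on (f i) S) \<Longrightarrow> cholomorphic_on (\<lambda>x. \<Sum>i\<in>I. f i x) S"
  by (induction I rule: infinite_finite_induct) (auto intro: cholomorphic_const cholomorphic_add)

lemmas cholomorphic_intros = cholomorphic_const cholomorphic_component cholomorphic_add cholomorphic_diff
  cholomorphic_minus cholomorphic_mult cholomorphic_divide cholomorphic_power cholomorphic_sum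

lemma cholomorphic_compose:
  fixes h :: "complex ^ 'n \<Rightarrow> complex ^ 'm"
  assumes "\<And>i. cholomorphic_on (\<lambda>x. h x $ i) S" "cholomorphic_on f T" "h ` S \<subseteq> T"
  shows "cholomorphic_on (\<lambda>x. f (h x)) S"
  unfolding cholomorphic_on_iff
proof
  fix x assume x: "x \<in> S"
  then have "\<forall>i. \<exists>D. has_cderiv (\<lambda>x. h x $ i) D x"
    using assms(1) by (auto simp: cholomorphic_on_iff)
  then obtain H where "\<And>i. has_cderiv (\<lambda>x. h x $ i) (H i) x"
    by metis
  moreover obtain D where "has_cderiv f D (h x)"
    using assms(2,3) x unfolding cholomorphic_on_iff by blast
  ultimately show "\<exists>D. has_cderiv (\<lambda>x. f (h x)) D x"
    using has_cderiv_vec by blast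
qed

lemma cholomorphic_line:
  assumes "cholomorphic_on f S"
  shows "(\<lambda>t. f (x + t *s y)) holomorphic_on {t. x + t *s y \<in> S}"
  unfolding holomorphic_on_def
proof
  fix t assume "t \<in> {t. x + t *s y \<in> S}"
  then obtain D where "has_cderiv f D (x + t *s y)"
    using assms by (auto simp: cholomorphic_on_iff)
  from has_cderiv_line[OF this]
  show "(\<lambda>t. f (x + t *s y)) field_differentiable at t within {t. x + t *s y \<in> S}"
    using field_differentiable_at_within field_differentiable_def by blast
qed

section \<open>Cauchy's formula and its consequences: regularity of derivatives, Hadamard's lemma,
  identity theorem\<close>

lemma has_integral_circle_derivative:
  fixes \<phi> :: "complex \<Rightarrow> complex"
  assumes "\<phi> holomorphic_on S" "open S" "cball 0 r \<subseteq> S" "r > 0"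
  shows "((\<lambda>t. \<phi> (r * exp (2 * of_real pi * \<i> * of_real t)) / (r * exp (2 * of_real pi * \<i> * of_real t)))
     has_integral deriv \<phi> 0) {0..1}"
proof -
  have "ball 0 r \<subseteq> S"
    using assms(3) ball_subset_cball by blast
  with assms have "((\<lambda>u. \<phi> u / (u - 0) ^ Suc 1) has_contour_integral ((2 * pi * \<i>) / (fact 1) * (deriv ^^ 1) \<phi> 0))
      (circlepath 0 r)"
    by (intro Cauchy_has_contour_integral_higher_derivative_circlepath)
      (auto intro: holomorphic_on_subset holomorphic_on_imp_continuous_on)
  then have "((\<lambda>t. \<phi> (r * exp (2 * of_real pi * \<i> * of_real t)) / (r * exp (2 * of_real pi * \<i> * of_real t))\<^sup>2
      * (2 * pi * \<i> * r * exp (2 * of_real pi * \<i> * of_real t))) has_integral (2 * pi * \<i> * deriv \<phi> 0)) {0..1}"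
    unfolding has_contour_integral_def
    by (rule has_integral_eq[rotated, where f="\<lambda>x. \<phi> (circlepath 0 r x) / (circlepath 0 r x - 0) ^ Suc 1 *
          vector_derivative (circlepath 0 r) (at x within {0..1})", THEN has_integral_eq_rhs])
      (simp_all add: vector_derivative_circlepath01, simp_all add: circlepath power2_eq_square)
  then have "((\<lambda>t. 1 / (2 * pi * \<i>) * (\<phi> (r * exp (2 * of_real pi * \<i> * of_real t)) / (r * exp (2 * of_real pi * \<i> * of_real t))\<^sup>2
      * (2 * pi * \<i> * r * exp (2 * of_real pi * \<i> * of_real t)))) has_integral 1 / (2 * pi * \<i>) * (2 * pi * \<i> * deriv \<phi> 0)) {0..1}"
    by (rule has_integral_mult_right)
  then show ?thesis
    using \<open>r > 0\<close> by (simp add: power2_eq_square field_simps)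
qed

definition circ :: "real \<Rightarrow> real \<Rightarrow> complex" where
  "circ r t = r * exp (2 * of_real pi * \<i> * of_real t)"

lemma norm_circ: "r \<ge> 0 \<Longrightarrow> norm (circ r t) = r"
  by (simp add: circ_def norm_mult)

lemma circ_nonzero: "r > 0 \<Longrightarrow> circ r t \<noteq> 0"
  by (simp add: circ_def)

lemma continuous_circ: "continuous_on S (\<lambda>p. circ r (g p))" if "continuous_on S g"
  using that unfolding circ_def by (intro continuous_intros)

text \<open>One-variable Cauchy formula for \<open>t \<mapsto> f (x + t *s v)\<close> at 0;
  \<open>norm v \<le> 1\<close> keeps the circle inside \<open>cball x r\<close>. It expresses a
  derivative by values of \<open>f\<close> alone, which is the source of all regularity
  below.\<close>

lemma cauchy_has_cderiv:
  assumes f: "cholomorphic_on f S" "open S" and D: "has_cderiv f D x"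
    and r: "r > 0" "cball x r \<subseteq> S" and v: "norm v \<le> 1"
  shows "((\<lambda>t. f (x + circ r t *s v) / circ r t) has_integral D v) {0..1}"
proof -
  let ?T = "{t. x + t *s v \<in> S}"
  have T: "?T = (\<lambda>t. x + t *s v) -` S"
    by auto
  have "open ?T"
    unfolding T by (intro open_vimage \<open>open S\<close> continuous_intros)
  moreover have "cball 0 r \<subseteq> ?T"
  proof
    fix t :: complex
    assume "t \<in> cball 0 r"
    then have "norm (t *s v) \<le> r"
      using v mult_mono[of "norm t" r "norm v" 1] r by (simp add: norm_smult)
    then show "t \<in> ?T"
      using r(2) by (auto simp: subset_iff dist_norm)
  qed
  ultimately have "((\<lambda>t. f (x + circ r t *s v) / circ r t) has_integral deriv (\<lambda>t. f (x + t *s v)) 0) {0..1}"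
    unfolding circ_def using r by (intro has_integral_circle_derivative[OF cholomorphic_line[OF f(1)]]) auto
  moreover have "deriv (\<lambda>t. f (x + t *s v)) 0 = D v"
    by (rule DERIV_imp_deriv, rule has_cderiv_line) (use D in simp)
  ultimately show ?thesis by simp
qed

text \<open>Differentiation under the integral sign requires the derivative to be continuous in
  parameter and point jointly. The definition of \<open>cholomorphic_on\<close> does not contain
  this, but Cauchy's formula writes the derivative as an integral of \<open>h\<close>
  itself.\<close>

lemma cholomorphic_integral:
  fixes h :: "real \<Rightarrow> complex ^ 'n \<Rightarrow> complex"
  assumes cont: "continuous_on ({0..1} \<times> S) (\<lambda>(t, x). h t x)" and S: "open S"
    and hol: "\<And>t. t \<in> {0..1} \<Longrightarrow> cholomorphic_on (h t) S"
  shows "cholomorphic_on (\<lambda>x. integral {0..1} (\<lambda>t. h t x)) S"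
  unfolding cholomorphic_on_iff
proof
  fix x0 assume x0: "x0 \<in> S"
  then obtain e where e: "e > 0" "cball x0 e \<subseteq> S"
    using S open_contains_cball by metis
  \<comment> \<open>Half the radius: closed balls of radius \<open>r\<close> about points of
    \<open>ball x0 r\<close> stay in \<open>S\<close>.\<close>
  define r where "r = e / 2"
  have r: "r > 0" using e by (simp add: r_def)
  have sub: "cball x r \<subseteq> S" if "x \<in> ball x0 r" for x
  proof
    fix y assume "y \<in> cball x r"
    then have "dist x0 y \<le> e"
      using that dist_triangle[of x0 y x] by (auto simp: r_def)
    then show "y \<in> S" using e by auto
  qed
  have "\<forall>t\<in>{0..1}. \<forall>x\<in>ball x0 r. \<exists>D. has_cderiv (h t) D x"
    using hol sub r unfolding cholomorphic_on_iff by (meson centre_in_cball less_imp_le subsetD)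
  then obtain D where D: "\<And>t x. t \<in> {0..1} \<Longrightarrow> x \<in> ball x0 r \<Longrightarrow> has_cderiv (h t) (D t x) x"
    by metis
  define E where "E = (\<lambda>x t. if t \<in> {0..1} \<and> x \<in> ball x0 r then Blinfun (D t x) else 0)"
  have E: "blinfun_apply (E x t) = D t x" if "t \<in> {0..1}" "x \<in> ball x0 r" for t x
    using D[OF that] that by (auto simp: E_def has_cderiv_def has_derivative_def bounded_linear_Blinfun_apply)
  have cauchy: "D t x v = integral {0..1} (\<lambda>s. h t (x + circ r s *s v) / circ r s)"
    if "t \<in> {0..1}" "x \<in> ball x0 r" "norm v \<le> 1" for t x v
    using cauchy_has_cderiv[OF hol[OF that(1)] S D[OF that(1,2)] r sub[OF that(2)] that(3)]
    by (simp add: integral_unique)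
  have cE: "continuous_on (ball x0 r \<times> cbox 0 1) (\<lambda>(x, t). E x t)"
  proof (rule continuous_on_blinfun_componentwise)
    fix v :: "complex ^ 'n" assume "v \<in> Basis"
    then have v: "norm v = 1" by simp
    have "continuous_on ((ball x0 r \<times> cbox 0 (1::real)) \<times> cbox 0 (1::real))
        (\<lambda>(p, s). h (snd p) (fst p + circ r s *s v) / circ r s)"
    proof -
      have "continuous_on ((ball x0 r \<times> cbox 0 (1::real)) \<times> cbox 0 (1::real))
        ((\<lambda>(t, x). h t x) \<circ> (\<lambda>q. (snd (fst q), fst (fst q) + circ r (snd q) *s v)))"
      proof (rule continuous_on_compose)
        show "continuous_on ((ball x0 r \<times> cbox 0 (1::real)) \<times> cbox 0 (1::real))
            (\<lambda>q. (snd (fst q), fst (fst q) + circ r (snd q) *s v))"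
          by (intro continuous_intros continuous_circ)
        have "fst (fst q) + circ r (snd q) *s v \<in> S" if "q \<in> (ball x0 r \<times> cbox 0 (1::real)) \<times> cbox 0 (1::real)" for q
        proof -
          have "fst (fst q) \<in> ball x0 r" using that by (auto simp: mem_Times_iff)
          moreover have "fst (fst q) + circ r (snd q) *s v \<in> cball (fst (fst q)) r"
            using r v by (simp add: dist_norm norm_smult norm_circ)
          ultimately show ?thesis using sub by blast
        qed
        then have "(snd (fst q), fst (fst q) + circ r (snd q) *s v) \<in> {0..1} \<times> S"
          if "q \<in> (ball x0 r \<times> cbox 0 (1::real)) \<times> cbox 0 (1::real)" for q
          using that[unfolded mem_Times_iff cbox_interval] that unfolding mem_Times_iff by (simp add: box_real)
        then have "(\<lambda>q. (snd (fst q), fst (fst q) + circ r (snd q) *s v)) `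
            ((ball x0 r \<times> cbox 0 (1::real)) \<times> cbox 0 (1::real)) \<subseteq> {0..1} \<times> S"
          by (rule image_subsetI)
        then show "continuous_on ((\<lambda>q. (snd (fst q), fst (fst q) + circ r (snd q) *s v)) `
            ((ball x0 r \<times> cbox 0 (1::real)) \<times> cbox 0 (1::real))) (\<lambda>(t, x). h t x)"
          by (rule continuous_on_subset[OF cont])
      qed
      then have "continuous_on ((ball x0 r \<times> cbox 0 (1::real)) \<times> cbox 0 (1::real))
          (\<lambda>q. ((\<lambda>(t, x). h t x) \<circ> (\<lambda>q. (snd (fst q), fst (fst q) + circ r (snd q) *s v))) q / circ r (snd q))"
        by (intro continuous_on_divide continuous_circ) (auto simp: circ_nonzero r intro!: continuous_intros)
      then show ?thesis by (simp add: split_beta o_def)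
    qed
    then have "continuous_on (ball x0 r \<times> cbox 0 1)
        (\<lambda>p. integral (cbox 0 (1::real)) (\<lambda>s. h (snd p) (fst p + circ r s *s v) / circ r s))"
      by (rule integral_continuous_on_param)
    moreover have "(case p of (x, t) \<Rightarrow> E x t) v =
        integral (cbox 0 (1::real)) (\<lambda>s. h (snd p) (fst p + circ r s *s v) / circ r s)"
      if "p \<in> ball x0 r \<times> cbox 0 1" for p
      using that E[of "snd p" "fst p"] cauchy[of "snd p" "fst p" v] v
      by (auto simp: mem_Times_iff split_beta)
    ultimately show "continuous_on (ball x0 r \<times> cbox 0 1) (\<lambda>p. (case p of (x, t) \<Rightarrow> E x t) v)"
      by (simp cong: continuous_on_cong)
  qed
  have "((\<lambda>x. integral (cbox 0 1) (\<lambda>t. h t x)) has_derivative integral (cbox 0 1) (E x0)) (at x0 within ball x0 r)"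
  proof (rule leibniz_rule[OF _ _ cE])
    fix x and t :: real assume "x \<in> ball x0 r" "t \<in> cbox 0 1"
    then show "(h t has_derivative blinfun_apply (E x t)) (at x within ball x0 r)"
      using E[of t x] D[of t x] by (auto simp: has_cderiv_def intro: has_derivative_at_withinI)
  next
    fix x assume "x \<in> ball x0 r"
    then have "x \<in> S" using sub[of x] r by (auto simp: subset_iff)
    then have "continuous_on {0..1} ((\<lambda>(t, x). h t x) \<circ> (\<lambda>t. (t, x)))"
      by (intro continuous_on_compose continuous_on_subset[OF cont] continuous_intros) auto
    then show "(\<lambda>t. h t x) integrable_on cbox 0 1"
      by (intro integrable_continuous) (simp add: o_def)
  qed (use r in auto)
  then have "((\<lambda>x. integral {0..1} (\<lambda>t. h t x)) has_derivative integral {0..1} (E x0)) (at x0)"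
    using r by (simp add: at_within_open[of x0 "ball x0 r"])
  moreover have Eint: "E x0 integrable_on {0..1}"
  proof -
    have "continuous_on {0..1} ((\<lambda>(x, t). E x t) \<circ> (\<lambda>t. (x0, t)))"
      using r by (intro continuous_on_compose continuous_on_subset[OF cE] continuous_intros) auto
    then show ?thesis
      by (simp add: o_def integrable_continuous_real)
  qed
  moreover have "blinfun_apply (integral {0..1} (E x0)) (c *s v) = c * blinfun_apply (integral {0..1} (E x0)) v" for c v
  proof -
    have *: "blinfun_apply (E x0 t) (c *s v) = c * blinfun_apply (E x0 t) v" if "t \<in> {0..1}" for t
      using E[OF that, of x0] D[OF that, of x0] r by (simp add: has_cderiv_def)
    have "integral {0..1} (\<lambda>t. blinfun_apply (E x0 t) (c *s v)) = integral {0..1} (\<lambda>t. c * blinfun_apply (E x0 t) v)"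
      by (rule integral_cong) (use * in auto)
    then show ?thesis
      by (simp add: blinfun_apply_integral[OF Eint])
  qed
  ultimately show "\<exists>D. has_cderiv (\<lambda>x. integral {0..1} (\<lambda>t. h t x)) D x0"
    unfolding has_cderiv_def by blast
qed

definition cderiv :: "(complex ^ 'n \<Rightarrow> complex) \<Rightarrow> complex ^ 'n \<Rightarrow> complex ^ 'n \<Rightarrow> complex" where
  "cderiv f x = (SOME D. has_cderiv f D x)"

lemma has_cderiv_cderiv: "cholomorphic_on f S \<Longrightarrow> x \<in> S \<Longrightarrow> has_cderiv f (cderiv f x) x"
  unfolding cderiv_def cholomorphic_on_iff using someI_ex[of "\<lambda>D. has_cderiv f D x"] by blast

lemma cderiv_eq: "has_cderiv f D x \<Longrightarrow> cderiv f x = D"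
  unfolding cderiv_def by (rule some_equality) (auto intro: has_cderiv_unique)

lemma cderiv_cong: "open S \<Longrightarrow> x \<in> S \<Longrightarrow> (\<And>y. y \<in> S \<Longrightarrow> f y = g y) \<Longrightarrow> cderiv f x = cderiv g x"
  unfolding cderiv_def by (metis (no_types, lifting) has_cderiv_cong)

text \<open>By Cauchy's formula a partial derivative is an integral of translates of
  \<open>f\<close> over a fixed circle, so \<open>cholomorphic_integral\<close> applies.\<close>

lemma cholomorphic_cderiv:
  assumes f: "cholomorphic_on f S" and S: "open S"
  shows "cholomorphic_on (\<lambda>x. cderiv f x (axis i 1)) S"
proof (rule cholomorphic_on_local)
  fix x0 assume x0: "x0 \<in> S"
  then obtain e where e: "e > 0" "cball x0 e \<subseteq> S"
    using S open_contains_cball by metis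
  define r where "r = e / 2"
  have r: "r > 0" using e by (simp add: r_def)
  have sub: "cball x r \<subseteq> S" if "x \<in> ball x0 r" for x
  proof
    fix y assume "y \<in> cball x r"
    then have "dist x0 y \<le> e"
      using that dist_triangle[of x0 y x] by (auto simp: r_def)
    then show "y \<in> S" using e by auto
  qed
  let ?v = "axis i 1 :: complex ^ 'a"
  have v: "norm ?v = 1"
    by (rule norm_Basis) (simp add: axis_in_Basis_iff Basis_complex_def)
  have in_S: "x + circ r t *s ?v \<in> S" if "x \<in> ball x0 r" for x t
    using sub[OF that] r v by (auto simp: subset_iff dist_norm norm_smult norm_circ)
  have "cholomorphic_on (\<lambda>x. integral {0..1} (\<lambda>t. f (x + circ r t *s ?v) / circ r t)) (ball x0 r)"
  proof (rule cholomorphic_integral)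
    have "continuous_on ({0..1} \<times> ball x0 r) (f \<circ> (\<lambda>p. snd p + circ r (fst p) *s ?v))"
    proof (rule continuous_on_compose)
      show "continuous_on ({0..1} \<times> ball x0 r) (\<lambda>p. snd p + circ r (fst p) *s ?v)"
        by (intro continuous_intros continuous_circ)
      show "continuous_on ((\<lambda>p. snd p + circ r (fst p) *s ?v) ` ({0..1} \<times> ball x0 r)) f"
        by (rule continuous_on_subset[OF cholomorphic_on_continuous[OF f]]) (auto simp: in_S)
    qed
    then have "continuous_on ({0..1} \<times> ball x0 r)
        (\<lambda>p. (f \<circ> (\<lambda>p. snd p + circ r (fst p) *s ?v)) p / circ r (fst p))"
      by (intro continuous_on_divide continuous_circ) (auto simp: circ_nonzero r intro!: continuous_intros)
    then show "continuous_on ({0..1} \<times> ball x0 r) (\<lambda>(t, x). f (x + circ r t *s ?v) / circ r t)"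
      by (simp add: split_beta o_def)
    show "cholomorphic_on (\<lambda>x. f (x + circ r t *s ?v) / circ r t) (ball x0 r)" for t
      by (intro cholomorphic_divide cholomorphic_compose[OF _ f] cholomorphic_const)
        (auto simp: circ_nonzero r in_S intro!: cholomorphic_intros)
  qed auto
  moreover have "cderiv f x ?v = integral {0..1} (\<lambda>t. f (x + circ r t *s ?v) / circ r t)" if "x \<in> ball x0 r" for x
  proof -
    have "x \<in> S" using sub[OF that] r by (auto simp: subset_iff)
    show ?thesis
      using cauchy_has_cderiv[OF f S has_cderiv_cderiv[OF f \<open>x \<in> S\<close>] r sub[OF that], of ?v] v
      by (simp add: integral_unique)
  qed
  ultimately have "cholomorphic_on (\<lambda>x. cderiv f x ?v) (ball x0 r)"
    by (subst cholomorphic_on_cong) auto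
  then show "\<exists>W. x0 \<in> W \<and> cholomorphic_on (\<lambda>x. cderiv f x ?v) W"
    using r by (meson centre_in_ball)
qed

text \<open>The fundamental theorem of calculus along the segment from \<open>x\<close> to
  \<open>z\<close>; \<open>G i\<close> is the mean of the i-th partial derivative over that
  segment.\<close>

lemma cholomorphic_hadamard:
  fixes f :: "complex ^ 'n \<Rightarrow> complex"
  assumes f: "cholomorphic_on f (ball x r)" "r > 0"
  obtains G where "\<And>i. cholomorphic_on (G i) (ball x r)" "\<And>i. G i x = cderiv f x (axis i 1)"
    "\<And>z. z \<in> ball x r \<Longrightarrow> f z = f x + (\<Sum>i\<in>UNIV. (z $ i - x $ i) * G i z)"
proof
  define G where "G = (\<lambda>i z. integral {0..1} (\<lambda>t. cderiv f (x + complex_of_real t *s (z - x)) (axis i 1)))"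
  have in_ball: "x + complex_of_real t *s (z - x) \<in> ball x r" if "z \<in> ball x r" "t \<in> {0..1}" for t z
  proof -
    have "norm (complex_of_real t *s (z - x)) \<le> 1 * norm (z - x)"
      unfolding norm_smult using that by (intro mult_mono) auto
    also have "\<dots> < r" using that by (simp add: dist_norm norm_minus_commute)
    finally show ?thesis
      by (metis add_diff_cancel_left' dist_commute dist_norm mem_ball)
  qed
  have contd: "continuous_on ({0..1} \<times> ball x r) (\<lambda>(t, z). cderiv f (x + complex_of_real t *s (z - x)) (axis i 1))" for i
  proof -
    have "continuous_on ({0..1} \<times> ball x r) ((\<lambda>y. cderiv f y (axis i 1)) \<circ> (\<lambda>p. x + complex_of_real (fst p) *s (snd p - x)))"
    proof (rule continuous_on_compose)
      show "continuous_on ({0..1} \<times> ball x r) (\<lambda>p. x + complex_of_real (fst p) *s (snd p - x))"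
        by (intro continuous_intros)
      show "continuous_on ((\<lambda>p. x + complex_of_real (fst p) *s (snd p - x)) ` ({0..1} \<times> ball x r))
          (\<lambda>y. cderiv f y (axis i 1))"
        by (rule continuous_on_subset[OF cholomorphic_on_continuous[OF cholomorphic_cderiv[OF f(1)]]])
          (use in_ball in \<open>auto simp del: mem_ball\<close>)
    qed
    then show ?thesis by (simp add: split_beta o_def)
  qed
  show "cholomorphic_on (G i) (ball x r)" for i
    unfolding G_def
  proof (rule cholomorphic_integral[OF contd])
    fix t :: real assume t: "t \<in> {0..1}"
    show "cholomorphic_on (\<lambda>z. cderiv f (x + complex_of_real t *s (z - x)) (axis i 1)) (ball x r)"
    proof (rule cholomorphic_compose[OF _ cholomorphic_cderiv[OF f(1) open_ball]])
      show "cholomorphic_on (\<lambda>z. (x + complex_of_real t *s (z - x)) $ j) (ball x r)" for j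
        by (simp, intro cholomorphic_intros)
      show "(\<lambda>z. x + complex_of_real t *s (z - x)) ` ball x r \<subseteq> ball x r"
        using in_ball t by (intro image_subsetI)
    qed
  qed auto
  show "G i x = cderiv f x (axis i 1)" for i
    by (simp add: G_def vector_scalar_mult_def zero_vec_def[symmetric])
  fix z assume z: "z \<in> ball x r"
  have int: "(\<lambda>t. (z $ i - x $ i) * cderiv f (x + complex_of_real t *s (z - x)) (axis i 1)) integrable_on {0..1}" for i
  proof -
    have "continuous_on {0..1} ((\<lambda>(t, z). cderiv f (x + complex_of_real t *s (z - x)) (axis i 1)) \<circ> (\<lambda>t. (t, z)))"
      using z by (intro continuous_on_compose continuous_on_subset[OF contd] continuous_intros) auto
    then show ?thesis
      by (intro integrable_continuous_real continuous_intros) (simp add: o_def)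
  qed
  have "((\<lambda>t. cderiv f (x + complex_of_real t *s (z - x)) (z - x)) has_integral
      (f (x + complex_of_real 1 *s (z - x)) - f (x + complex_of_real 0 *s (z - x)))) {0..1}"
  proof (rule fundamental_theorem_of_calculus)
    fix t :: real assume "t \<in> {0..1}"
    from has_cderiv_line[OF has_cderiv_cderiv[OF f(1) in_ball[OF z this]]]
    have "((\<lambda>t. f (x + t *s (z - x))) has_field_derivative
        cderiv f (x + complex_of_real t *s (z - x)) (z - x)) (at (complex_of_real t))" .
    then show "((\<lambda>t. f (x + complex_of_real t *s (z - x))) has_vector_derivative
        cderiv f (x + complex_of_real t *s (z - x)) (z - x)) (at t within {0..1})"
      by (rule has_vector_derivative_real_field)
  qed auto
  then have "((\<lambda>t. \<Sum>i\<in>UNIV. (z $ i - x $ i) * cderiv f (x + complex_of_real t *s (z - x)) (axis i 1)) has_integral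
      (f z - f x)) {0..1}"
  proof (rule has_integral_eq[rotated, THEN has_integral_eq_rhs])
    fix t :: real assume "t \<in> {0..1}"
    from has_cderiv_expand[OF has_cderiv_cderiv[OF f(1) in_ball[OF z this]], of "z - x"]
    show "cderiv f (x + complex_of_real t *s (z - x)) (z - x) =
        (\<Sum>i\<in>UNIV. (z $ i - x $ i) * cderiv f (x + complex_of_real t *s (z - x)) (axis i 1))"
      by simp
  qed simp
  then have "f z - f x = integral {0..1} (\<lambda>t. \<Sum>i\<in>UNIV. (z $ i - x $ i) * cderiv f (x + complex_of_real t *s (z - x)) (axis i 1))"
    by (simp add: integral_unique)
  also have "\<dots> = (\<Sum>i\<in>UNIV. (z $ i - x $ i) * G i z)"
    by (subst integral_sum) (use int in \<open>auto simp: G_def\<close>)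
  finally show "f z = f x + (\<Sum>i\<in>UNIV. (z $ i - x $ i) * G i z)"
    by (metis add.commute diff_add_cancel)
qed

text \<open>Restriction to the complex line through \<open>w\<close> and \<open>z\<close> reduces
  this to the identity theorem in one variable. The line meets the ball in a convex, hence
  connected, set.\<close>

lemma cholomorphic_eq_0_on_ball:
  assumes f: "cholomorphic_on f (ball x r)" and W: "open W" "w \<in> W" "w \<in> ball x r"
    and 0: "\<And>y. y \<in> W \<Longrightarrow> f y = 0" and z: "z \<in> ball x r"
  shows "f z = 0"
proof -
  define T where "T = {t. w + t *s (z - w) \<in> ball x r}"
  have T: "T = (\<lambda>t. w + t *s (z - w)) -` ball x r"
    by (auto simp: T_def)
  have "open T"
    unfolding T by (intro open_vimage continuous_intros) auto
  have "convex T"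
  proof (rule convexI)
    fix s t :: complex and u v :: real
    assume st: "s \<in> T" "t \<in> T" and uv: "u \<ge> 0" "v \<ge> 0" "u + v = 1"
    then have "u = 1 - v" by simp
    have "w + (u *\<^sub>R s + v *\<^sub>R t) *s (z - w) = u *\<^sub>R (w + s *s (z - w)) + v *\<^sub>R (w + t *s (z - w))"
      unfolding \<open>u = 1 - v\<close> vec_eq_iff vector_add_component vector_scaleR_component
      by (simp add: scaleR_conv_of_real algebra_simps)
    then show "u *\<^sub>R s + v *\<^sub>R t \<in> T"
      using convexD[OF convex_ball, of "w + s *s (z - w)" x r "w + t *s (z - w)" u v] st uv
      by (simp add: T_def)
  qed
  define W' where "W' = T \<inter> (\<lambda>t. w + t *s (z - w)) -` W"
  have "open W'"
    unfolding W'_def by (intro open_Int \<open>open T\<close> open_vimage W continuous_intros)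
  have "0 \<in> W'" using W by (simp add: W'_def T_def)
  have "(\<lambda>t. f (w + t *s (z - w))) 1 = (\<lambda>t. 0) 1"
  proof (rule analytic_continuation_open[where s=W' and s'=T and f="\<lambda>t. f (w + t *s (z - w))" and g="\<lambda>t. 0"])
    show "(\<lambda>t. f (w + t *s (z - w))) holomorphic_on T"
      unfolding T_def by (rule cholomorphic_line[OF f])
    show "connected T" using \<open>convex T\<close> by (rule convex_connected)
    show "1 \<in> T" using z by (simp add: T_def)
  qed (use \<open>open W'\<close> \<open>0 \<in> W'\<close> \<open>open T\<close> 0 in \<open>auto simp: W'_def\<close>)
  then show ?thesis by simp
qed

section \<open>Projective space and its tangent vectors\<close>

lemma abs_proj_eq_iff:
  assumes "x \<noteq> 0" "y \<noteq> 0"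
  shows "abs_proj x = abs_proj y \<longleftrightarrow> (\<exists>c. c \<noteq> 0 \<and> y = c *s x)"
proof -
  have "proportional x x" "proportional y y"
    using assms by (auto simp: proportional_def intro!: exI[of _ "1::complex"])
  then show ?thesis
    using Quotient3_rel[OF Quotient3_proj, of x y] assms by (auto simp: proportional_def)
qed

lemma proportional_rep_proj: "proportional (rep_proj p) (rep_proj p)"
  by (rule Quotient3_rep_reflp[OF Quotient3_proj])

lemma rep_proj_nonzero [simp]: "rep_proj p \<noteq> 0"
  using proportional_rep_proj[of p] by (simp add: proportional_def)

lemma abs_rep_proj [simp]: "abs_proj (rep_proj p) = p"
  by (rule Quotient3_abs_rep[OF Quotient3_proj])

lemma abs_proj_smult [simp]: "c \<noteq> 0 \<Longrightarrow> x \<noteq> 0 \<Longrightarrow> abs_proj (c *s x) = abs_proj x"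
  using abs_proj_eq_iff[of x "c *s x"] abs_proj_eq_iff[of "c *s x" x]
  by (auto simp: vec_eq_iff)

lemma rep_abs_proj:
  assumes "x \<noteq> 0"
  obtains c where "c \<noteq> 0" "rep_proj (abs_proj x) = c *s x"
  using abs_proj_eq_iff[of x "rep_proj (abs_proj x)"] assms by auto

lemma proj_cases:
  obtains x where "x \<noteq> 0" "p = abs_proj x"
  by (metis abs_rep_proj rep_proj_nonzero)

lemma cone_iff [simp]: "x \<in> cone U \<longleftrightarrow> x \<noteq> 0 \<and> abs_proj x \<in> U"
  by (simp add: cone_def)

lemma smult_in_cone: "x \<in> cone U \<Longrightarrow> c \<noteq> 0 \<Longrightarrow> c *s x \<in> cone U"
  by simp

lemma open_cone: "open U \<Longrightarrow> open (cone U)"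
  by (simp add: open_proj_def)

text \<open>The cone over the image is the union of the nonzero multiples of \<open>B\<close>.
  Neighbourhoods in projective space can thus be constructed on the cone.\<close>

lemma open_abs_proj_image:
  assumes "open B" "0 \<notin> B"
  shows "open (abs_proj ` B :: 'n::finite proj set)"
proof -
  have "cone (abs_proj ` B) = (\<Union>c\<in>- {0}. (\<lambda>x. c *s x) -` B)" (is "?l = ?r")
  proof
    show "?l \<subseteq> ?r"
    proof
      fix x :: "complex ^ 'n" assume x: "x \<in> ?l"
      then obtain b where b: "b \<in> B" "abs_proj x = abs_proj b" by auto
      then obtain c where "c \<noteq> 0" "b = c *s x"
        using x assms abs_proj_eq_iff[of x b] by auto
      then show "x \<in> ?r" using b by auto
    qed
    show "?r \<subseteq> ?l"
    proof
      fix x :: "complex ^ 'n" assume "x \<in> ?r"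
      then obtain c where c: "c \<noteq> 0" "c *s x \<in> B" by auto
      moreover have "c *s (0 :: complex ^ 'n) = 0" by (simp add: vec_eq_iff)
      ultimately have "x \<noteq> 0" using assms by auto
      then show "x \<in> ?l" using c by (auto intro!: image_eqI[of _ _ "c *s x"])
    qed
  qed
  moreover have "open ?r"
    by (intro open_UN ballI open_vimage assms linear_continuous_on linear_smult_right)
  ultimately show ?thesis by (simp add: open_proj_def)
qed

lemma open_around:
  assumes "open V" "x \<noteq> 0" "abs_proj x \<in> V"
  obtains r where "r > 0" "ball x r \<subseteq> cone V"
  using open_cone[OF assms(1)] assms openE[of "cone V" x] by auto

lemma eventually_nhds_abs_proj:
  assumes "x \<noteq> 0"
  shows "(\<forall>\<^sub>F q in nhds (abs_proj x). P q) \<longleftrightarrow> (\<forall>\<^sub>F y in nhds x. P (abs_proj y))"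
proof
  assume "\<forall>\<^sub>F q in nhds (abs_proj x). P q"
  then obtain V where V: "open V" "abs_proj x \<in> V" "\<And>q. q \<in> V \<Longrightarrow> P q"
    by (auto simp: eventually_nhds)
  then show "\<forall>\<^sub>F y in nhds x. P (abs_proj y)"
    unfolding eventually_nhds using open_cone[of V] assms by (intro exI[of _ "cone V"]) auto
next
  assume "\<forall>\<^sub>F y in nhds x. P (abs_proj y)"
  then obtain B where B: "open B" "x \<in> B" "\<And>y. y \<in> B \<Longrightarrow> P (abs_proj y)"
    by (auto simp: eventually_nhds)
  then show "\<forall>\<^sub>F q in nhds (abs_proj x). P q"
    unfolding eventually_nhds using assms open_abs_proj_image[of "B - {0}"]
    by (intro exI[of _ "abs_proj ` (B - {0})"]) (auto intro: open_delete)
qed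

section \<open>Affine charts and germs of holomorphic functions\<close>

definition chart :: "'n::finite \<Rightarrow> 'n proj set" where
  "chart k = {p. rep_proj p $ k \<noteq> 0}"

definition coord :: "'n::finite \<Rightarrow> 'n \<Rightarrow> 'n proj \<Rightarrow> complex" where
  "coord k i p = rep_proj p $ i / rep_proj p $ k"

lemma coord_abs_proj:
  assumes "x \<noteq> 0"
  shows "coord k i (abs_proj x) = x $ i / x $ k"
proof -
  obtain c where "c \<noteq> 0" "rep_proj (abs_proj x) = c *s x"
    using rep_abs_proj[OF assms] .
  then show ?thesis by (simp add: coord_def)
qed

lemma abs_proj_in_chart:
  assumes "x \<noteq> 0"
  shows "abs_proj x \<in> chart k \<longleftrightarrow> x $ k \<noteq> 0"
proof -
  obtain c where "c \<noteq> 0" "rep_proj (abs_proj x) = c *s x"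
    using rep_abs_proj[OF assms] .
  then show ?thesis by (simp add: chart_def)
qed

lemma cone_chart: "cone (chart k) = {x. x $ k \<noteq> 0}"
proof -
  have "x \<noteq> 0" if "x $ k \<noteq> 0" for x :: "complex ^ 'a"
    using that by auto
  then show ?thesis
    by (auto simp: abs_proj_in_chart)
qed

lemma open_chart: "open (chart k :: 'n::finite proj set)"
proof -
  have "{x :: complex ^ 'n. x $ k \<noteq> 0} = (\<lambda>x. x $ k) -` (- {0})"
    by auto
  moreover have "open \<dots>"
    by (intro open_vimage continuous_intros)
  ultimately show ?thesis
    by (simp add: open_proj_def cone_chart)
qed

lemma in_some_chart: obtains k where "p \<in> chart k"
  using rep_proj_nonzero[of p] unfolding chart_def vec_eq_iff by auto

lemma hol_iff: "f \<in> hol U \<longleftrightarrow> cholomorphic_on (\<lambda>x. f (abs_proj x)) (cone U)"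
  by (simp add: hol_def)

lemma hol_subset: "f \<in> hol U \<Longrightarrow> V \<subseteq> U \<Longrightarrow> f \<in> hol V"
  unfolding hol_iff by (erule cholomorphic_on_subset) auto

lemma hol_cong:
  assumes "f \<in> hol U" "open U" "\<And>p. p \<in> U \<Longrightarrow> f p = g p"
  shows "g \<in> hol U"
proof -
  have "cholomorphic_on (\<lambda>x. f (abs_proj x)) (cone U) \<longleftrightarrow> cholomorphic_on (\<lambda>x. g (abs_proj x)) (cone U)"
    using assms by (intro cholomorphic_on_cong open_cone) simp_all
  then show ?thesis
    using assms(1) by (simp add: hol_iff)
qed

lemma hol_const: "(\<lambda>p. c) \<in> hol U"
  unfolding hol_iff by (rule cholomorphic_const)

lemma hol_add: "f \<in> hol U \<Longrightarrow> g \<in> hol U \<Longrightarrow> (\<lambda>p. f p + g p) \<in> hol U"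
  unfolding hol_iff by (rule cholomorphic_add)

lemma hol_diff: "f \<in> hol U \<Longrightarrow> g \<in> hol U \<Longrightarrow> (\<lambda>p. f p - g p) \<in> hol U"
  unfolding hol_iff by (rule cholomorphic_diff)

lemma hol_minus: "f \<in> hol U \<Longrightarrow> (\<lambda>p. - f p) \<in> hol U"
  unfolding hol_iff by (rule cholomorphic_minus)

lemma hol_mult: "f \<in> hol U \<Longrightarrow> g \<in> hol U \<Longrightarrow> (\<lambda>p. f p * g p) \<in> hol U"
  unfolding hol_iff by (rule cholomorphic_mult)

lemma hol_divide: "f \<in> hol U \<Longrightarrow> g \<in> hol U \<Longrightarrow> (\<And>p. p \<in> U \<Longrightarrow> g p \<noteq> 0) \<Longrightarrow> (\<lambda>p. f p / g p) \<in> hol U"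
  unfolding hol_iff by (rule cholomorphic_divide) auto

lemma hol_coord: "coord k i \<in> hol (chart k)"
proof -
  have "open (cone (chart k))" by (intro open_cone open_chart)
  moreover have "cholomorphic_on (\<lambda>x. x $ i / x $ k) (cone (chart k))"
    by (intro cholomorphic_intros) (simp add: cone_chart del: cone_iff)
  ultimately show ?thesis
    unfolding hol_iff by (subst cholomorphic_on_cong) (auto simp: coord_abs_proj)
qed

lemma hol_atI: "f \<in> hol V \<Longrightarrow> open V \<Longrightarrow> p \<in> V \<Longrightarrow> hol_at p f"
  by (auto simp: hol_at_def)

lemma hol_at_has_cderiv:
  "hol_at (abs_proj x) f \<Longrightarrow> x \<noteq> 0 \<Longrightarrow> has_cderiv (\<lambda>y. f (abs_proj y)) (cderiv (\<lambda>y. f (abs_proj y)) x) x"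
  unfolding hol_at_def hol_iff using has_cderiv_cderiv by (metis cone_iff)

lemma hol_at_coord: "p \<in> chart k \<Longrightarrow> hol_at p (coord k i)"
  by (rule hol_atI[OF hol_coord open_chart])

lemma hol_at_binary:
  assumes "hol_at p f" "hol_at p g"
  obtains V where "open V" "p \<in> V" "f \<in> hol V" "g \<in> hol V"
proof -
  obtain V W where "open V" "p \<in> V" "f \<in> hol V" "open W" "p \<in> W" "g \<in> hol W"
    using assms by (auto simp: hol_at_def)
  then show ?thesis
    using that[of "V \<inter> W"] by (auto intro: hol_subset open_Int)
qed

lemma hol_at_const: "hol_at p (\<lambda>q. c)"
  by (rule hol_atI[OF hol_const open_UNIV]) simp

lemma hol_at_add: "hol_at p f \<Longrightarrow> hol_at p g \<Longrightarrow> hol_at p (\<lambda>q. f q + g q)"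
  by (erule (1) hol_at_binary) (auto intro: hol_atI hol_add)

lemma hol_at_mult: "hol_at p f \<Longrightarrow> hol_at p g \<Longrightarrow> hol_at p (\<lambda>q. f q * g q)"
  by (erule (1) hol_at_binary) (auto intro: hol_atI hol_mult)

lemma hol_at_sum: "(\<And>i. i \<in> I \<Longrightarrow> hol_at p (f i)) \<Longrightarrow> hol_at p (\<lambda>q. \<Sum>i\<in>I. f i q)"
  by (induction I rule: infinite_finite_induct) (auto simp: hol_at_const hol_at_add)

text \<open>Germs form an integral domain: if \<open>f\<close> has a nonzero value on a ball,
  \<open>g\<close> vanishes on the nonempty open subset where \<open>f\<close> is nonzero, hence on
  the ball by the identity theorem.\<close>

lemma germ_mult_eq_0:
  assumes f: "hol_at p f" and g: "hol_at p g"
    and fg: "\<forall>\<^sub>F q in nhds p. f q * g q = 0"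
  shows "(\<forall>\<^sub>F q in nhds p. f q = 0) \<or> (\<forall>\<^sub>F q in nhds p. g q = 0)"
proof -
  obtain x where x: "x \<noteq> 0" "p = abs_proj x" by (rule proj_cases)
  obtain V where V: "open V" "p \<in> V" "f \<in> hol V" "g \<in> hol V"
    using hol_at_binary[OF f g] .
  obtain W where W: "open W" "p \<in> W" "\<And>q. q \<in> W \<Longrightarrow> f q * g q = 0"
    using fg by (auto simp: eventually_nhds)
  obtain r where r: "r > 0" "ball x r \<subseteq> cone (V \<inter> W)"
    using open_around[of "V \<inter> W" x] V W x by (auto simp: open_Int)
  have hf: "cholomorphic_on (\<lambda>x. f (abs_proj x)) (ball x r)"
    and hg: "cholomorphic_on (\<lambda>x. g (abs_proj x)) (ball x r)"
    using V(3,4) r(2) unfolding hol_iff by (auto elim!: cholomorphic_on_subset)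
  show ?thesis
  proof (cases "\<exists>w\<in>ball x r. f (abs_proj w) \<noteq> 0")
    case True
    then obtain w where w: "w \<in> ball x r" "f (abs_proj w) \<noteq> 0" by blast
    define B where "B = {y \<in> ball x r. f (abs_proj y) \<noteq> 0}"
    have "B = ball x r \<inter> (\<lambda>y. f (abs_proj y)) -` (- {0})"
      by (auto simp: B_def)
    then have "open B"
      using continuous_open_preimage[OF cholomorphic_on_continuous[OF hf], of "- {0}"] by auto
    then have "g (abs_proj y) = 0" if "y \<in> ball x r" for y
      using cholomorphic_eq_0_on_ball[OF hg, of B w y] that w r(2) W(3) by (fastforce simp: B_def)
    then have "\<forall>\<^sub>F y in nhds x. g (abs_proj y) = 0"
      unfolding eventually_nhds using r(1) by (intro exI[of _ "ball x r"]) auto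
    then show ?thesis
      using x eventually_nhds_abs_proj[OF x(1)] by auto
  next
    case False
    then have "\<forall>\<^sub>F y in nhds x. f (abs_proj y) = 0"
      unfolding eventually_nhds using r(1) by (intro exI[of _ "ball x r"]) auto
    then show ?thesis
      using x eventually_nhds_abs_proj[OF x(1)] by auto
  qed
qed

section \<open>Derivations at a point and their lifts to the cone\<close>

lemma tangent_vector_0: "tangent_vector p v \<Longrightarrow> \<not> hol_at p f \<Longrightarrow> v f = 0"
  unfolding tangent_vector_def by blast

lemma tangent_vector_cong: "tangent_vector p v \<Longrightarrow> hol_at p f \<Longrightarrow> hol_at p g \<Longrightarrow>
    \<forall>\<^sub>F q in nhds p. f q = g q \<Longrightarrow> v f = v g"
  unfolding tangent_vector_def by blast

lemma tangent_vector_add: "tangent_vector p v \<Longrightarrow> hol_at p f \<Longrightarrow> hol_at p g \<Longrightarrow>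
    v (\<lambda>q. f q + g q) = v f + v g"
  unfolding tangent_vector_def by blast

lemma tangent_vector_cmult: "tangent_vector p v \<Longrightarrow> hol_at p f \<Longrightarrow> v (\<lambda>q. c * f q) = c * v f"
  unfolding tangent_vector_def by blast

lemma tangent_vector_mult: "tangent_vector p v \<Longrightarrow> hol_at p f \<Longrightarrow> hol_at p g \<Longrightarrow>
    v (\<lambda>q. f q * g q) = v f * g p + f p * v g"
  unfolding tangent_vector_def by blast

lemma tangent_vector_const:
  assumes "tangent_vector p v"
  shows "v (\<lambda>q. c) = 0"
proof -
  have "v (\<lambda>q. 1) = 0"
    using tangent_vector_mult[OF assms hol_at_const hol_at_const, of 1 1] by simp
  then show ?thesis
    using tangent_vector_cmult[OF assms hol_at_const[of p 1], of c] by simp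
qed

lemma tangent_vector_sum:
  assumes "tangent_vector p v" "\<And>i. i \<in> I \<Longrightarrow> hol_at p (f i)"
  shows "v (\<lambda>q. \<Sum>i\<in>I. f i q) = (\<Sum>i\<in>I. v (f i))"
  using assms(2)
proof (induction I rule: infinite_finite_induct)
  case (insert i I)
  then show ?case
    using tangent_vector_add[OF assms(1), of "f i" "\<lambda>q. \<Sum>i\<in>I. f i q"] by (simp add: hol_at_sum)
qed (simp_all add: tangent_vector_const[OF assms(1)])

text \<open>On the slice through \<open>x\<close> where the k-th coordinate is constant, the other
  coordinates are \<open>x $ k * coord k i\<close>. For a derivation this picks the lift whose k-th
  component is 0.\<close>

definition lift :: "'n::finite \<Rightarrow> complex ^ 'n \<Rightarrow> (('n proj \<Rightarrow> complex) \<Rightarrow> complex) \<Rightarrow> complex ^ 'n" where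
  "lift k x v = (\<chi> i. x $ k * v (coord k i))"

text \<open>Hadamard's lemma reduces a derivation to its values on the affine coordinates.\<close>

lemma tangent_vector_lift:
  assumes v: "tangent_vector (abs_proj x) v" and f: "hol_at (abs_proj x) f" and x: "x $ k \<noteq> 0"
  shows "v f = cderiv (\<lambda>y. f (abs_proj y)) x (lift k x v)"
proof -
  let ?p = "abs_proj x"
  have x0: "x \<noteq> 0" using x by auto
  obtain V where V: "open V" "?p \<in> V" "f \<in> hol V"
    using f by (auto simp: hol_at_def)
  obtain r where r: "r > 0" "ball x r \<subseteq> cone V"
    using open_around[OF V(1) x0 V(2)] .
  have F: "cholomorphic_on (\<lambda>y. f (abs_proj y)) (ball x r)"
    using V(3) r(2) unfolding hol_iff by (rule cholomorphic_on_subset)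
  obtain G where G: "\<And>i. cholomorphic_on (G i) (ball x r)"
      "\<And>i. G i x = cderiv (\<lambda>y. f (abs_proj y)) x (axis i 1)"
      "\<And>z. z \<in> ball x r \<Longrightarrow> f (abs_proj z) = f ?p + (\<Sum>i\<in>UNIV. (z $ i - x $ i) * G i z)"
    by (rule cholomorphic_hadamard[OF F r(1)], rule that)
  \<comment> \<open>The representative of \<open>q\<close> whose k-th coordinate is
    \<open>x $ k\<close>. Over the chart it is a holomorphic section of the map from the cone,
    passing through \<open>x\<close>, and it carries the expansion of \<open>f\<close> down to
    projective space.\<close>
  define Z where "Z = (\<lambda>q. \<chi> i. x $ k * coord k i q)"
  have Zabs: "Z (abs_proj y) = (x $ k / y $ k) *s y" if "y \<noteq> 0" for y
    using that by (simp add: Z_def vec_eq_iff coord_abs_proj)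
  have Zx: "Z ?p = x"
    using Zabs[OF x0] x by simp
  have abs_Z: "abs_proj (Z q) = q" if "q \<in> chart k" for q
  proof -
    obtain y where y: "y \<noteq> 0" "q = abs_proj y" by (rule proj_cases)
    then show ?thesis
      using that x by (simp add: Zabs abs_proj_in_chart)
  qed
  define B where "B = {y. y $ k \<noteq> 0 \<and> (x $ k / y $ k) *s y \<in> ball x r}"
  have "continuous_on {y. y $ k \<noteq> 0} (\<lambda>y. (x $ k / y $ k) *s y)"
    by (intro continuous_intros) auto
  moreover have "open {y :: complex ^ 'a. y $ k \<noteq> 0}"
    using open_cone[OF open_chart[of k]] by (simp add: cone_chart)
  ultimately have "open ({y. y $ k \<noteq> 0} \<inter> (\<lambda>y. (x $ k / y $ k) *s y) -` ball x r)"
    by (rule continuous_open_preimage) auto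
  moreover have "B = {y. y $ k \<noteq> 0} \<inter> (\<lambda>y. (x $ k / y $ k) *s y) -` ball x r"
    by (auto simp: B_def)
  ultimately have "open B" by simp
  have "0 \<notin> B" by (auto simp: B_def)
  define W where "W = abs_proj ` B"
  have W: "open W" "?p \<in> W"
    using open_abs_proj_image[OF \<open>open B\<close> \<open>0 \<notin> B\<close>] x r(1) by (auto simp: W_def B_def)
  have WB: "Z q \<in> ball x r \<and> q \<in> chart k" if qW: "q \<in> W" for q
  proof -
    obtain y where y: "y \<in> B" "q = abs_proj y" using qW unfolding W_def by blast
    moreover have "y \<noteq> 0" using y \<open>0 \<notin> B\<close> by auto
    ultimately show ?thesis by (auto simp: B_def Zabs abs_proj_in_chart)
  qed
  have hG: "(\<lambda>q. G i (Z q)) \<in> hol W" for i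
    unfolding hol_iff
  proof (rule cholomorphic_compose[OF _ G(1)])
    show "cholomorphic_on (\<lambda>y. Z (abs_proj y) $ j) (cone W)" for j
    proof -
      have "coord k j \<in> hol W"
        using hol_coord WB by (blast intro: hol_subset)
      then have "(\<lambda>q. x $ k * coord k j q) \<in> hol W"
        by (intro hol_mult hol_const)
      then show ?thesis by (simp add: hol_iff Z_def)
    qed
    show "(\<lambda>y. Z (abs_proj y)) ` cone W \<subseteq> ball x r"
      using WB by auto
  qed
  have hat: "hol_at ?p (\<lambda>q. G i (Z q))" for i
    by (rule hol_atI[OF hG W])
  have pk: "?p \<in> chart k"
    using x x0 by (simp add: abs_proj_in_chart)
  have hz: "hol_at ?p (\<lambda>q. x $ k * coord k i q + - x $ i)" for i
    by (intro hol_at_add hol_at_mult hol_at_const hol_at_coord pk)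
  define g where "g = (\<lambda>q. f ?p + (\<Sum>i\<in>UNIV. (x $ k * coord k i q + - x $ i) * G i (Z q)))"
  have hg: "hol_at ?p (\<lambda>q. \<Sum>i\<in>UNIV. (x $ k * coord k i q + - x $ i) * G i (Z q))"
    by (intro hol_at_sum hol_at_mult hz hat)
  have "\<forall>\<^sub>F q in nhds ?p. f q = g q"
    unfolding eventually_nhds
  proof (intro exI[of _ W] conjI W ballI)
    fix q assume "q \<in> W"
    then show "f q = g q"
      using G(3)[of "Z q"] WB[of q] abs_Z[of q] by (simp add: g_def Z_def)
  qed
  then have "v f = v g"
    using f hg by (intro tangent_vector_cong[OF v]) (auto simp: g_def intro!: hol_at_add hol_at_const)
  also have "\<dots> = v (\<lambda>q. \<Sum>i\<in>UNIV. (x $ k * coord k i q + - x $ i) * G i (Z q))"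
    unfolding g_def by (subst tangent_vector_add[OF v hol_at_const hg]) (simp add: tangent_vector_const[OF v])
  also have "\<dots> = (\<Sum>i\<in>UNIV. v (\<lambda>q. (x $ k * coord k i q + - x $ i) * G i (Z q)))"
    by (intro tangent_vector_sum[OF v] hol_at_mult hz hat)
  also have "\<dots> = (\<Sum>i\<in>UNIV. lift k x v $ i * cderiv (\<lambda>y. f (abs_proj y)) x (axis i 1))"
  proof (rule sum.cong[OF refl])
    fix i
    have 1: "v (\<lambda>q. x $ k * coord k i q + - x $ i) = x $ k * v (coord k i)"
      by (subst tangent_vector_add[OF v], intro hol_at_mult hol_at_const hol_at_coord pk,
          intro hol_at_const, subst tangent_vector_cmult[OF v hol_at_coord[OF pk]])
        (simp add: tangent_vector_const[OF v])
    \<comment> \<open>This zero removes one of the two Leibniz terms; what remains involves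
      \<open>G i\<close> only at \<open>x\<close>, where it is the partial derivative.\<close>
    have 2: "x $ k * coord k i ?p + - x $ i = 0"
      using x x0 by (simp add: coord_abs_proj)
    show "v (\<lambda>q. (x $ k * coord k i q + - x $ i) * G i (Z q)) =
        lift k x v $ i * cderiv (\<lambda>y. f (abs_proj y)) x (axis i 1)"
      by (subst tangent_vector_mult[OF v hz hat], subst 2, subst 1) (simp add: lift_def Zx G(2))
  qed
  also have "\<dots> = cderiv (\<lambda>y. f (abs_proj y)) x (lift k x v)"
    by (rule has_cderiv_expand[OF hol_at_has_cderiv[OF f x0], symmetric])
  finally show ?thesis .
qed

text \<open>The image of \<zeta> under the differential of the map from the cone. The case
  distinction reproduces the convention of \<open>tangent_vector\<close> for functions without a
  germ.\<close>

definition tv :: "complex ^ 'n \<Rightarrow> complex ^ 'n \<Rightarrow> (('n::finite) proj \<Rightarrow> complex) \<Rightarrow> complex" where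
  "tv x \<zeta> f = (if hol_at (abs_proj x) f then cderiv (\<lambda>y. f (abs_proj y)) x \<zeta> else 0)"

lemma tv_has_cderiv:
  assumes "has_cderiv (\<lambda>y. f (abs_proj y)) D x" "hol_at (abs_proj x) f"
  shows "tv x \<zeta> f = D \<zeta>"
  using assms by (simp add: tv_def cderiv_eq)

lemma cderiv_eventually_cong:
  assumes "\<forall>\<^sub>F y in nhds x. f y = g y"
  shows "cderiv f x = cderiv g x"
proof -
  obtain S where "open S" "x \<in> S" "\<And>y. y \<in> S \<Longrightarrow> f y = g y"
    using assms by (auto simp: eventually_nhds)
  then show ?thesis by (rule cderiv_cong)
qed

lemma tangent_vector_tv:
  assumes x: "x \<noteq> 0"
  shows "tangent_vector (abs_proj x) (tv x \<zeta>)"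
  unfolding tangent_vector_def
proof (intro conjI allI impI)
  fix f g :: "'a proj \<Rightarrow> complex" and c
  show "tv x \<zeta> f = 0" if "\<not> hol_at (abs_proj x) f"
    using that by (simp add: tv_def)
  assume fg: "hol_at (abs_proj x) f \<and> hol_at (abs_proj x) g"
  let ?D = "\<lambda>f. cderiv (\<lambda>y. f (abs_proj y)) x"
  have f: "hol_at (abs_proj x) f" "has_cderiv (\<lambda>y. f (abs_proj y)) (?D f) x"
    and g: "hol_at (abs_proj x) g" "has_cderiv (\<lambda>y. g (abs_proj y)) (?D g) x"
    using fg hol_at_has_cderiv[OF _ x] by auto
  show "tv x \<zeta> f = tv x \<zeta> g" if "\<forall>\<^sub>F q in nhds (abs_proj x). f q = g q"
    using that cderiv_eventually_cong[of "\<lambda>y. f (abs_proj y)" "\<lambda>y. g (abs_proj y)" x] f g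
    by (simp add: tv_def eventually_nhds_abs_proj[OF x])
  show "tv x \<zeta> (\<lambda>q. f q + g q) = tv x \<zeta> f + tv x \<zeta> g"
    using tv_has_cderiv[OF has_cderiv_add[OF f(2) g(2)]] hol_at_add[OF f(1) g(1)] f g by (simp add: tv_def)
  show "tv x \<zeta> (\<lambda>q. f q * g q) = tv x \<zeta> f * g (abs_proj x) + f (abs_proj x) * tv x \<zeta> g"
    using tv_has_cderiv[OF has_cderiv_mult[OF f(2) g(2)]] hol_at_mult[OF f(1) g(1)] f g by (simp add: tv_def)
  show "tv x \<zeta> (\<lambda>q. c * f q) = c * tv x \<zeta> f"
    using tv_has_cderiv[OF has_cderiv_mult[OF has_cderiv_const f(2)]] hol_at_mult[OF hol_at_const f(1)] f
    by (simp add: tv_def)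
qed

lemma tangent_vector_eq_tv:
  assumes "tangent_vector (abs_proj x) v" "x $ k \<noteq> 0"
  shows "v = tv x (lift k x v)"
  using tangent_vector_lift[OF assms(1) _ assms(2)] tangent_vector_0[OF assms(1)] by (auto simp: tv_def)

lemma tv_ex:
  assumes "tangent_vector (abs_proj x) v" "x \<noteq> 0"
  obtains \<zeta> where "v = tv x \<zeta>"
proof -
  obtain k where "x $ k \<noteq> 0" using assms(2) by (auto simp: vec_eq_iff)
  then show ?thesis using tangent_vector_eq_tv[OF assms(1)] that by blast
qed

lemma tv_coord:
  assumes "x $ k \<noteq> 0"
  shows "tv x \<zeta> (coord k i) = (\<zeta> $ i * x $ k - x $ i * \<zeta> $ k) / (x $ k)\<^sup>2"
proof -
  have x: "x \<noteq> 0" using assms by auto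
  have "has_cderiv (\<lambda>y. y $ i / y $ k) (\<lambda>v. (v $ i * x $ k - x $ i * v $ k) / (x $ k)\<^sup>2) x"
    by (intro has_cderiv_divide has_cderiv_component assms)
  then have "has_cderiv (\<lambda>y. coord k i (abs_proj y)) (\<lambda>v. (v $ i * x $ k - x $ i * v $ k) / (x $ k)\<^sup>2) x"
    by (rule has_cderiv_cong[where S="- {0}"]) (auto simp: coord_abs_proj x)
  then show ?thesis
    using hol_at_coord[of "abs_proj x" k i] x assms
    by (simp add: tv_has_cderiv abs_proj_in_chart)
qed

lemma tv_add: "x \<noteq> 0 \<Longrightarrow> tv x (\<zeta> + \<eta>) f = tv x \<zeta> f + tv x \<eta> f"
  by (simp add: tv_def has_cderiv_add_arg[OF hol_at_has_cderiv])

lemma tv_smult: "x \<noteq> 0 \<Longrightarrow> tv x (c *s \<zeta>) f = c * tv x \<zeta> f"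
  by (simp add: tv_def has_cderiv_smult[OF hol_at_has_cderiv])

lemma tv_zero: "x \<noteq> 0 \<Longrightarrow> tv x 0 f = 0"
  using tv_smult[of x 0 0 f] by simp

text \<open>Functions pulled back from projective space are constant on lines through the origin, so
  the radial direction lies in the kernel of the differential.\<close>

lemma tv_self:
  assumes x: "x \<noteq> 0"
  shows "tv x x f = 0"
proof (cases "hol_at (abs_proj x) f")
  case True
  have "((\<lambda>t. f (abs_proj (x + t *s x))) has_field_derivative cderiv (\<lambda>y. f (abs_proj y)) x x) (at 0)"
    by (rule has_cderiv_line) (simp add: hol_at_has_cderiv[OF True x])
  moreover have "((\<lambda>t. f (abs_proj (x + t *s x))) has_field_derivative 0) (at 0)"
  proof (rule has_field_derivative_transform_within_open[where S="ball 0 1" and f="\<lambda>t. f (abs_proj x)"])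
    fix t :: complex assume "t \<in> ball 0 1"
    then have "1 + t \<noteq> 0"
      by (auto dest: minus_unique)
    moreover have "x + t *s x = (1 + t) *s x"
      by (simp add: vec_eq_iff algebra_simps)
    ultimately show "f (abs_proj x) = f (abs_proj (x + t *s x))"
      using abs_proj_smult[of "1 + t" x] x by metis
  qed auto
  ultimately show ?thesis
    using True by (simp add: tv_def DERIV_unique)
qed (simp add: tv_def)

text \<open>This is why a lift that is homogeneous of degree 1, such as a linear map, defines a
  field on projective space independently of the representative.\<close>

lemma tv_scale:
  assumes x: "x \<noteq> 0" and c: "c \<noteq> 0"
  shows "tv (c *s x) (c *s \<zeta>) f = tv x \<zeta> f"
proof (cases "hol_at (abs_proj x) f")
  case True
  let ?F = "\<lambda>y. f (abs_proj y)"
  have cx: "c *s x \<noteq> 0" using x c by (auto simp: vec_eq_iff)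
  have D: "has_cderiv ?F (cderiv ?F (c *s x)) (c *s x)"
    using hol_at_has_cderiv[of "c *s x" f] True x c cx by simp
  then have "has_cderiv (\<lambda>y. ?F (0 + c *s y)) (\<lambda>v. c * cderiv ?F (c *s x) v) x"
    by (intro has_cderiv_affine) simp
  then have "has_cderiv ?F (\<lambda>v. c * cderiv ?F (c *s x) v) x"
    by (rule has_cderiv_cong[where S="- {0}"]) (auto simp: x c)
  then show ?thesis
    using True x c by (simp add: tv_def cderiv_eq has_cderiv_smult[OF D])
qed (use x c in \<open>simp add: tv_def\<close>)

section \<open>Vector fields and their lifts to the cone\<close>

lemma TP_tangent_vector: "X \<in> TP U \<Longrightarrow> p \<in> U \<Longrightarrow> tangent_vector p (X p)"
  by (simp add: TP_def)

lemma TP_outside: "X \<in> TP U \<Longrightarrow> p \<notin> U \<Longrightarrow> X p = (\<lambda>f. 0)"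
  by (simp add: TP_def)

lemma TP_hol: "X \<in> TP U \<Longrightarrow> open V \<Longrightarrow> V \<subseteq> U \<Longrightarrow> f \<in> hol V \<Longrightarrow> (\<lambda>p. X p f) \<in> hol V"
  by (simp add: TP_def)

lemma TP_coord_hol:
  assumes "X \<in> TP U" "open U" "V \<subseteq> U" "V \<subseteq> chart k"
  shows "(\<lambda>p. X p (coord k i)) \<in> hol V"
proof -
  have "(\<lambda>p. X p (coord k i)) \<in> hol (U \<inter> chart k)"
    using assms by (intro TP_hol[OF assms(1)] open_Int open_chart hol_subset[OF hol_coord]) auto
  then show ?thesis
    by (rule hol_subset) (use assms in auto)
qed

lemma TP_tv:
  assumes "X \<in> TP U" "abs_proj x \<in> U" "x \<noteq> 0"
  obtains \<zeta> where "X (abs_proj x) = tv x \<zeta>"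
  using tv_ex[OF TP_tangent_vector[OF assms(1,2)] assms(3)] .

lemma vres_TP:
  assumes "X \<in> TP U" "open V" "V \<subseteq> U"
  shows "vres V X \<in> TP V"
proof -
  have "(\<lambda>p. vres V X p f) \<in> hol W" if "open W" "W \<subseteq> V" "f \<in> hol W" for W f
    by (rule hol_cong[OF TP_hol[OF assms(1) that(1) _ that(3)]]) (use that assms in \<open>auto simp: vres_def\<close>)
  then show ?thesis
    using assms by (auto simp: TP_def vres_def)
qed

text \<open>The lift acts on a pulled back function as a combination of its partial derivatives,
  which are holomorphic by \<open>cholomorphic_cderiv\<close>.\<close>

lemma TP_lift:
  assumes "\<And>x. x \<in> cone U \<Longrightarrow> X (abs_proj x) = tv x (\<xi> x)"
    and "\<And>i. cholomorphic_on (\<lambda>x. \<xi> x $ i) (cone U)"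
    and "\<And>p. p \<notin> U \<Longrightarrow> X p = (\<lambda>f. 0)"
  shows "X \<in> TP U"
  unfolding TP_def
proof (intro CollectI conjI ballI allI impI)
  fix p assume p: "p \<in> U"
  obtain x where "x \<noteq> 0" "p = abs_proj x" by (rule proj_cases)
  then show "tangent_vector p (X p)"
    using assms(1)[of x] p by (simp add: tangent_vector_tv)
next
  fix V and f :: "'a proj \<Rightarrow> complex"
  assume V: "open V \<and> V \<subseteq> U \<and> f \<in> hol V"
  let ?F = "\<lambda>y. f (abs_proj y)"
  have F: "cholomorphic_on ?F (cone V)"
    using V by (simp add: hol_iff)
  have "cholomorphic_on (\<lambda>x. \<Sum>i\<in>UNIV. \<xi> x $ i * cderiv ?F x (axis i 1)) (cone V)"
    using V by (intro cholomorphic_sum cholomorphic_mult cholomorphic_cderiv[OF F] open_cone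
        cholomorphic_on_subset[OF assms(2)]) auto
  moreover have "X (abs_proj x) f = (\<Sum>i\<in>UNIV. \<xi> x $ i * cderiv ?F x (axis i 1))" if "x \<in> cone V" for x
  proof -
    have "hol_at (abs_proj x) f" using V that by (auto intro: hol_atI)
    moreover have "X (abs_proj x) = tv x (\<xi> x)" using assms(1)[of x] V that by auto
    ultimately show ?thesis
      using has_cderiv_expand[OF has_cderiv_cderiv[OF F that], of "\<xi> x"] by (simp add: tv_def)
  qed
  ultimately show "(\<lambda>p. X p f) \<in> hol V"
    unfolding hol_iff using V by (subst cholomorphic_on_cong) (auto simp: open_cone)
qed (use assms(3) in auto)

definition linfield :: "complex ^ 'n ^ 'n \<Rightarrow> ('n::finite) vfield" where
  "linfield B p = tv (rep_proj p) (B *v rep_proj p)"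

lemma linfield_abs_proj:
  assumes "x \<noteq> 0"
  shows "linfield B (abs_proj x) = tv x (B *v x)"
proof -
  obtain c where c: "c \<noteq> 0" "rep_proj (abs_proj x) = c *s x"
    using rep_abs_proj[OF assms] .
  have "B *v (c *s x) = c *s (B *v x)"
    by (simp add: matrix_vector_mult_def vec_eq_iff sum_distrib_left mult_ac)
  then show ?thesis
    using c assms by (auto simp: linfield_def tv_scale)
qed

lemma linfield_component: "has_cderiv (\<lambda>x. (B *v x) $ i) (\<lambda>v. (B *v v) $ i) x"
  unfolding matrix_vector_mult_def vec_lambda_beta
  by (rule has_cderiv_sum) (use has_cderiv_mult[OF has_cderiv_const has_cderiv_component] in simp)

lemma vres_linfield_TP:
  assumes "open U"
  shows "vres U (linfield B) \<in> TP U"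
  by (rule TP_lift[where \<xi>="\<lambda>x. B *v x"])
    (use linfield_component in \<open>auto simp: vres_def linfield_abs_proj cholomorphic_on_iff\<close>)

section \<open>Homogeneous functions and linear trivectors\<close>

text \<open>Moving \<open>x\<close> in the direction (1, ..., 1) leaves both hyperplanes for all but
  at most two values of \<open>t\<close>; continuity does the rest. Identities valid where two
  charts overlap extend to the whole space in this way.\<close>

lemma eq_if_eq_on_dense:
  fixes f g :: "complex ^ 'n::finite \<Rightarrow> complex"
  assumes f: "continuous_on UNIV f" "continuous_on UNIV g"
    and eq: "\<And>x. x $ k \<noteq> 0 \<Longrightarrow> x $ l \<noteq> 0 \<Longrightarrow> f x = g x"
  shows "f x = g x"
proof -
  define u :: "complex ^ 'n" where "u = (\<chi> i. 1)"
  have lim: "((\<lambda>t. h (x + t *s u)) \<longlongrightarrow> h x) (at 0)" if "continuous_on UNIV h" for h :: "complex ^ 'n \<Rightarrow> complex"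
  proof -
    have "continuous_on UNIV (\<lambda>t. h (x + t *s u))"
      by (rule continuous_on_compose2[OF that]) (auto intro!: continuous_intros)
    then have "isCont (\<lambda>t. h (x + t *s u)) 0"
      by (simp add: continuous_on_eq_continuous_at)
    then show ?thesis by (simp add: isCont_def)
  qed
  have "\<forall>\<^sub>F t in at 0. t \<noteq> - x $ k" "\<forall>\<^sub>F t in at 0. t \<noteq> - x $ l"
    by (rule eventually_neq_at_within)+
  then have "\<forall>\<^sub>F t in at 0. f (x + t *s u) = g (x + t *s u)"
  proof eventually_elim
    case (elim t)
    then show ?case
      by (intro eq) (auto simp: u_def dest: minus_unique)
  qed
  then have "((\<lambda>t. g (x + t *s u)) \<longlongrightarrow> f x) (at 0)"
    using lim[OF f(1)] by (rule Lim_transform_eventually[rotated])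
  then show ?thesis
    using lim[OF f(2)] by (intro tendsto_unique) auto
qed

definition clin :: "(complex ^ 'n \<Rightarrow> complex) \<Rightarrow> bool" where
  "clin D \<longleftrightarrow> (\<forall>x. D x = (\<Sum>i\<in>UNIV. x $ i * D (axis i 1)))"

lemma clin_continuous:
  assumes "clin D"
  shows "continuous_on S D"
proof -
  have "continuous_on S (\<lambda>x. \<Sum>i\<in>UNIV. x $ i * D (axis i 1))"
    by (intro continuous_intros)
  moreover have "(\<lambda>x. \<Sum>i\<in>UNIV. x $ i * D (axis i 1)) = D"
    using assms unfolding clin_def by (intro ext) metis
  ultimately show ?thesis by (rule back_subst[where P="continuous_on S"])
qed

lemma clin_minus:
  assumes "clin D"
  shows "clin (\<lambda>x. - D x)"
  unfolding clin_def
proof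
  fix x
  have "D x = (\<Sum>i\<in>UNIV. x $ i * D (axis i 1))"
    using assms unfolding clin_def by blast
  then show "- D x = (\<Sum>i\<in>UNIV. x $ i * - D (axis i 1))"
    by (simp only: mult_minus_right sum_negf)
qed

lemma clin_zero: "clin (\<lambda>x. 0)"
  by (simp add: clin_def)

lemma clin_add:
  assumes "clin D"
  shows "D (x + y) = D x + D y"
proof -
  have "D (x + y) = (\<Sum>i\<in>UNIV. (x + y) $ i * D (axis i 1))"
    using assms unfolding clin_def by blast
  also have "\<dots> = (\<Sum>i\<in>UNIV. x $ i * D (axis i 1)) + (\<Sum>i\<in>UNIV. y $ i * D (axis i 1))"
    by (simp add: sum.distrib algebra_simps)
  also have "\<dots> = D x + D y"
    using assms unfolding clin_def by metis
  finally show ?thesis .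
qed

text \<open>
  On a line through \<open>axis k 1\<close> that avoids the codimension two subspace where \<open>f\<close> is undefined, \<open>f\<close>
  grows linearly; Liouville's theorem makes it affine there. This replaces Hartogs' extension.
\<close>

lemma homogeneous_deg1_linear:
  fixes f :: "complex ^ 'n::finite \<Rightarrow> complex" and k l :: 'n
  defines "S \<equiv> {x. x $ k \<noteq> 0 \<or> x $ l \<noteq> 0}"
  assumes kl: "k \<noteq> l" and f: "cholomorphic_on f S"
    and hom: "\<And>c x. c \<noteq> 0 \<Longrightarrow> x \<in> S \<Longrightarrow> f (c *s x) = c * f x"
  obtains D where "clin D" "\<And>x. x \<in> S \<Longrightarrow> f x = D x"
proof -
  define e :: "complex ^ 'n" where "e = axis k 1"
  have ek: "e $ k = 1" "e $ l = 0" "e \<in> S"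
    using kl by (auto simp: e_def axis_def S_def)
  define D where "D = cderiv f e"
  have D: "has_cderiv f D e"
    unfolding D_def by (rule has_cderiv_cderiv[OF f ek(3)])
  have "clin D"
    unfolding clin_def using has_cderiv_expand[OF D] by blast
  have openS: "open S"
  proof -
    have "S = (\<lambda>x. x $ k) -` (- {0}) \<union> (\<lambda>x. x $ l) -` (- {0})"
      by (auto simp: S_def)
    then show ?thesis
      by (auto intro!: open_Un open_vimage continuous_intros)
  qed
  have main: "f y = D y" if y: "y $ l \<noteq> 0" for y
  proof -
    have yS: "y \<in> S" using y by (simp add: S_def)
    \<comment> \<open>The l-th coordinate is \<open>t * y $ l\<close>, and for \<open>t = 0\<close>
      the k-th one is 1, so the line avoids the subspace where both vanish.\<close>
    have inS: "e + t *s y \<in> S" for t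
      using y ek by (cases "t = 0") (auto simp: S_def)
    define \<phi> where "\<phi> t = f (e + t *s y)" for t
    have hol: "\<phi> holomorphic_on UNIV"
      using cholomorphic_line[OF f, of e y] inS by (simp add: \<phi>_def[abs_def])
    \<comment> \<open>The difference quotient of the entire function \<open>\<phi>\<close> at 0,
      completed to an entire function. Homogeneity gives it the limit \<open>f y\<close> at
      infinity, so it is constant; its value at 0 is \<open>D y\<close>.\<close>
    define \<psi> where "\<psi> t = (if t = 0 then deriv \<phi> 0 else (\<phi> t - \<phi> 0) / (t - 0))" for t
    have "\<psi> holomorphic_on UNIV"
      unfolding \<psi>_def by (rule pole_lemma_open[OF hol open_UNIV])
    moreover have "(\<psi> \<longlongrightarrow> f y) at_infinity"
    proof -
      have "isCont f y"
        using cholomorphic_on_continuous[OF f] openS yS continuous_on_eq_continuous_at by blast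
      moreover have "((\<lambda>t. y + inverse t *s e) \<longlongrightarrow> y + 0 *s e) at_infinity"
        unfolding vector_scalar_mult_def plus_vec_def
        by (intro tendsto_vec_lambda tendsto_intros) (auto intro!: tendsto_inverse_0)
      ultimately have "((\<lambda>t. f (y + inverse t *s e)) \<longlongrightarrow> f y) at_infinity"
        by (intro isCont_tendsto_compose[of y f]) (auto simp: vector_scalar_mult_def zero_vec_def[symmetric])
      then have "((\<lambda>t. f (y + inverse t *s e) - \<phi> 0 * inverse t) \<longlongrightarrow> f y - \<phi> 0 * 0) at_infinity"
        by (intro tendsto_intros tendsto_inverse_0)
      moreover have "\<forall>\<^sub>F t in at_infinity. f (y + inverse t *s e) - \<phi> 0 * inverse t = \<psi> t"
        unfolding eventually_at_infinity
      proof (intro exI[of _ 1] allI impI)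
        fix t :: complex assume "1 \<le> norm t"
        then have t: "t \<noteq> 0" by auto
        have "e + t *s y = t *s (y + inverse t *s e)"
          using t by (simp add: vec_eq_iff field_simps)
        moreover have "y + inverse t *s e \<in> S"
          using y ek by (simp add: S_def)
        ultimately have "\<phi> t = t * f (y + inverse t *s e)"
          unfolding \<phi>_def using hom[OF t, of "y + inverse t *s e"] by metis
        then show "f (y + inverse t *s e) - \<phi> 0 * inverse t = \<psi> t"
          using t by (simp add: \<psi>_def field_simps)
      qed
      ultimately show ?thesis
        by (auto intro: Lim_transform_eventually)
    qed
    ultimately have "\<psi> 0 = f y"
      by (rule Liouville_weak)
    moreover have "deriv \<phi> 0 = D y"
      unfolding \<phi>_def by (rule DERIV_imp_deriv, rule has_cderiv_line) (simp add: D)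
    ultimately show ?thesis by (simp add: \<psi>_def)
  qed
  have "f x = D x" if x: "x \<in> S" for x
  proof (cases "x $ l = 0")
    case True
    \<comment> \<open>Points with vanishing l-th coordinate are limits of points covered by
      \<open>main\<close>. Along the l-th axis the k-th coordinate stays fixed and nonzero.\<close>
    define u :: "complex ^ 'n" where "u = axis l 1"
    have inS: "x + t *s u \<in> S" for t
      using x True kl by (auto simp: S_def u_def axis_def)
    have "continuous_on UNIV (\<lambda>t. f (x + t *s u))"
      by (rule continuous_on_compose2[OF cholomorphic_on_continuous[OF f]]) (auto intro!: continuous_intros inS)
    moreover have "continuous_on UNIV (\<lambda>t. D (x + t *s u))"
      by (rule continuous_on_compose2[OF clin_continuous[OF \<open>clin D\<close>], of UNIV]) (auto intro!: continuous_intros)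
    ultimately have "isCont (\<lambda>t. f (x + t *s u)) 0" "isCont (\<lambda>t. D (x + t *s u)) 0"
      by (simp_all add: continuous_on_eq_continuous_at)
    then have *: "((\<lambda>t. f (x + t *s u)) \<longlongrightarrow> f x) (at 0)" "((\<lambda>t. D (x + t *s u)) \<longlongrightarrow> D x) (at 0)"
      by (simp_all add: isCont_def)
    have "\<forall>\<^sub>F t in at 0. f (x + t *s u) = D (x + t *s u)"
      using eventually_neq_at_within[of 0 0 UNIV]
      by eventually_elim (rule main, simp add: True u_def axis_def)
    then have "((\<lambda>t. D (x + t *s u)) \<longlongrightarrow> f x) (at 0)"
      using *(1) by (rule Lim_transform_eventually[rotated])
    then show ?thesis
      using *(2) by (intro tendsto_unique) auto
  qed (rule main)
  then show ?thesis
    using that \<open>clin D\<close> by blast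
qed

text \<open>
  \<open>sig \<omega> x\<close> is the trivector \<open>x \<and> \<omega>\<close>. Below, \<open>ext4 \<omega> x \<zeta>\<close> is \<open>\<zeta> \<and> x \<and> \<omega>\<close>, and \<open>plu \<omega>\<close> is \<open>\<omega> \<and> \<omega> / 2\<close>.
\<close>

definition sig :: "('n \<Rightarrow> 'n \<Rightarrow> complex) \<Rightarrow> complex ^ 'n \<Rightarrow> 'n \<Rightarrow> 'n \<Rightarrow> 'n \<Rightarrow> complex" where
  "sig \<omega> x i j k = x $ i * \<omega> j k - x $ j * \<omega> i k + x $ k * \<omega> i j"

text \<open>The last hypothesis says x \<and> L = 0, and the result is exactness of the Koszul
  complex for linear coefficients. Evaluation at a basis vector shows that \<open>L i j l\<close>
  involves only the coordinates i, j, l. Evaluation at a sum of two basis vectors shows that the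
  coefficient of the l-th coordinate is independent of l; this coefficient is
  \<open>\<omega> i j\<close>.\<close>

lemma linear_trivector_divisible:
  fixes L :: "'n::finite \<Rightarrow> 'n \<Rightarrow> 'n \<Rightarrow> complex ^ 'n \<Rightarrow> complex"
  assumes card: "CARD('n) \<ge> 4" and lin: "\<And>i j k. clin (L i j k)"
    and a1: "\<And>i j k x. L i j k x = - L j i k x" and a2: "\<And>i j k x. L i j k x = - L i k j x"
    and wedge: "\<And>i j k l x. x $ k * L i j l x = x $ l * L i j k x - x $ j * L i l k x + x $ i * L j l k x"
  obtains \<omega> where "\<And>i j. \<omega> i j = - \<omega> j i" "\<And>i j k x. L i j k x = sig \<omega> x i j k"
proof -
  let ?e = "\<lambda>k. axis k 1 :: complex ^ 'n"
  have d1: "L i i k x = 0" for i k x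
    using a1[of i i k x] by simp
  have d2: "L i k k x = 0" for i k x
    using a2[of i k k x] by simp
  have d3: "L i k i x = 0" for i k x
    using a2[of i k i x] d1 by simp
  have z: "L i j l (?e k) = 0" if "k \<noteq> i" "k \<noteq> j" "k \<noteq> l" for i j k l
    using wedge[of "?e k" k i j l] that by (simp add: axis_def)
  have eq: "L i j l (?e l) = L i j k (?e k)" if "k \<noteq> i" "k \<noteq> j" "k \<noteq> l" "l \<noteq> i" "l \<noteq> j" for i j k l
  proof -
    have "L i j l (?e k + ?e l) = L i j k (?e k + ?e l)"
      using wedge[of "?e k + ?e l" k i j l] that by (simp add: axis_def)
    then show ?thesis
      using z[of k i j l] z[of l i j k] that by (simp add: clin_add[OF lin])
  qed
  define \<omega> where "\<omega> i j = (if i = j then 0 else L i j (SOME k. k \<noteq> i \<and> k \<noteq> j) (?e (SOME k. k \<noteq> i \<and> k \<noteq> j)))" for i j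
  have ex: "\<exists>k. k \<noteq> i \<and> k \<noteq> j" for i j :: 'n
  proof (rule ccontr)
    assume "\<not> ?thesis"
    then have "UNIV = {i, j}" by auto
    then have "CARD('n) \<le> 2"
      by (metis card_2_iff card_eq_0_iff insert_absorb2 card.empty card_insert_if empty_iff finite.emptyI le_SucI
          numeral_2_eq_2 One_nat_def order_refl)
    then show False using card by simp
  qed
  have \<omega>: "\<omega> i j = L i j k (?e k)" if "i \<noteq> j" "k \<noteq> i" "k \<noteq> j" for i j k
  proof -
    define m where "m = (SOME k. k \<noteq> i \<and> k \<noteq> j)"
    have m: "m \<noteq> i \<and> m \<noteq> j"
      unfolding m_def by (rule someI_ex[OF ex])
    have "\<omega> i j = L i j m (?e m)"
      using that(1) by (simp add: \<omega>_def m_def)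
    also have "\<dots> = L i j k (?e k)"
      using eq[of k i j m] m that by (cases "k = m") auto
    finally show ?thesis .
  qed
  have anti: "\<omega> i j = - \<omega> j i" for i j
  proof (cases "i = j")
    case False
    obtain k where "k \<noteq> i \<and> k \<noteq> j" using ex by blast
    then show ?thesis
      using False \<omega>[of i j k] \<omega>[of j i k] a1[of i j k] by simp
  qed (simp add: \<omega>_def)
  have w0: "\<omega> i i = 0" for i by (simp add: \<omega>_def)
  have "L i j k x = sig \<omega> x i j k" for i j k x
  proof (cases "i = j \<or> i = k \<or> j = k")
    case True
    then show ?thesis
      using anti[of j i] by (auto simp: sig_def w0 d1 d2 d3)
  next
    case False
    have "L i j k x = (\<Sum>m\<in>UNIV. x $ m * L i j k (?e m))"
      using lin unfolding clin_def by blast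
    also have "\<dots> = (\<Sum>m\<in>{i, j, k}. x $ m * L i j k (?e m))"
      by (rule sum.mono_neutral_right) (auto simp: z)
    also have "\<dots> = x $ i * L i j k (?e i) + x $ j * L i j k (?e j) + x $ k * L i j k (?e k)"
      using False by simp
    also have "L i j k (?e k) = \<omega> i j"
      using \<omega>[of i j k] False by metis
    also have "L i j k (?e j) = - \<omega> i k"
      using \<omega>[of i k j] a2[of i j k "?e j"] False by metis
    also have "L i j k (?e i) = \<omega> j k"
      using \<omega>[of j k i] a1[of i j k "?e i"] a2[of j i k "?e i"] False by (metis minus_minus)
    finally show ?thesis by (simp add: sig_def)
  qed
  then show ?thesis using that[of \<omega>] anti by blast
qed

section \<open>The bivector of a distribution of degree zero\<close>

lemma hol_power: "f \<in> hol U \<Longrightarrow> (\<lambda>p. f p ^ m) \<in> hol U"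
  unfolding hol_iff by (rule cholomorphic_power)

definition wedge :: "'n \<Rightarrow> 'n \<Rightarrow> 'n \<Rightarrow> ('n::finite) vfield \<Rightarrow> 'n vfield \<Rightarrow> 'n proj \<Rightarrow> complex" where
  "wedge k i j X Y p = X p (coord k i) * Y p (coord k j) - X p (coord k j) * Y p (coord k i)"

text \<open>The numerator is the component i, j, k of x \<and> \<xi> \<and> \<eta>, unchanged when
  multiples of \<open>x\<close> are added to \<xi> or \<eta>.\<close>

lemma wedge_tv:
  assumes "x $ k \<noteq> 0" "X (abs_proj x) = tv x \<xi>" "Y (abs_proj x) = tv x \<eta>"
  shows "wedge k i j X Y (abs_proj x) = (x $ k * (\<xi> $ i * \<eta> $ j - \<xi> $ j * \<eta> $ i)
    - x $ j * (\<xi> $ i * \<eta> $ k - \<xi> $ k * \<eta> $ i) + x $ i * (\<xi> $ j * \<eta> $ k - \<xi> $ k * \<eta> $ j)) / (x $ k) ^ 3"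
  using assms by (simp add: wedge_def tv_coord field_simps power2_eq_square power3_eq_cube)

text \<open>This is the component i, j, l, k of x \<and> x \<and> \<xi> \<and> \<eta> = 0, divided
  by the fourth power of \<open>x $ k\<close>.\<close>

lemma wedge_chart_change:
  assumes x: "x $ k \<noteq> 0" "x $ l \<noteq> 0" and "X (abs_proj x) = tv x \<xi>" "Y (abs_proj x) = tv x \<eta>"
  shows "coord k l (abs_proj x) ^ 3 * wedge l i j X Y (abs_proj x) =
    coord k l (abs_proj x) * wedge k i j X Y (abs_proj x)
    + (- coord k j (abs_proj x) * wedge k i l X Y (abs_proj x) + coord k i (abs_proj x) * wedge k j l X Y (abs_proj x))"
proof -
  have "x \<noteq> 0" using x by auto
  then show ?thesis
    unfolding wedge_tv[of x k X \<xi> Y \<eta>, OF x(1) assms(3,4)] wedge_tv[of x l X \<xi> Y \<eta>, OF x(2) assms(3,4)] using x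
    by (simp add: coord_abs_proj power_divide field_simps power3_eq_cube)
qed

definition wform :: "('n::finite) subsheaf \<Rightarrow> 'n proj set \<Rightarrow> 'n \<Rightarrow> 'n \<Rightarrow> 'n \<Rightarrow> 'n altform" where
  "wform T U k i j = (\<lambda>V Xs p. if open V \<and> V \<subseteq> U \<and> length Xs = 2 \<and> set Xs \<subseteq> T V \<and> p \<in> V
     then wedge k i j (Xs ! 0) (Xs ! 1) p else 0)"

lemma length_2E:
  assumes "length Xs = 2"
  obtains X Y where "Xs = [X, Y]"
proof -
  obtain X Ys where 1: "Xs = X # Ys" "length Ys = 1"
    using assms by (cases Xs) auto
  then obtain Y where "Ys = [Y]"
    by (cases Ys) auto
  with 1 have "Xs = [X, Y]" by simp
  then show ?thesis by (rule that)
qed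

context
  fixes T :: "('n::finite) subsheaf"
  assumes sub: "subsheaf_TP T"
begin

lemmas subsheafD = sub[unfolded subsheaf_TP_def, THEN spec, THEN mp]

lemma subsheaf_subset: "open U \<Longrightarrow> X \<in> T U \<Longrightarrow> X \<in> TP U"
  using subsheafD[of U, THEN conjunct1] by (rule subsetD)

lemma subsheaf_vadd: "open U \<Longrightarrow> X \<in> T U \<Longrightarrow> Y \<in> T U \<Longrightarrow> vadd X Y \<in> T U"
  using subsheafD[of U, THEN conjunct2, THEN conjunct2, THEN conjunct1] by simp

lemma subsheaf_vscale: "open U \<Longrightarrow> X \<in> T U \<Longrightarrow> h \<in> hol U \<Longrightarrow> vscale h X \<in> T U"
  using subsheafD[of U, THEN conjunct2, THEN conjunct2, THEN conjunct2, THEN conjunct1] by simp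

lemma subsheaf_vres: "open U \<Longrightarrow> X \<in> T U \<Longrightarrow> open V \<Longrightarrow> V \<subseteq> U \<Longrightarrow> vres V X \<in> T V"
  using subsheafD[of U, THEN conjunct2, THEN conjunct2, THEN conjunct2, THEN conjunct2, THEN conjunct1] by simp

lemma subsheaf_glue:
  "open U \<Longrightarrow> X \<in> TP U \<Longrightarrow> (\<And>p. p \<in> U \<Longrightarrow> \<exists>V. open V \<and> p \<in> V \<and> V \<subseteq> U \<and> vres V X \<in> T V) \<Longrightarrow> X \<in> T U"
  using subsheafD[of U, THEN conjunct2, THEN conjunct2, THEN conjunct2, THEN conjunct2, THEN conjunct2] by simp

lemma wform_alt_forms:
  assumes U: "U \<subseteq> chart k"
  shows "wform T U k i j \<in> alt_forms 2 T U"
  unfolding alt_forms_def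
proof (intro CollectI conjI allI impI ballI)
  fix V Xs p
  assume "\<not> (open V \<and> V \<subseteq> U \<and> length Xs = 2 \<and> set Xs \<subseteq> T V \<and> p \<in> V)"
  then show "wform T U k i j V Xs p = 0"
    unfolding wform_def by (rule if_not_P)
next
  fix V and Xs :: "'n vfield list"
  assume A: "open V \<and> V \<subseteq> U \<and> length Xs = 2 \<and> set Xs \<subseteq> T V"
  then obtain X Y where Xs: "Xs = [X, Y]" using length_2E by blast
  have XY: "open V" "V \<subseteq> U" "X \<in> T V" "Y \<in> T V" using A Xs by auto
  have val: "wform T U k i j V [X', Y'] p = wedge k i j X' Y' p" if "X' \<in> T V" "Y' \<in> T V" "p \<in> V" for X' Y' p
    using XY that by (simp add: wform_def)
  have two: "m = 0 \<or> m = 1" if "m < 2" for m :: nat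
    using that by auto
  have hc: "(\<lambda>p. X' p (coord k m)) \<in> hol V" if "X' \<in> T V" for X' m
    using TP_coord_hol[OF subsheaf_subset[OF XY(1) that] XY(1) order_refl] U XY by auto
  have lin: "wedge k i j (vadd A B) Z p = wedge k i j A Z p + wedge k i j B Z p"
      "wedge k i j Z (vadd A B) p = wedge k i j Z A p + wedge k i j Z B p"
      "wedge k i j (vscale h A) Z p = h p * wedge k i j A Z p"
      "wedge k i j Z (vscale h A) p = h p * wedge k i j Z A p" for A B Z h p
    by (simp_all add: wedge_def vadd_def vscale_def algebra_simps)
  show "wform T U k i j V Xs \<in> hol V"
  proof (rule hol_cong[OF _ XY(1)])
    show "(\<lambda>p. X p (coord k i) * Y p (coord k j) - X p (coord k j) * Y p (coord k i)) \<in> hol V"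
      by (intro hol_diff hol_mult hc XY)
  qed (simp add: Xs val XY wedge_def)
  show "wform T U k i j V (Xs[m := vadd A B]) p = wform T U k i j V (Xs[m := A]) p + wform T U k i j V (Xs[m := B]) p"
    if "m < 2" "A \<in> T V" "B \<in> T V" "p \<in> V" for m A B p
    using two[OF that(1)] that(2-4) XY
    by (auto simp: Xs val subsheaf_vadd lin)
  show "wform T U k i j V (Xs[m := vscale h (Xs ! m)]) p = h p * wform T U k i j V Xs p"
    if "m < 2" "h \<in> hol V" "p \<in> V" for m h p
    using two[OF that(1)] that(2-3) XY
    by (auto simp: Xs val subsheaf_vscale lin)
  show "wform T U k i j V Xs p = 0"
    if "m < 2" "m' < 2" "m \<noteq> m' \<and> Xs ! m = Xs ! m'" "p \<in> V" for m m' p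
    using two[OF that(1)] two[OF that(2)] that(3,4) XY
    by (auto simp: Xs val wedge_def algebra_simps)
  show "wform T U k i j W (map (vres W) Xs) p = wform T U k i j V Xs p" if "open W \<and> W \<subseteq> V" "p \<in> W" for W p
  proof -
    have "vres W X \<in> T W" "vres W Y \<in> T W"
      using subsheaf_vres[OF XY(1)] XY(3,4) that by simp_all
    then show ?thesis
      using that XY by (auto simp: Xs wform_def wedge_def vres_def)
  qed
qed

end

lemma twistD:
  assumes "g \<in> twist m U"
  shows "cholomorphic_on g (cone U)" "\<And>x c. x \<in> cone U \<Longrightarrow> c \<noteq> 0 \<Longrightarrow> g (c *s x) = c powi m * g x"
    "\<And>x. x \<notin> cone U \<Longrightarrow> g x = 0"
  using assms by (simp_all add: twist_def del: cone_iff)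

lemma twist_add: "g \<in> twist m U \<Longrightarrow> h \<in> twist m U \<Longrightarrow> (\<lambda>x. g x + h x) \<in> twist m U"
  unfolding twist_def by (simp add: cholomorphic_add algebra_simps del: cone_iff)

lemma twist_mult:
  assumes "g \<in> twist m U" "h \<in> hol U"
  shows "(\<lambda>x. h (abs_proj x) * g x) \<in> twist m U"
proof -
  have "h (abs_proj (c *s x)) = h (abs_proj x)" if "x \<in> cone U" "c \<noteq> 0" for x c
    using that by simp
  moreover have "cholomorphic_on (\<lambda>x. h (abs_proj x) * g x) (cone U)"
    using assms by (intro cholomorphic_mult twistD(1)[OF assms(1)]) (simp add: hol_iff)
  ultimately show ?thesis
    using twistD[OF assms(1)] unfolding twist_def by simp
qed

lemma twist_res_in:
  assumes "g \<in> twist m U" "open V" "V \<subseteq> U"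
  shows "twist_res V g \<in> twist m V"
proof -
  have sub: "cone V \<subseteq> cone U" using assms by auto
  have "cholomorphic_on (twist_res V g) (cone V) \<longleftrightarrow> cholomorphic_on g (cone V)"
    by (rule cholomorphic_on_cong) (auto simp: twist_res_def open_cone assms)
  moreover have "cholomorphic_on g (cone V)"
    using twistD(1)[OF assms(1)] sub by (rule cholomorphic_on_subset)
  moreover have "twist_res V g (c *s x) = c powi m * twist_res V g x" if "x \<in> cone V" "c \<noteq> 0" for x c
    using that twistD(2)[OF assms(1), of x c] sub smult_in_cone[OF that] by (auto simp: twist_res_def simp del: cone_iff)
  ultimately show ?thesis
    unfolding twist_def by (simp add: twist_res_def del: cone_iff)
qed

text \<open>The isomorphism of \<open>has_c1\<close> for c = 2, fixed and unpacked. Surjectivity is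
  used on single charts, injectivity on charts and their overlaps.\<close>

locale degree_zero =
  fixes T :: "('n::finite) subsheaf"
    and \<Phi> :: "'n proj set \<Rightarrow> (complex ^ 'n \<Rightarrow> complex) \<Rightarrow> 'n altform"
  assumes sub: "subsheaf_TP T" and rank: "has_rank T 2" and tf: "torsion_free_quotient T"
    and card: "CARD('n) \<ge> 4"
    and bij: "\<And>U. open U \<Longrightarrow> bij_betw (\<Phi> U) (twist (- 2) U) (alt_forms 2 T U)"
    and Phi_add: "\<And>U g g'. open U \<Longrightarrow> g \<in> twist (- 2) U \<Longrightarrow> g' \<in> twist (- 2) U \<Longrightarrow>
      \<Phi> U (\<lambda>x. g x + g' x) = (\<lambda>V Xs p. \<Phi> U g V Xs p + \<Phi> U g' V Xs p)"
    and Phi_mult: "\<And>U h g. open U \<Longrightarrow> h \<in> hol U \<Longrightarrow> g \<in> twist (- 2) U \<Longrightarrow>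
      \<Phi> U (\<lambda>x. h (abs_proj x) * g x) = (\<lambda>V Xs p. h p * \<Phi> U g V Xs p)"
    and Phi_res: "\<And>U V g. open U \<Longrightarrow> open V \<Longrightarrow> V \<subseteq> U \<Longrightarrow> g \<in> twist (- 2) U \<Longrightarrow>
      \<Phi> V (twist_res V g) = altform_res V (\<Phi> U g)"
begin

lemma Phi_inj: "open U \<Longrightarrow> g \<in> twist (- 2) U \<Longrightarrow> g' \<in> twist (- 2) U \<Longrightarrow> \<Phi> U g = \<Phi> U g' \<Longrightarrow> g = g'"
  using bij by (meson bij_betw_imp_inj_on inj_onD)

text \<open>The function on the cone over the k-th chart that corresponds under
  \<open>\<Phi>\<close> to the form of the pair i, j.\<close>

definition sec :: "'n \<Rightarrow> 'n \<Rightarrow> 'n \<Rightarrow> complex ^ 'n \<Rightarrow> complex" where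
  "sec k i j = inv_into (twist (- 2) (chart k)) (\<Phi> (chart k)) (wform T (chart k) k i j)"

lemma sec: "sec k i j \<in> twist (- 2) (chart k)" "\<Phi> (chart k) (sec k i j) = wform T (chart k) k i j"
proof -
  have "wform T (chart k) k i j \<in> \<Phi> (chart k) ` twist (- 2) (chart k)"
    using bij[OF open_chart] wform_alt_forms[OF sub order_refl] by (simp add: bij_betw_def)
  then show "sec k i j \<in> twist (- 2) (chart k)" "\<Phi> (chart k) (sec k i j) = wform T (chart k) k i j"
    unfolding sec_def by (simp_all add: inv_into_into f_inv_into_f)
qed

lemma Phi_res_sec:
  assumes "open W" "W \<subseteq> chart k"
  shows "\<Phi> W (twist_res W (sec k i j)) = wform T W k i j"
proof -
  have "\<Phi> W (twist_res W (sec k i j)) = altform_res W (wform T (chart k) k i j)"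
    using Phi_res[OF open_chart assms sec(1)] sec(2) by simp
  also have "\<dots> = wform T W k i j"
    using assms by (auto simp: altform_res_def wform_def fun_eq_iff)
  finally show ?thesis .
qed

text \<open>\<open>wedge_chart_change\<close> transported from forms to functions: the rules for
  \<open>\<Phi>\<close> collect all terms over the overlap of the two charts, and injectivity there
  removes \<open>\<Phi>\<close>.\<close>

lemma sec_relation:
  assumes x: "x $ k \<noteq> 0" "x $ l \<noteq> 0"
  shows "(x $ l / x $ k) ^ 3 * sec l i j x =
    x $ l / x $ k * sec k i j x + (- (x $ j / x $ k) * sec k i l x + x $ i / x $ k * sec k j l x)"
proof -
  define W where "W = chart k \<inter> (chart l :: 'n proj set)"
  have W: "open W" "W \<subseteq> chart k" "W \<subseteq> chart l"
    by (auto simp: W_def open_Int open_chart)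
  have x0: "x \<noteq> 0" using x by auto
  then have xW: "x \<in> cone W"
    using x by (simp add: W_def abs_proj_in_chart)
  have hc: "coord k m \<in> hol W" for m
    by (rule hol_subset[OF hol_coord W(2)])
  have tw: "twist_res W (sec k m m') \<in> twist (- 2) W" "twist_res W (sec l m m') \<in> twist (- 2) W" for m m'
    using twist_res_in[OF sec(1) W(1)] W by auto
  have h3: "(\<lambda>p. coord k l p ^ 3) \<in> hol W" "(\<lambda>p. - coord k j p) \<in> hol W"
    using hc by (auto intro: hol_power hol_minus)
  let ?L = "\<lambda>x. (\<lambda>p. coord k l p ^ 3) (abs_proj x) * twist_res W (sec l i j) x"
  let ?R = "\<lambda>x. coord k l (abs_proj x) * twist_res W (sec k i j) x"
  let ?S = "\<lambda>x. (\<lambda>p. - coord k j p) (abs_proj x) * twist_res W (sec k i l) x"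
  let ?Q = "\<lambda>x. coord k i (abs_proj x) * twist_res W (sec k j l) x"
  note mem = twist_mult[OF tw(2)[of i j] h3(1)] twist_mult[OF tw(1)[of i j] hc[of l]]
    twist_mult[OF tw(1)[of i l] h3(2)] twist_mult[OF tw(1)[of j l] hc[of i]]
  have "\<Phi> W ?L = \<Phi> W (\<lambda>x. ?R x + (?S x + ?Q x))"
  proof -
    have "\<Phi> W (\<lambda>x. ?R x + (?S x + ?Q x)) = (\<lambda>V Xs p. \<Phi> W ?R V Xs p + (\<Phi> W ?S V Xs p + \<Phi> W ?Q V Xs p))"
      using Phi_add[OF W(1) mem(2) twist_add[OF mem(3,4)]] Phi_add[OF W(1) mem(3,4)] by simp
    also have "\<dots> = (\<lambda>V Xs p. coord k l p * wform T W k i j V Xs p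
        + (- coord k j p * wform T W k i l V Xs p + coord k i p * wform T W k j l V Xs p))"
      unfolding Phi_mult[OF W(1) hc tw(1)] Phi_mult[OF W(1) h3(2) tw(1)] Phi_res_sec[OF W(1,2)] ..
    also have "\<dots> = (\<lambda>V Xs p. coord k l p ^ 3 * wform T W l i j V Xs p)"
    proof (intro ext)
      fix V Xs p
      show "coord k l p * wform T W k i j V Xs p
        + (- coord k j p * wform T W k i l V Xs p + coord k i p * wform T W k j l V Xs p) =
        coord k l p ^ 3 * wform T W l i j V Xs p"
      proof (cases "open V \<and> V \<subseteq> W \<and> length Xs = 2 \<and> set Xs \<subseteq> T V \<and> p \<in> V")
        case True
        then obtain X Y where Xs: "Xs = [X, Y]" using length_2E by blast
        then have "X \<in> TP V" "Y \<in> TP V" using True subsheaf_subset[OF sub] by auto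
        moreover obtain y where y: "y \<noteq> 0" "p = abs_proj y" by (rule proj_cases)
        ultimately obtain \<xi> \<eta> where "X (abs_proj y) = tv y \<xi>" "Y (abs_proj y) = tv y \<eta>"
          using TP_tv[of X V y] TP_tv[of Y V y] True by metis
        moreover have "y $ k \<noteq> 0" "y $ l \<noteq> 0"
          using True y by (auto simp: W_def abs_proj_in_chart)
        ultimately show ?thesis
          using wedge_chart_change[of y k l X \<xi> Y \<eta> i j] True Xs y by (simp add: wform_def)
      qed (auto simp: wform_def)
    qed
    also have "\<dots> = \<Phi> W ?L"
      unfolding Phi_mult[OF W(1) h3(1) tw(2)] Phi_res_sec[OF W(1,3)] ..
    finally show ?thesis by simp
  qed
  then have "?L = (\<lambda>x. ?R x + (?S x + ?Q x))"
    by (rule Phi_inj[OF W(1) mem(1) twist_add[OF mem(2) twist_add[OF mem(3,4)]]])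
  from fun_cong[OF this, of x] show ?thesis
    using xW x0 by (simp add: twist_res_def coord_abs_proj del: cone_iff)
qed

lemma sec_0:
  assumes "\<And>V X Y p. X \<in> TP V \<Longrightarrow> p \<in> V \<Longrightarrow> Y \<in> TP V \<Longrightarrow> V \<subseteq> chart k \<Longrightarrow> wedge k i j X Y p = 0"
  shows "sec k i j x = 0"
proof -
  let ?U = "chart k :: 'n proj set"
  have "wform T ?U k i j = (\<lambda>V Xs p. 0)"
  proof (intro ext)
    fix V Xs p
    show "wform T ?U k i j V Xs p = 0"
    proof (cases "open V \<and> V \<subseteq> ?U \<and> length Xs = 2 \<and> set Xs \<subseteq> T V \<and> p \<in> V")
      case True
      then obtain X Y where Xs: "Xs = [X, Y]" using length_2E by blast
      then have "X \<in> TP V" "Y \<in> TP V" using True subsheaf_subset[OF sub] by auto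
      then show ?thesis using assms[of X V p Y] True Xs by (simp add: wform_def)
    qed (auto simp: wform_def)
  qed
  \<comment> \<open>Linearity over the constant function 0 shows that the zero function has the zero
    form as its image.\<close>
  then have "\<Phi> ?U (\<lambda>x. (\<lambda>p. 0) (abs_proj x) * sec k i j x) = \<Phi> ?U (sec k i j)"
    unfolding Phi_mult[OF open_chart hol_const sec(1)] sec(2) by (simp add: fun_eq_iff)
  then have "(\<lambda>x. (\<lambda>p. 0) (abs_proj x) * sec k i j x) = sec k i j"
    by (rule Phi_inj[OF open_chart twist_mult[OF sec(1) hol_const] sec(1)])
  from fun_cong[OF this, of x] show ?thesis by simp
qed

lemma coord_self_tv:
  assumes "X \<in> TP V" "p \<in> V" "V \<subseteq> chart k"
  shows "X p (coord k k) = 0"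
proof -
  obtain x where x: "x \<noteq> 0" "p = abs_proj x" by (rule proj_cases)
  moreover have "x $ k \<noteq> 0" using assms x abs_proj_in_chart[of x k] by auto
  moreover obtain \<xi> where "X (abs_proj x) = tv x \<xi>" using TP_tv[of X V x] assms x by metis
  ultimately show ?thesis by (simp add: tv_coord)
qed

lemma sec_diag: "sec k i i x = 0" "sec k i k x = 0" "sec k k j x = 0"
  by (rule sec_0; simp add: wedge_def coord_self_tv)+

lemma sec_swap: "sec k i j x = - sec k j i x"
proof -
  have 1: "(\<lambda>p. -1) \<in> hol (chart k)" by (rule hol_const)
  have "\<Phi> (chart k) (\<lambda>x. (\<lambda>p. -1) (abs_proj x) * sec k j i x) = \<Phi> (chart k) (sec k i j)"
    unfolding Phi_mult[OF open_chart 1 sec(1)] sec(2) by (auto simp: fun_eq_iff wform_def wedge_def)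
  then have "(\<lambda>x. (\<lambda>p. -1) (abs_proj x) * sec k j i x) = sec k i j"
    by (rule Phi_inj[OF open_chart twist_mult[OF sec(1) 1] sec(1)])
  from fun_cong[OF this, of x] show ?thesis by simp
qed

text \<open>The component i, j, k of the trivector on the cone, as seen from the chart k. The cube
  raises the degree from -2 to 1.\<close>

definition hsec :: "'n \<Rightarrow> 'n \<Rightarrow> 'n \<Rightarrow> complex ^ 'n \<Rightarrow> complex" where
  "hsec k i j x = (x $ k) ^ 3 * sec k i j x"

lemma hsec_hom:
  assumes "c \<noteq> 0"
  shows "hsec k i j (c *s x) = c * hsec k i j x"
proof (cases "x $ k = 0")
  case True
  then show ?thesis by (simp add: hsec_def)
next
  case False
  then have "x \<in> cone (chart k)"
    by (simp add: cone_chart del: cone_iff)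
  then have "sec k i j (c *s x) = c powi (- 2) * sec k i j x"
    using twistD(2)[OF sec(1)] assms by blast
  then show ?thesis
    using assms by (simp add: hsec_def power_int_minus power_mult_distrib field_simps power2_eq_square power3_eq_cube)
qed

lemma hsec_hol: "cholomorphic_on (hsec k i j) {x. x $ k \<noteq> 0}"
  unfolding hsec_def[abs_def] using twistD(1)[OF sec(1)[of k i j]]
  by (intro cholomorphic_mult cholomorphic_power cholomorphic_component) (simp add: cone_chart)

lemma hsec_relation:
  assumes "x $ k \<noteq> 0" "x $ l \<noteq> 0"
  shows "x $ k * hsec l i j x = x $ l * hsec k i j x - x $ j * hsec k i l x + x $ i * hsec k j l x"
proof -
  have "x $ k ^ 4 * ((x $ l / x $ k) ^ 3 * sec l i j x) =
    x $ k ^ 4 * (x $ l / x $ k * sec k i j x + (- (x $ j / x $ k) * sec k i l x + x $ i / x $ k * sec k j l x))"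
    using sec_relation[OF assms] by simp
  then show ?thesis
    using assms by (simp add: hsec_def power_divide power3_eq_cube power4_eq_xxxx distrib_left right_diff_distrib mult_ac)
qed

text \<open>The case j = k of \<open>hsec_relation\<close>. It says that the charts k and l see the
  same component up to the sign of the transposition.\<close>

lemma hsec_swap:
  assumes "x $ k \<noteq> 0" "x $ l \<noteq> 0"
  shows "hsec l i k x = - hsec k i l x"
proof -
  have "x $ k * hsec l i k x = x $ k * - hsec k i l x"
    using hsec_relation[OF assms, of i k] by (simp add: hsec_def sec_diag)
  then show ?thesis
    using assms by (simp only: mult_cancel_left) simp
qed

text \<open>By \<open>hsec_swap\<close> the component continues from \<open>x $ l \<noteq> 0\<close>
  to \<open>x $ k \<noteq> 0\<close>. It is then defined off a subspace of codimension two, as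
  \<open>homogeneous_deg1_linear\<close> demands.\<close>

lemma hsec_linear: "\<exists>D. clin D \<and> (\<forall>x. x $ l \<noteq> 0 \<longrightarrow> hsec l i k x = D x)"
proof (cases "k = l")
  case True
  then show ?thesis
    using clin_zero by (intro exI[of _ "\<lambda>x. 0"]) (simp add: hsec_def sec_diag)
next
  case False
  let ?f = "\<lambda>x. if x $ l \<noteq> 0 then hsec l i k x else - hsec k i l x"
  let ?S = "{x :: complex ^ 'n. x $ k \<noteq> 0 \<or> x $ l \<noteq> 0}"
  have op: "open {x :: complex ^ 'n. x $ m \<noteq> 0}" for m
    using open_cone[OF open_chart[of m]] by (simp add: cone_chart)
  have "cholomorphic_on ?f ?S"
  proof (rule cholomorphic_on_local)
    fix x assume "x \<in> ?S"
    then consider "x $ l \<noteq> 0" | "x $ k \<noteq> 0" by auto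
    then show "\<exists>W. x \<in> W \<and> cholomorphic_on ?f W"
    proof cases
      case 1
      have "cholomorphic_on ?f {x. x $ l \<noteq> 0} \<longleftrightarrow> cholomorphic_on (hsec l i k) {x. x $ l \<noteq> 0}"
        by (rule cholomorphic_on_cong[OF op]) simp
      from this[THEN iffD2, OF hsec_hol] show ?thesis
        by (intro exI[of _ "{x. x $ l \<noteq> 0}"] conjI CollectI 1)
    next
      case 2
      have "cholomorphic_on ?f {x. x $ k \<noteq> 0} \<longleftrightarrow> cholomorphic_on (\<lambda>x. - hsec k i l x) {x. x $ k \<noteq> 0}"
        by (rule cholomorphic_on_cong[OF op]) (simp add: hsec_swap[of _ k l i])
      from this[THEN iffD2, OF cholomorphic_minus[OF hsec_hol]] show ?thesis
        by (intro exI[of _ "{x. x $ k \<noteq> 0}"] conjI CollectI 2)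
    qed
  qed
  then obtain D where "clin D" "\<And>x. x \<in> ?S \<Longrightarrow> ?f x = D x"
    by (rule homogeneous_deg1_linear[OF False]) (auto simp: hsec_hom)
  then show ?thesis by (intro exI[of _ D]) force
qed

lemma hsec_omega:
  obtains \<omega> where "\<And>i j. \<omega> i j = - \<omega> j i"
    "\<And>i j k x. x $ k \<noteq> 0 \<Longrightarrow> hsec k i j x = sig \<omega> x i j k"
proof -
  have "\<forall>l i k. \<exists>D. clin D \<and> (\<forall>x. x $ l \<noteq> 0 \<longrightarrow> hsec l i k x = D x)"
    using hsec_linear by blast
  then obtain D where D: "\<And>l i k. clin (D l i k)" "\<And>l i k x. x $ l \<noteq> 0 \<Longrightarrow> hsec l i k x = D l i k x"
    by metis
  have a1: "D l i k x = - D l k i x" for l i k x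
  proof (rule eq_if_eq_on_dense[of _ "\<lambda>x. - D l k i x" l l])
    fix x :: "complex ^ 'n" assume "x $ l \<noteq> 0"
    then show "D l i k x = - D l k i x"
      using D(2)[of x l i k] D(2)[of x l k i] by (simp add: hsec_def sec_swap[of l i k])
  qed (intro clin_continuous D clin_minus)+
  have a2: "D l i k x = - D k i l x" for l i k x
  proof (rule eq_if_eq_on_dense[of _ "\<lambda>x. - D k i l x" l k])
    fix x :: "complex ^ 'n" assume "x $ l \<noteq> 0" "x $ k \<noteq> 0"
    then show "D l i k x = - D k i l x"
      using D(2)[of x l i k] D(2)[of x k i l] hsec_swap[of x k l i] by simp
  qed (intro clin_continuous D clin_minus)+
  have w: "x $ k * D l i j x = x $ l * D k i j x - x $ j * D k i l x + x $ i * D k j l x" for i j k l x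
  proof (rule eq_if_eq_on_dense[of "\<lambda>x. x $ k * D l i j x" "\<lambda>x. x $ l * D k i j x - x $ j * D k i l x + x $ i * D k j l x" k l])
    fix x :: "complex ^ 'n" assume "x $ k \<noteq> 0" "x $ l \<noteq> 0"
    then show "x $ k * D l i j x = x $ l * D k i j x - x $ j * D k i l x + x $ i * D k j l x"
      using hsec_relation[of x k l i j] D(2) by simp
  qed (intro continuous_intros clin_continuous D)+
  \<comment> \<open>The chart index moves to the end: the component i, j, k of the trivector is
    \<open>D k i j\<close>.\<close>
  show ?thesis
  proof (rule linear_trivector_divisible[OF card, of "\<lambda>i j k. D k i j"])
    show "clin (D k i j)" for i j k by (rule D(1))
    show "x $ k * D l i j x = x $ l * D k i j x - x $ j * D k i l x + x $ i * D k j l x" for i j k l x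
      by (rule w)
    show "D k i j x = - D j i k x" for i j k x by (rule a2)
    show "D k i j x = - D k j i x" for i j k x by (rule a1)
    fix \<omega> assume \<omega>: "\<And>i j. \<omega> i j = - \<omega> j i" "\<And>i j k x. D k i j x = sig \<omega> x i j k"
    show ?thesis
    proof (rule that[OF \<omega>(1)])
      fix i j k and x :: "complex ^ 'n" assume "x $ k \<noteq> 0"
      then show "hsec k i j x = sig \<omega> x i j k" by (simp add: D(2) \<omega>(2))
    qed
  qed
qed

text \<open>The pairing of X \<and> Y with the generator of O(-2) over the k-th chart. It is the
  common factor of all \<open>wedge k i j X Y\<close>.\<close>

definition theta :: "'n \<Rightarrow> 'n proj set \<Rightarrow> 'n vfield \<Rightarrow> 'n vfield \<Rightarrow> 'n proj \<Rightarrow> complex" where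
  "theta k V X Y = \<Phi> (chart k) (\<lambda>x. inverse (x $ k) ^ 2) V [X, Y]"

text \<open>Off the cone over the chart the function is 0, as \<open>twist\<close> requires, because
  \<open>inverse 0 = 0\<close>.\<close>

lemma inverse_square_twist: "(\<lambda>x. inverse (x $ k) ^ 2) \<in> twist (- 2) (chart k :: 'n proj set)"
  unfolding twist_def cone_chart
  by (auto simp: power_int_minus power_mult_distrib inverse_eq_divide simp del: cone_iff intro!: cholomorphic_intros)
    (simp_all add: field_simps)

lemma theta_hol:
  assumes "open V" "V \<subseteq> chart k" "X \<in> T V" "Y \<in> T V"
  shows "theta k V X Y \<in> hol V"
proof -
  have "\<Phi> (chart k) (\<lambda>x. inverse (x $ k) ^ 2) \<in> alt_forms 2 T (chart k)"
    by (rule bij_betw_apply[OF bij[OF open_chart] inverse_square_twist])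
  then show ?thesis
    using assms unfolding alt_forms_def theta_def by simp
qed

text \<open>Over the chart a section of O(-2) is a function times the generator, and linearity of
  \<open>\<Phi>\<close> pulls that function out. This separates a factor depending only on i, j from
  one depending only on \<open>X\<close>, \<open>Y\<close>; together with \<open>wedge_tv\<close>, x
  \<and> \<xi> \<and> \<eta> is a scalar multiple of the trivector.\<close>

lemma wedge_theta:
  assumes V: "open V" "V \<subseteq> chart k" "X \<in> T V" "Y \<in> T V" and x: "x \<in> cone V"
  shows "wedge k i j X Y (abs_proj x) = hsec k i j x / x $ k * theta k V X Y (abs_proj x)"
proof -
  \<comment> \<open>The quotient of \<open>sec k i j\<close> by the generator has degree 0, so it is
    a function on the chart.\<close>
  define h where "h q = (rep_proj q $ k) ^ 2 * sec k i j (rep_proj q)" for q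
  have h_abs: "h (abs_proj y) = (y $ k) ^ 2 * sec k i j y" if y: "y $ k \<noteq> 0" for y
  proof -
    have "y \<noteq> 0" using y by auto
    then obtain c where c: "c \<noteq> 0" "rep_proj (abs_proj y) = c *s y"
      by (rule rep_abs_proj)
    have "y \<in> cone (chart k)" using y by (simp add: cone_chart del: cone_iff)
    then have "sec k i j (c *s y) = c powi (- 2) * sec k i j y"
      using twistD(2)[OF sec(1)] c by blast
    then show ?thesis
      using c by (simp add: h_def power_int_minus power_mult_distrib)
  qed
  have hh: "h \<in> hol (chart k)"
  proof -
    have "cholomorphic_on (\<lambda>y. h (abs_proj y)) (cone (chart k)) \<longleftrightarrow>
        cholomorphic_on (\<lambda>y. (y $ k) ^ 2 * sec k i j y) (cone (chart k))"
      by (rule cholomorphic_on_cong[OF open_cone[OF open_chart]]) (simp add: cone_chart h_abs del: cone_iff)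
    then show ?thesis
      unfolding hol_iff using twistD(1)[OF sec(1)]
      by (simp add: cholomorphic_mult cholomorphic_power cholomorphic_component)
  qed
  have "(\<lambda>y. h (abs_proj y) * inverse (y $ k) ^ 2) = sec k i j"
  proof
    fix y
    show "h (abs_proj y) * inverse (y $ k) ^ 2 = sec k i j y"
    proof (cases "y $ k = 0")
      case True
      then have "y \<notin> cone (chart k)" by (simp add: cone_chart del: cone_iff)
      then show ?thesis using True twistD(3)[OF sec(1)] by simp
    next
      case False
      then show ?thesis by (simp add: h_abs field_simps)
    qed
  qed
  then have "wform T (chart k) k i j = (\<lambda>V Xs p. h p * \<Phi> (chart k) (\<lambda>x. inverse (x $ k) ^ 2) V Xs p)"
    using Phi_mult[OF open_chart hh inverse_square_twist] sec(2) by simp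
  from fun_cong[OF fun_cong[OF fun_cong[OF this, of V], of "[X, Y]"], of "abs_proj x"]
  have "wedge k i j X Y (abs_proj x) = h (abs_proj x) * theta k V X Y (abs_proj x)"
    using V x by (simp add: wform_def theta_def)
  moreover have "x $ k \<noteq> 0"
    using V(2) x abs_proj_in_chart[of x k] by auto
  ultimately show ?thesis
    by (simp add: h_abs hsec_def power2_eq_square power3_eq_cube)
qed

end

section \<open>Exterior products of the bivector with points and tangent vectors\<close>

definition ext4 :: "('n \<Rightarrow> 'n \<Rightarrow> complex) \<Rightarrow> complex ^ 'n \<Rightarrow> complex ^ 'n \<Rightarrow> 'n \<Rightarrow> 'n \<Rightarrow> 'n \<Rightarrow> 'n \<Rightarrow> complex" where
  "ext4 \<omega> x \<zeta> i j k l = \<zeta> $ i * sig \<omega> x j k l - \<zeta> $ j * sig \<omega> x i k l + \<zeta> $ k * sig \<omega> x i j l - \<zeta> $ l * sig \<omega> x i j k"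

text \<open>Subtracting from \<zeta> the multiple of \<open>x\<close> that cancels its k-th
  component changes nothing, since x \<and> x \<and> \<omega> = 0. The condition on \<zeta> thus
  becomes one on the tangent vector.\<close>

lemma ext4_tv_coord:
  assumes "x $ k \<noteq> 0"
  shows "ext4 \<omega> x \<zeta> i j l k = x $ k * (tv x \<zeta> (coord k i) * sig \<omega> x j l k
    - tv x \<zeta> (coord k j) * sig \<omega> x i l k + tv x \<zeta> (coord k l) * sig \<omega> x i j k)"
proof -
  have c: "x $ k * tv x \<zeta> (coord k m) = \<zeta> $ m - x $ m * (\<zeta> $ k / x $ k)" for m
    using assms by (simp add: tv_coord field_simps power2_eq_square)
  have "x $ k * (tv x \<zeta> (coord k i) * sig \<omega> x j l k
    - tv x \<zeta> (coord k j) * sig \<omega> x i l k + tv x \<zeta> (coord k l) * sig \<omega> x i j k) =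
    (x $ k * tv x \<zeta> (coord k i)) * sig \<omega> x j l k
    - (x $ k * tv x \<zeta> (coord k j)) * sig \<omega> x i l k + (x $ k * tv x \<zeta> (coord k l)) * sig \<omega> x i j k"
    by (simp add: algebra_simps)
  also have "\<dots> = ext4 \<omega> x \<zeta> i j l k + (\<zeta> $ k / x $ k) * (x $ k * sig \<omega> x i j l
     - x $ i * sig \<omega> x j l k + x $ j * sig \<omega> x i l k - x $ l * sig \<omega> x i j k)"
    unfolding c using assms by (simp add: ext4_def algebra_simps)
  also have "x $ k * sig \<omega> x i j l
     - x $ i * sig \<omega> x j l k + x $ j * sig \<omega> x i l k - x $ l * sig \<omega> x i j k = 0"
    by (simp add: sig_def algebra_simps)
  finally show ?thesis by simp
qed

text \<open>The product of \<open>x\<close> with \<zeta> \<and> x \<and> \<omega> vanishes. As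
  \<open>x $ k \<noteq> 0\<close>, the components containing the index k determine all
  others.\<close>

lemma ext4_all_zero:
  assumes "x $ k \<noteq> 0" and "\<And>i j l. ext4 \<omega> x \<zeta> i j l k = 0"
  shows "ext4 \<omega> x \<zeta> a b c d = 0"
proof -
  have "x $ k * ext4 \<omega> x \<zeta> a b c d = x $ d * ext4 \<omega> x \<zeta> a b c k - x $ c * ext4 \<omega> x \<zeta> a b d k
      + x $ b * ext4 \<omega> x \<zeta> a c d k - x $ a * ext4 \<omega> x \<zeta> b c d k"
    unfolding ext4_def sig_def by (simp add: algebra_simps)
  then show ?thesis
    using assms by simp
qed

definition plu :: "('n \<Rightarrow> 'n \<Rightarrow> complex) \<Rightarrow> 'n \<Rightarrow> 'n \<Rightarrow> 'n \<Rightarrow> 'n \<Rightarrow> complex" where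
  "plu \<omega> a b c d = \<omega> a b * \<omega> c d - \<omega> a c * \<omega> b d + \<omega> a d * \<omega> b c"

text \<open>Fixing the last index contracts the trivector to a bivector, and the bracket is the
  component a, b, c, d, k of x \<and> \<open>plu \<omega>\<close>. Decomposability of x \<and>
  \<omega> thereby becomes an equation linear in \<open>x\<close>.\<close>

lemma plu_sig:
  "plu (\<lambda>i j. sig \<omega> x i j k) a b c d = x $ k * (x $ k * plu \<omega> a b c d - x $ d * plu \<omega> a b c k
    + x $ c * plu \<omega> a b d k - x $ b * plu \<omega> a c d k + x $ a * plu \<omega> b c d k)"
  unfolding plu_def sig_def by (simp add: algebra_simps)

section \<open>Relations between germs of vector fields\<close>

lemma lincomb_1: "lincomb [h] [X] q f = h q * X q f"
  by (simp add: lincomb_def)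

lemma lincomb_2: "lincomb [h1, h2] [X, Y] q f = h1 q * X q f + h2 q * Y q f"
  by (simp add: lincomb_def)

lemma lincomb_3: "lincomb [h0, h1, h2] [Z, X, Y] q f = h0 q * Z q f + h1 q * X q f + h2 q * Y q f"
  by (simp add: lincomb_def eval_nat_numeral)

lemma vres_eq_vzero: "vres V Z = vzero \<longleftrightarrow> (\<forall>q\<in>V. \<forall>f. Z q f = 0)"
  by (auto simp: vres_def vzero_def fun_eq_iff)

lemma germs_independent_vres:
  assumes "germs_independent p U Xs" "W \<subseteq> U"
  shows "germs_independent p W (map (vres W) Xs)"
  unfolding germs_independent_def
proof (intro allI impI)
  fix V and hs :: "('a proj \<Rightarrow> complex) list"
  assume A: "open V \<and> p \<in> V \<and> V \<subseteq> W \<and> length hs = length (map (vres W) Xs) \<and> set hs \<subseteq> hol V \<and>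
    vres V (lincomb hs (map (vres W) Xs)) = vzero"
  have "lincomb hs Xs q f = lincomb hs (map (vres W) Xs) q f" if "q \<in> V" for q f
  proof -
    have "q \<in> W" using A that by blast
    then show ?thesis by (simp add: lincomb_def vres_def)
  qed
  then have "vres V (lincomb hs Xs) = vzero"
    using A by (simp add: vres_eq_vzero)
  moreover have "V \<subseteq> U" using A assms(2) by blast
  ultimately have "open V \<and> p \<in> V \<and> V \<subseteq> U \<and> length hs = length Xs \<and> set hs \<subseteq> hol V \<and>
      vres V (lincomb hs Xs) = vzero"
    using A by simp
  then show "\<forall>h\<in>set hs. \<forall>\<^sub>F q in nhds p. h q = 0"
    by (rule assms(1)[unfolded germs_independent_def, THEN spec, THEN spec, THEN mp])
qed

lemma germs_independent_pairD:
  assumes "germs_independent p W [X, Y]" "open V" "p \<in> V" "V \<subseteq> W" "h1 \<in> hol V" "h2 \<in> hol V"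
    and "\<And>q f. q \<in> V \<Longrightarrow> h1 q * X q f + h2 q * Y q f = 0"
  shows "\<forall>\<^sub>F q in nhds p. h1 q = 0" "\<forall>\<^sub>F q in nhds p. h2 q = 0"
proof -
  have "open V \<and> p \<in> V \<and> V \<subseteq> W \<and> length [h1, h2] = length [X, Y] \<and> set [h1, h2] \<subseteq> hol V \<and>
      vres V (lincomb [h1, h2] [X, Y]) = vzero"
    using assms(2-) by (simp add: vres_eq_vzero lincomb_2)
  then have "\<forall>h\<in>set [h1, h2]. \<forall>\<^sub>F q in nhds p. h q = 0"
    by (rule assms(1)[unfolded germs_independent_def, THEN spec, THEN spec, THEN mp])
  then show "\<forall>\<^sub>F q in nhds p. h1 q = 0" "\<forall>\<^sub>F q in nhds p. h2 q = 0"
    by simp_all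
qed

lemma TP_comb_zero:
  assumes X: "X \<in> TP W" and Y: "Y \<in> TP W" and Z: "Z \<in> TP W" and q: "q \<in> W" "q \<in> chart k"
    and 0: "\<And>j. c * Z q (coord k j) + a * X q (coord k j) + b * Y q (coord k j) = 0"
  shows "c * Z q f + a * X q f + b * Y q f = 0"
proof -
  obtain x where x: "x \<noteq> 0" "q = abs_proj x" by (rule proj_cases)
  have xk: "x $ k \<noteq> 0" using q x by (simp add: abs_proj_in_chart)
  obtain \<xi> \<eta> \<zeta> where t: "X q = tv x \<xi>" "Y q = tv x \<eta>" "Z q = tv x \<zeta>"
    using TP_tv[OF X] TP_tv[OF Y] TP_tv[OF Z] q x by metis
  define u where "u = c *s \<zeta> + a *s \<xi> + b *s \<eta>"
  have u: "c * Z q f + a * X q f + b * Y q f = tv x u f" for f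
    using x(1) by (simp add: t u_def tv_add tv_smult)
  have "lift k x (tv x u) = 0"
    using 0 unfolding u by (simp add: lift_def vec_eq_iff)
  then have "tv x u = tv x 0"
    using tangent_vector_eq_tv[OF tangent_vector_tv[OF x(1)] xk, of u] by simp
  then show ?thesis
    using x(1) by (simp add: u tv_zero)
qed

text \<open>If all minors vanished near \<open>p\<close>, then \<open>X q (coord k i)\<close> and
  \<open>- Y q (coord k i)\<close> would be coefficients of a relation between \<open>Y\<close> and
  \<open>X\<close>. Independence would kill them, so \<open>X\<close> would vanish near
  \<open>p\<close>, and the relation with coefficients 1 and 0 would contradict
  independence.\<close>

lemma wedge_nonzero_germ:
  assumes W: "open W" "p \<in> W" "W \<subseteq> chart k" and X: "X \<in> TP W" and Y: "Y \<in> TP W"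
    and ind: "germs_independent p W [X, Y]"
  obtains i j where "\<not> (\<forall>\<^sub>F q in nhds p. wedge k i j X Y q = 0)"
proof (rule ccontr)
  assume "\<not> thesis"
  then have "\<forall>i j. \<forall>\<^sub>F q in nhds p. wedge k i j X Y q = 0"
    using that by blast
  then have "\<forall>\<^sub>F q in nhds p. \<forall>i j. wedge k i j X Y q = 0"
    by (simp add: eventually_all_finite)
  then obtain V where V: "open V" "p \<in> V" "\<And>q i j. q \<in> V \<Longrightarrow> wedge k i j X Y q = 0"
    by (auto simp: eventually_nhds)
  have hc: "(\<lambda>q. X q (coord k i)) \<in> hol W" "(\<lambda>q. Y q (coord k i)) \<in> hol W" for i
    using TP_coord_hol[OF X W(1) order_refl W(3)] TP_coord_hol[OF Y W(1) order_refl W(3)] by auto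
  have Xi: "\<forall>\<^sub>F q in nhds p. X q (coord k i) = 0" for i
  proof (rule germs_independent_pairD(2)[OF ind, of "V \<inter> W" "\<lambda>q. - Y q (coord k i)"])
    show "(\<lambda>q. - Y q (coord k i)) \<in> hol (V \<inter> W)" "(\<lambda>q. X q (coord k i)) \<in> hol (V \<inter> W)"
      by (rule hol_subset[of _ W], intro hol_minus hc, blast)+
    fix q f assume q: "q \<in> V \<inter> W"
    have "0 * X q f + - Y q (coord k i) * X q f + X q (coord k i) * Y q f = 0"
    proof (rule TP_comb_zero[OF X Y X, of q k])
      fix j
      show "0 * X q (coord k j) + - Y q (coord k i) * X q (coord k j) + X q (coord k i) * Y q (coord k j) = 0"
        using V(3)[of q i j] q by (simp add: wedge_def mult.commute)
    qed (use q W in auto)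
    then show "- Y q (coord k i) * X q f + X q (coord k i) * Y q f = 0" by simp
  qed (use V W in auto)
  then have "\<forall>\<^sub>F q in nhds p. \<forall>i. X q (coord k i) = 0"
    by (simp add: eventually_all_finite)
  then obtain V' where V': "open V'" "p \<in> V'" "\<And>q i. q \<in> V' \<Longrightarrow> X q (coord k i) = 0"
    by (auto simp: eventually_nhds)
  have "\<forall>\<^sub>F q in nhds p. (1::complex) = 0"
  proof (rule germs_independent_pairD(1)[OF ind, of "V' \<inter> W" "\<lambda>q. 1" "\<lambda>q. 0"])
    fix q f assume q: "q \<in> V' \<inter> W"
    have "0 * X q f + 1 * X q f + 0 * Y q f = 0"
    proof (rule TP_comb_zero[OF X Y X, of q k])
      show "0 * X q (coord k j) + 1 * X q (coord k j) + 0 * Y q (coord k j) = 0" for j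
        using V'(3)[of q j] q by simp
    qed (use q W in auto)
    then show "1 * X q f + 0 * Y q f = 0" by simp
  qed (use V' W in \<open>auto intro: hol_const\<close>)
  then have "(1::complex) = 0" by (rule eventually_nhds_x_imp_x)
  then show False by simp
qed

section \<open>Membership in \<open>T\<close> in terms of the bivector\<close>

locale degree_zero_bivector = degree_zero T \<Phi> for T :: "('n::finite) subsheaf" and \<Phi> +
  fixes \<omega> :: "'n \<Rightarrow> 'n \<Rightarrow> complex"
  assumes anti: "\<And>i j. \<omega> i j = - \<omega> j i"
    and hsec_sig: "\<And>i j k x. x $ k \<noteq> 0 \<Longrightarrow> hsec k i j x = sig \<omega> x i j k"
begin

text \<open>Only independence of germs is obtained: \<open>X\<close> and \<open>Y\<close> may be
  dependent at single points and need not generate \<open>T\<close>.\<close>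

lemma local_generators:
  assumes "open U" "p \<in> U" "p \<in> chart k"
  obtains W X Y where "open W" "p \<in> W" "W \<subseteq> U" "W \<subseteq> chart k" "X \<in> T W" "Y \<in> T W"
    "germs_independent p W [X, Y]"
proof -
  have "has_independent_germs T p 2" using rank by (simp add: has_rank_def)
  then obtain U' Xs where U': "open U'" "p \<in> U'" "length Xs = 2" "set Xs \<subseteq> T U'" "germs_independent p U' Xs"
    unfolding has_independent_germs_def by blast
  obtain X Y where Xs: "Xs = [X, Y]" using length_2E[OF U'(3)] .
  define W where "W = U \<inter> U' \<inter> chart k"
  have W: "open W" "p \<in> W" "W \<subseteq> U" "W \<subseteq> chart k" "W \<subseteq> U'"
    using assms U' by (auto simp: W_def open_Int open_chart)
  show ?thesis
  proof (rule that[OF W(1-4)])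
    show "vres W X \<in> T W" "vres W Y \<in> T W"
      using subsheaf_vres[OF sub U'(1) _ W(1) W(5)] U' Xs by auto
    show "germs_independent p W [vres W X, vres W Y]"
      using germs_independent_vres[OF U'(5) W(5)] Xs by simp
  qed
qed

text \<open>Rank two provides a relation with some nonzero coefficient germ. If the coefficient of
  \<open>Z\<close> vanished near \<open>p\<close>, independence of \<open>X\<close> and
  \<open>Y\<close> would kill the other two as well.\<close>

lemma local_dependence:
  assumes W: "open W" "p \<in> W" and ZXY: "Z \<in> T W" "X \<in> T W" "Y \<in> T W"
    and ind: "germs_independent p W [X, Y]"
  obtains V h0 h1 h2 where "open V" "p \<in> V" "V \<subseteq> W" "h0 \<in> hol V" "h1 \<in> hol V" "h2 \<in> hol V"
    "\<And>q f. q \<in> V \<Longrightarrow> h0 q * Z q f + h1 q * X q f + h2 q * Y q f = 0" "\<not> (\<forall>\<^sub>F q in nhds p. h0 q = 0)"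
proof -
  have "\<not> has_independent_germs T p (Suc 2)" using rank by (simp add: has_rank_def)
  then have "\<not> germs_independent p W [Z, X, Y]"
    unfolding has_independent_germs_def using W ZXY by auto
  then obtain V hs where V: "open V" "p \<in> V" "V \<subseteq> W" "length hs = 3" "set hs \<subseteq> hol V"
      "vres V (lincomb hs [Z, X, Y]) = vzero" and hs: "\<exists>h\<in>set hs. \<not> (\<forall>\<^sub>F q in nhds p. h q = 0)"
    unfolding germs_independent_def by (auto simp: eval_nat_numeral)
  obtain h0 h1 h2 where h: "hs = [h0, h1, h2]"
  proof -
    obtain h0 hs' where 1: "hs = h0 # hs'" "length hs' = 2" using V(4) by (cases hs) auto
    obtain h1 h2 where "hs' = [h1, h2]" using length_2E[OF 1(2)] .
    with 1 have "hs = [h0, h1, h2]" by simp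
    then show thesis by (rule that)
  qed
  have eq: "h0 q * Z q f + h1 q * X q f + h2 q * Y q f = 0" if "q \<in> V" for q f
    using V(6) that unfolding vres_eq_vzero h lincomb_3 by blast
  have hol: "h0 \<in> hol V" "h1 \<in> hol V" "h2 \<in> hol V" using V(5) h by auto
  have "\<not> (\<forall>\<^sub>F q in nhds p. h0 q = 0)"
  proof
    assume h0: "\<forall>\<^sub>F q in nhds p. h0 q = 0"
    then obtain V' where V': "open V'" "p \<in> V'" "\<And>q. q \<in> V' \<Longrightarrow> h0 q = 0"
      by (auto simp: eventually_nhds)
    have "(\<forall>\<^sub>F q in nhds p. h1 q = 0) \<and> (\<forall>\<^sub>F q in nhds p. h2 q = 0)"
    proof -
      have 1: "h1 q * X q f + h2 q * Y q f = 0" if "q \<in> V \<inter> V'" for q f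
        using eq[of q f] V'(3)[of q] that by simp
      have 2: "h1 \<in> hol (V \<inter> V')" "h2 \<in> hol (V \<inter> V')"
        using hol by (auto intro: hol_subset)
      show ?thesis
        using germs_independent_pairD[OF ind, of "V \<inter> V'" h1 h2] 1 2 V V' by (auto simp: open_Int)
    qed
    then show False using hs h h0 by simp
  qed
  then show ?thesis using that[OF V(1-3) hol eq] by blast
qed

lemma wedge_sig:
  assumes "open V" "V \<subseteq> chart k" "X \<in> T V" "Y \<in> T V" "x \<in> cone V"
  shows "wedge k i j X Y (abs_proj x) = sig \<omega> x i j k / x $ k * theta k V X Y (abs_proj x)"
proof -
  have "x $ k \<noteq> 0" using assms(2,5) abs_proj_in_chart[of x k] by auto
  then show ?thesis using wedge_theta[OF assms] hsec_sig by simp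
qed

text \<open>
  \<open>Z\<close> and two independent sections \<open>X\<close>, \<open>Y\<close> are dependent, so \<open>Z \<and> X \<and> Y\<close> is killed by a nonzero germ;
  germs form an integral domain and \<open>X \<and> Y\<close> is a nonzero multiple of \<open>x \<and> \<omega>\<close>.
\<close>

lemma TP_ext4_zero_if:
  assumes U: "open U" and Z: "Z \<in> T U" and x: "x \<in> cone U" and \<zeta>: "Z (abs_proj x) = tv x \<zeta>"
  shows "ext4 \<omega> x \<zeta> a b c d = 0"
proof -
  have x0: "x \<noteq> 0" using x by simp
  obtain k where xk: "x $ k \<noteq> 0" using x0 by (auto simp: vec_eq_iff)
  let ?p = "abs_proj x"
  have p: "?p \<in> U" "?p \<in> chart k"
    using x x0 xk by (auto simp: abs_proj_in_chart)
  obtain W X Y where W: "open W" "?p \<in> W" "W \<subseteq> U" "W \<subseteq> chart k" and XY: "X \<in> T W" "Y \<in> T W"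
      and ind: "germs_independent ?p W [X, Y]"
    using local_generators[OF U p] .
  define Z' where "Z' = vres W Z"
  have Z': "Z' \<in> T W" unfolding Z'_def by (rule subsheaf_vres[OF sub U Z W(1) W(3)])
  obtain V h0 h1 h2 where V: "open V" "?p \<in> V" "V \<subseteq> W" and h: "h0 \<in> hol V" "h1 \<in> hol V" "h2 \<in> hol V"
    and dep: "\<And>q f. q \<in> V \<Longrightarrow> h0 q * Z' q f + h1 q * X q f + h2 q * Y q f = 0"
    and h0: "\<not> (\<forall>\<^sub>F q in nhds ?p. h0 q = 0)"
    by (rule local_dependence[OF W(1,2) Z' XY ind], rule that)
  note TPW = subsheaf_subset[OF sub W(1)]
  obtain i0 j0 where nz: "\<not> (\<forall>\<^sub>F q in nhds ?p. wedge k i0 j0 X Y q = 0)"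
    using wedge_nonzero_germ[OF W(1,2,4) TPW[OF XY(1)] TPW[OF XY(2)] ind] .
  have th: "theta k W X Y \<in> hol W" by (rule theta_hol[OF W(1,4) XY])
  have hc: "(\<lambda>q. Z' q (coord k i)) \<in> hol W" for i
    by (rule TP_coord_hol[OF TPW[OF Z'] W(1) order_refl W(4)])
  have eqV: "\<forall>\<^sub>F q in nhds ?p. q \<in> W" using W eventually_nhds by blast
  have th_nz: "\<not> (\<forall>\<^sub>F q in nhds ?p. theta k W X Y q = 0)"
  proof
    assume "\<forall>\<^sub>F q in nhds ?p. theta k W X Y q = 0"
    with eqV have "\<forall>\<^sub>F q in nhds ?p. wedge k i0 j0 X Y q = 0"
    proof eventually_elim
      case (elim q)
      obtain y where "y \<noteq> 0" "q = abs_proj y" by (rule proj_cases)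
      then show ?case using elim wedge_sig[OF W(1,4) XY, of y i0 j0] by simp
    qed
    then show False using nz by simp
  qed
  \<comment> \<open>Dividing the components of x \<and> \<omega> by \<open>x $ k\<close> makes them
    functions on the chart, so that the statement about germs applies to them.\<close>
  define S where "S i j q = sig \<omega> (\<chi> m. coord k m q) i j k" for i j q
  have S_abs: "S i j (abs_proj y) = sig \<omega> y i j k / y $ k" if "y $ k \<noteq> 0" for i j y
  proof -
    have "y \<noteq> 0" using that by auto
    then show ?thesis
      using that by (simp add: S_def sig_def coord_abs_proj field_simps)
  qed
  have wS: "wedge k i j X Y q = S i j q * theta k W X Y q" if "q \<in> W" for i j q
  proof -
    obtain y where y: "y \<noteq> 0" "q = abs_proj y" by (rule proj_cases)
    then have "y $ k \<noteq> 0" using that W(4) abs_proj_in_chart[of y k] by auto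
    then show ?thesis using y that wedge_sig[OF W(1,4) XY, of y i j] by (simp add: S_abs)
  qed
  have zero: "ext4 \<omega> x \<zeta> i j l k = 0" for i j l
  proof -
    \<comment> \<open>Times \<open>theta k W X Y q\<close>, this is a component of Z \<and> X \<and>
      Y in affine coordinates.\<close>
    define C where "C q = Z' q (coord k i) * S j l q - Z' q (coord k j) * S i l q + Z' q (coord k l) * S i j q" for q
    have "S i j \<in> hol (chart k)" for i j
      unfolding S_def[abs_def] sig_def by (simp, intro hol_add hol_diff hol_mult hol_const hol_coord)
    then have S_hol: "S i j \<in> hol W" for i j
      using W(4) by (rule hol_subset)
    have C_hol: "C \<in> hol W"
      unfolding C_def[abs_def] by (intro hol_add hol_diff hol_mult hc S_hol)
    have "\<forall>\<^sub>F q in nhds ?p. q \<in> V" using V eventually_nhds by blast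
    then have "\<forall>\<^sub>F q in nhds ?p. h0 q * (theta k W X Y q * C q) = 0"
    proof eventually_elim
      case (elim q)
      have qW: "q \<in> W" using elim V by blast
      have d: "h0 q * Z' q (coord k m) = - (h1 q * X q (coord k m) + h2 q * Y q (coord k m))" for m
        using dep[OF elim, of "coord k m"] by (simp only: eq_neg_iff_add_eq_0 add.assoc)
      have "h0 q * (theta k W X Y q * C q) = h0 q * Z' q (coord k i) * wedge k j l X Y q
          - h0 q * Z' q (coord k j) * wedge k i l X Y q + h0 q * Z' q (coord k l) * wedge k i j X Y q"
        by (simp add: C_def wS[OF qW] algebra_simps)
      \<comment> \<open>A three by three determinant in which the row of \<open>h0 q * Z'\<close> is
        a combination of the rows of \<open>X\<close> and \<open>Y\<close>.\<close>
      also have "\<dots> = 0"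
        unfolding d wedge_def by (simp add: algebra_simps)
      finally show ?case .
    qed
    then have "\<forall>\<^sub>F q in nhds ?p. theta k W X Y q * C q = 0"
      using germ_mult_eq_0[of ?p h0 "\<lambda>q. theta k W X Y q * C q"] h0
        hol_atI[OF h(1) V(1,2)] hol_atI[OF hol_mult[OF th C_hol] W(1,2)] by blast
    then have "\<forall>\<^sub>F q in nhds ?p. C q = 0"
      using germ_mult_eq_0[of ?p "theta k W X Y" C] th_nz
        hol_atI[OF th W(1,2)] hol_atI[OF C_hol W(1,2)] by blast
    then have "C ?p = 0" by (rule eventually_nhds_x_imp_x)
    moreover have "C ?p = (tv x \<zeta> (coord k i) * sig \<omega> x j l k
      - tv x \<zeta> (coord k j) * sig \<omega> x i l k + tv x \<zeta> (coord k l) * sig \<omega> x i j k) / x $ k"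
      using W(2) \<zeta> xk by (simp add: C_def Z'_def vres_def S_abs add_divide_distrib diff_divide_distrib)
    ultimately have "tv x \<zeta> (coord k i) * sig \<omega> x j l k
      - tv x \<zeta> (coord k j) * sig \<omega> x i l k + tv x \<zeta> (coord k l) * sig \<omega> x i j k = 0"
      using xk by simp
    then show ?thesis
      by (simp add: ext4_tv_coord[OF xk])
  qed
  show ?thesis by (rule ext4_all_zero[OF xk zero])
qed

text \<open>
  By Cramer's rule a nonzero minor of \<open>X \<and> Y\<close> times \<open>Z\<close> is a combination of \<open>X\<close> and \<open>Y\<close>; torsion
  freeness of the quotient then gives \<open>Z\<close> itself.
\<close>

lemma TP_if_ext4_zero:
  assumes U: "open U" and Z: "Z \<in> TP U"
    and E: "\<And>x \<zeta> a b c d. x \<in> cone U \<Longrightarrow> Z (abs_proj x) = tv x \<zeta> \<Longrightarrow> ext4 \<omega> x \<zeta> a b c d = 0"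
  shows "Z \<in> T U"
proof (rule subsheaf_glue[OF sub U Z])
  fix p assume p: "p \<in> U"
  obtain k where pk: "p \<in> chart k" by (rule in_some_chart)
  obtain W X Y where W: "open W" "p \<in> W" "W \<subseteq> U" "W \<subseteq> chart k" and XY: "X \<in> T W" "Y \<in> T W"
      and ind: "germs_independent p W [X, Y]"
    using local_generators[OF U p pk] .
  note TPW = subsheaf_subset[OF sub W(1)]
  obtain i j where nz: "\<not> (\<forall>\<^sub>F q in nhds p. wedge k i j X Y q = 0)"
    using wedge_nonzero_germ[OF W(1,2,4) TPW[OF XY(1)] TPW[OF XY(2)] ind] .
  define Z' where "Z' = vres W Z"
  have Z': "Z' \<in> TP W" unfolding Z'_def by (rule vres_TP[OF Z W(1) W(3)])
  have hc: "(\<lambda>q. X' q (coord k m)) \<in> hol W" if "X' \<in> TP W" for X' m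
    by (rule TP_coord_hol[OF that W(1) order_refl W(4)])
  have hw: "(\<lambda>q. wedge k i j X' Y' q) \<in> hol W" if "X' \<in> TP W" "Y' \<in> TP W" for X' Y'
    unfolding wedge_def by (intro hol_diff hol_mult hc that)
  \<comment> \<open>The three by three minors of \<open>Z\<close>, \<open>X\<close>,
    \<open>Y\<close>. By \<open>wedge_sig\<close> they are multiples of the vanishing components of
    \<open>ext4\<close>.\<close>
  have Zx: "tv y \<zeta> (coord k a) * wedge k b c X Y (abs_proj y) - tv y \<zeta> (coord k b) * wedge k a c X Y (abs_proj y)
      + tv y \<zeta> (coord k c) * wedge k a b X Y (abs_proj y) = 0"
    if y: "y \<in> cone W" "Z (abs_proj y) = tv y \<zeta>" for y \<zeta> a b c
  proof -
    have yk: "y $ k \<noteq> 0" using y W(4) abs_proj_in_chart[of y k] by auto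
    have "y \<in> cone U" using y W by auto
    then have "ext4 \<omega> y \<zeta> a b c k = 0" using E y by blast
    then have "tv y \<zeta> (coord k a) * sig \<omega> y b c k
      - tv y \<zeta> (coord k b) * sig \<omega> y a c k + tv y \<zeta> (coord k c) * sig \<omega> y a b k = 0"
      using yk by (simp add: ext4_tv_coord[OF yk])
    then have "theta k W X Y (abs_proj y) / y $ k * (tv y \<zeta> (coord k a) * sig \<omega> y b c k
      - tv y \<zeta> (coord k b) * sig \<omega> y a c k + tv y \<zeta> (coord k c) * sig \<omega> y a b k) = 0"
      by simp
    then show ?thesis
      unfolding wedge_sig[OF W(1,4) XY y(1)] by (simp add: algebra_simps)
  qed
  have "vscale (wedge k i j X Y) Z' = vadd (vscale (wedge k i j Z' Y) X) (vscale (wedge k i j X Z') Y)"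
  proof (intro ext)
    fix q f
    show "vscale (wedge k i j X Y) Z' q f = vadd (vscale (wedge k i j Z' Y) X) (vscale (wedge k i j X Z') Y) q f"
    proof (cases "q \<in> W")
      case True
      have "wedge k i j X Y q * Z' q f + (- wedge k i j Z' Y q) * X q f + (- wedge k i j X Z' q) * Y q f = 0"
      proof (rule TP_comb_zero[OF TPW[OF XY(1)] TPW[OF XY(2)] Z' True, of k])
        show "q \<in> chart k" using True W by blast
        fix l
        obtain y where y: "y \<noteq> 0" "q = abs_proj y" by (rule proj_cases)
        have "q \<in> U" using True W by blast
        then obtain \<zeta> where \<zeta>: "Z (abs_proj y) = tv y \<zeta>" using TP_tv[OF Z] y by metis
        have Zt: "Z' q = tv y \<zeta>" using \<zeta> True y by (simp add: Z'_def vres_def)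
        have "tv y \<zeta> (coord k i) * wedge k j l X Y q - tv y \<zeta> (coord k j) * wedge k i l X Y q
          + tv y \<zeta> (coord k l) * wedge k i j X Y q = 0"
          using Zx[OF _ \<zeta>] y True by simp
        then show "wedge k i j X Y q * Z' q (coord k l) + (- wedge k i j Z' Y q) * X q (coord k l)
            + (- wedge k i j X Z' q) * Y q (coord k l) = 0"
          by (simp add: wedge_def Zt algebra_simps)
      qed
      then show ?thesis by (simp add: vscale_def vadd_def algebra_simps)
    next
      case False
      then show ?thesis
        using TP_outside[OF Z'] TP_outside[OF TPW[OF XY(1)]] TP_outside[OF TPW[OF XY(2)]]
        by (simp add: vscale_def vadd_def)
    qed
  qed
  also have "\<dots> \<in> T W"
    by (intro subsheaf_vadd[OF sub] subsheaf_vscale[OF sub] W XY hw Z' TPW)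
  finally have "vscale (wedge k i j X Y) Z' \<in> T W" .
  moreover have "wedge k i j X Y \<in> hol W"
    using hw[OF TPW[OF XY(1)] TPW[OF XY(2)]] by simp
  ultimately obtain V where V: "open V" "p \<in> V" "V \<subseteq> W" "vres V Z' \<in> T V"
    using tf W Z' nz unfolding torsion_free_quotient_def by metis
  moreover have "vres V Z' = vres V Z"
    using V(3) by (auto simp: Z'_def vres_def fun_eq_iff)
  ultimately show "\<exists>V. open V \<and> p \<in> V \<and> V \<subseteq> U \<and> vres V Z \<in> T V"
    using W(3) by (metis order_trans)
qed

lemma in_T_iff:
  assumes "open U"
  shows "Z \<in> T U \<longleftrightarrow> Z \<in> TP U \<and> (\<forall>x\<in>cone U. \<forall>\<zeta>. Z (abs_proj x) = tv x \<zeta> \<longrightarrow> (\<forall>a b c d. ext4 \<omega> x \<zeta> a b c d = 0))"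
proof (intro iffI conjI ballI allI impI)
  show "Z \<in> TP U" if "Z \<in> T U"
    using that by (rule subsheaf_subset[OF sub assms])
  show "ext4 \<omega> x \<zeta> a b c d = 0" if "Z \<in> T U" "x \<in> cone U" "Z (abs_proj x) = tv x \<zeta>" for x \<zeta> a b c d
    using that by (rule TP_ext4_zero_if[OF assms])
  show "Z \<in> T U" if Z: "Z \<in> TP U \<and> (\<forall>x\<in>cone U. \<forall>\<zeta>. Z (abs_proj x) = tv x \<zeta> \<longrightarrow> (\<forall>a b c d. ext4 \<omega> x \<zeta> a b c d = 0))"
  proof (rule TP_if_ext4_zero[OF assms])
    show "Z \<in> TP U" using Z by simp
    show "ext4 \<omega> x \<zeta> a b c d = 0" if "x \<in> cone U" "Z (abs_proj x) = tv x \<zeta>" for x \<zeta> a b c d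
      using Z that by (simp del: cone_iff)
  qed
qed

text \<open>Where \<open>theta\<close> is nonzero, \<open>wedge_sig\<close> makes the components
  with last index k proportional to the two by two minors of \<open>X\<close> and \<open>Y\<close>,
  and such minors satisfy the Pluecker relations. A nonzero minor shows that the set is not
  empty.\<close>

lemma generic_decomposable:
  obtains B where "open B" "B \<noteq> {}" "\<And>x. x \<in> B \<Longrightarrow> x $ k \<noteq> 0"
    "\<And>x a b c d. x \<in> B \<Longrightarrow> plu (\<lambda>i j. sig \<omega> x i j k) a b c d = 0"
    "\<exists>x\<in>B. \<exists>i j. sig \<omega> x i j k \<noteq> 0"
proof -
  \<comment> \<open>Any point of the k-th chart would serve as base point.\<close>
  define e :: "complex ^ 'n" where "e = axis k 1"
  have e: "e \<noteq> 0" "e $ k \<noteq> 0" by (auto simp: e_def axis_eq_0_iff)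
  let ?p = "abs_proj e"
  have pk: "?p \<in> chart k" using e by (simp add: abs_proj_in_chart)
  obtain W X Y where W: "open W" "?p \<in> W" "W \<subseteq> chart k" and XY: "X \<in> T W" "Y \<in> T W"
      and ind: "germs_independent ?p W [X, Y]"
    using local_generators[OF open_UNIV UNIV_I pk] by metis
  note TPW = subsheaf_subset[OF sub W(1)]
  obtain i j where nz: "\<not> (\<forall>\<^sub>F q in nhds ?p. wedge k i j X Y q = 0)"
    using wedge_nonzero_germ[OF W TPW[OF XY(1)] TPW[OF XY(2)] ind] .
  then obtain q where q: "q \<in> W" "wedge k i j X Y q \<noteq> 0"
    using W(1,2) by (auto simp: eventually_nhds)
  obtain y where y: "y \<noteq> 0" "q = abs_proj y" by (rule proj_cases)
  define B where "B = cone W \<inter> (\<lambda>x. theta k W X Y (abs_proj x)) -` (- {0})"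
  have "cholomorphic_on (\<lambda>x. theta k W X Y (abs_proj x)) (cone W)"
    using theta_hol[OF W(1,3) XY] by (simp add: hol_iff)
  then have "open B"
    unfolding B_def by (intro continuous_open_preimage cholomorphic_on_continuous open_cone W) auto
  have wy: "wedge k i j X Y (abs_proj y) = sig \<omega> y i j k / y $ k * theta k W X Y (abs_proj y)"
    by (rule wedge_sig[OF W(1,3) XY]) (use y q in simp)
  have yB: "y \<in> B" "sig \<omega> y i j k \<noteq> 0"
    using y q wy by (auto simp: B_def)
  have Bk: "x $ k \<noteq> 0" if "x \<in> B" for x
    using that W(3) abs_proj_in_chart[of x k] by (auto simp: B_def)
  have "plu (\<lambda>i j. sig \<omega> x i j k) a b c d = 0" if x: "x \<in> B" for x a b c d
  proof -
    let ?t = "theta k W X Y (abs_proj x)"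
    have t: "?t \<noteq> 0" "x \<in> cone W" using x by (auto simp: B_def)
    have s: "sig \<omega> x i j k = x $ k / ?t * wedge k i j X Y (abs_proj x)" for i j
      using wedge_sig[OF W(1,3) XY t(2), of i j] t(1) Bk[OF x] by simp
    have "plu (\<lambda>i j. wedge k i j X Y (abs_proj x)) a b c d = 0"
      by (simp add: plu_def wedge_def algebra_simps)
    moreover have "plu (\<lambda>i j. sig \<omega> x i j k) a b c d =
        (x $ k / ?t) ^ 2 * plu (\<lambda>i j. wedge k i j X Y (abs_proj x)) a b c d"
      unfolding s by (simp add: plu_def power2_eq_square algebra_simps)
    ultimately show ?thesis by simp
  qed
  then show ?thesis
    using that[OF \<open>open B\<close> _ Bk] yB by blast
qed

lemma omega_nonzero: "\<exists>i j. \<omega> i j \<noteq> 0"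
proof -
  obtain k :: 'n where True by simp
  obtain B where "\<exists>x\<in>B. \<exists>i j. sig \<omega> x i j k \<noteq> 0"
    using generic_decomposable[of k] by metis
  then obtain x i j where "sig \<omega> x i j k \<noteq> 0" by blast
  then have "\<omega> j k \<noteq> 0 \<or> \<omega> i k \<noteq> 0 \<or> \<omega> i j \<noteq> 0"
    by (auto simp: sig_def)
  then show ?thesis by blast
qed

text \<open>By \<open>plu_sig\<close> a linear form vanishes on an open set. In the direction of the
  k-th axis only its coefficient \<open>plu \<omega> a b c d\<close> is felt, because k differs from
  a, b, c, d. A nonzero component must therefore exhaust the index set, which is how dimension three
  arises.\<close>

lemma plu_zero:
  assumes "k \<notin> {a, b, c, d}"
  shows "plu \<omega> a b c d = 0"
proof -
  obtain B where B: "open B" "B \<noteq> {}" "\<And>x. x \<in> B \<Longrightarrow> x $ k \<noteq> 0"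
      "\<And>x a b c d. x \<in> B \<Longrightarrow> plu (\<lambda>i j. sig \<omega> x i j k) a b c d = 0"
    using generic_decomposable[of k] by metis
  define Q where "Q x = x $ k * plu \<omega> a b c d - x $ d * plu \<omega> a b c k
    + x $ c * plu \<omega> a b d k - x $ b * plu \<omega> a c d k + x $ a * plu \<omega> b c d k" for x
  have Q: "Q x = 0" if "x \<in> B" for x
    using B(3)[OF that] B(4)[OF that, of a b c d] by (simp add: plu_sig Q_def)
  obtain x where x: "x \<in> B" using B(2) by blast
  obtain r where r: "r > 0" "ball x r \<subseteq> B" using B(1) x openE by blast
  define t where "t = complex_of_real (r / 2)"
  have "norm (axis k (1::complex) :: complex ^ 'n) = 1"
    by (rule norm_Basis) (simp add: axis_in_Basis_iff Basis_complex_def)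
  then have "norm (t *s axis k (1::complex) :: complex ^ 'n) = r / 2"
    using r by (simp add: norm_smult t_def)
  then have "x + t *s axis k 1 \<in> B"
    using r by (intro subsetD[OF r(2)]) (simp add: dist_norm)
  from Q[OF this] Q[OF x] have "t * plu \<omega> a b c d = 0"
    using assms by (auto simp: Q_def axis_def algebra_simps)
  then show ?thesis using r by (simp add: t_def)
qed

end

section \<open>Linear projections\<close>

lemma nhds_in_open: "open V \<Longrightarrow> p \<in> V \<Longrightarrow> \<forall>\<^sub>F q in nhds p. q \<in> V"
  by (auto simp: eventually_nhds)

lemma TP_eq_on_open:
  assumes X: "X \<in> TP U" and V: "open V" "V \<subseteq> U" "f \<in> hol V" "g \<in> hol V" and eq: "\<And>q. q \<in> V \<Longrightarrow> f q = g q"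
    and p: "p \<in> V"
  shows "X p f = X p g"
proof (rule tangent_vector_cong[of p "X p" f g])
  show "tangent_vector p (X p)" using TP_tangent_vector[OF X] V p by blast
  show "\<forall>\<^sub>F q in nhds p. f q = g q"
    using nhds_in_open[OF V(1) p] by eventually_elim (rule eq)
  show "hol_at p f" by (rule hol_atI[OF V(3,1) p])
  show "hol_at p g" by (rule hol_atI[OF V(4,1) p])
qed

lemma
  assumes X: "X \<in> TP U" and p: "p \<in> U" and f: "hol_at p f" and g: "hol_at p g"
  shows TP_add: "X p (\<lambda>q. f q + g q) = X p f + X p g"
    and TP_cmult: "X p (\<lambda>q. c * f q) = c * X p f"
    and TP_mult: "X p (\<lambda>q. f q * g q) = X p f * g p + f p * X p g"
  using tangent_vector_add[OF TP_tangent_vector[OF X p] f g]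
    tangent_vector_cmult[OF TP_tangent_vector[OF X p] f, of c]
    tangent_vector_mult[OF TP_tangent_vector[OF X p] f g] by simp_all

text \<open>The mixed terms in the product rule are symmetric under exchanging \<open>X\<close> and
  \<open>Y\<close>, so they cancel in the bracket and leave a derivation.\<close>

lemma TP_second_order:
  assumes X: "X \<in> TP U" and Y: "Y \<in> TP U" and V: "open V" "V \<subseteq> U" and f: "f \<in> hol V" and g: "g \<in> hol V"
    and p: "p \<in> V"
  shows "X p (\<lambda>q. Y q (\<lambda>r. f r + g r)) = X p (\<lambda>q. Y q f) + X p (\<lambda>q. Y q g)"
    and "X p (\<lambda>q. Y q (\<lambda>r. c * f r)) = c * X p (\<lambda>q. Y q f)"
    and "X p (\<lambda>q. Y q (\<lambda>r. f r * g r)) =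
      X p (\<lambda>q. Y q f) * g p + Y p f * X p g + (X p f * Y p g + f p * X p (\<lambda>q. Y q g))"
proof -
  have pU: "p \<in> U" using p V by blast
  have at: "hol_at q h" if "q \<in> V" "h \<in> hol V" for q h
    using hol_atI[OF that(2) V(1) that(1)] .
  have Yh: "(\<lambda>q. Y q h) \<in> hol V" if "h \<in> hol V" for h
    by (rule TP_hol[OF Y V that])
  have qU: "q \<in> U" if "q \<in> V" for q using that V by blast
  have "X p (\<lambda>q. Y q (\<lambda>r. f r + g r)) = X p (\<lambda>q. Y q f + Y q g)"
    by (rule TP_eq_on_open[OF X V _ _ _ p]) (auto intro!: Yh hol_add f g TP_add[OF Y qU] at)
  then show "X p (\<lambda>q. Y q (\<lambda>r. f r + g r)) = X p (\<lambda>q. Y q f) + X p (\<lambda>q. Y q g)"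
    using TP_add[OF X pU at[OF p Yh[OF f]] at[OF p Yh[OF g]]] by simp
  have "X p (\<lambda>q. Y q (\<lambda>r. c * f r)) = X p (\<lambda>q. c * Y q f)"
    by (rule TP_eq_on_open[OF X V _ _ _ p]) (auto intro!: Yh hol_mult hol_const f TP_cmult[OF Y qU] at)
  then show "X p (\<lambda>q. Y q (\<lambda>r. c * f r)) = c * X p (\<lambda>q. Y q f)"
    using TP_cmult[OF X pU at[OF p Yh[OF f]]] at[OF p Yh[OF f]] by simp
  have "X p (\<lambda>q. Y q (\<lambda>r. f r * g r)) = X p (\<lambda>q. Y q f * g q + f q * Y q g)"
    by (rule TP_eq_on_open[OF X V _ _ _ p]) (auto intro!: Yh hol_add hol_mult f g TP_mult[OF Y qU] at)
  also have "\<dots> = X p (\<lambda>q. Y q f * g q) + X p (\<lambda>q. f q * Y q g)"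
    by (intro TP_add[OF X pU] at p hol_mult Yh f g)
  also have "X p (\<lambda>q. Y q f * g q) = X p (\<lambda>q. Y q f) * g p + Y p f * X p g"
    by (intro TP_mult[OF X pU] at p Yh f g)
  also have "X p (\<lambda>q. f q * Y q g) = X p f * Y p g + f p * X p (\<lambda>q. Y q g)"
    by (intro TP_mult[OF X pU] at p Yh f g)
  finally show "X p (\<lambda>q. Y q (\<lambda>r. f r * g r)) =
      X p (\<lambda>q. Y q f) * g p + Y p f * X p g + (X p f * Y p g + f p * X p (\<lambda>q. Y q g))" .
qed

lemma TP_second_order_cong:
  assumes X: "X \<in> TP U" and Y: "Y \<in> TP U" and V: "open V" "V \<subseteq> U" and f: "f \<in> hol V" and g: "g \<in> hol V"
    and eq: "\<And>q. q \<in> V \<Longrightarrow> f q = g q" and p: "p \<in> V"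
  shows "X p (\<lambda>q. Y q f) = X p (\<lambda>q. Y q g)"
  by (rule TP_eq_on_open[OF X V TP_hol[OF Y V f] TP_hol[OF Y V g] _ p])
    (rule TP_eq_on_open[OF Y V f g eq])

lemma lie_TP:
  assumes X: "X \<in> TP U" and Y: "Y \<in> TP U" and U: "open U"
  shows "lie X Y \<in> TP U"
  unfolding TP_def
proof (intro CollectI conjI ballI allI impI)
  fix p assume p: "p \<in> U"
  show "tangent_vector p (lie X Y p)"
    unfolding tangent_vector_def
  proof (intro conjI allI impI)
    fix f g :: "'a proj \<Rightarrow> complex" and c
    show "lie X Y p f = 0" if "\<not> hol_at p f"
      using that by (simp add: lie_def)
    assume fg: "hol_at p f \<and> hol_at p g"
    then obtain V0 where V0: "open V0" "p \<in> V0" "f \<in> hol V0" "g \<in> hol V0"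
      using hol_at_binary by blast
    define V where "V = U \<inter> V0"
    have V: "open V" "V \<subseteq> U" "p \<in> V" and f: "f \<in> hol V" and g: "g \<in> hol V"
      using V0 U p by (auto simp: V_def open_Int intro: hol_subset)
    note so = TP_second_order[OF X Y V(1,2) f g V(3)] TP_second_order[OF Y X V(1,2) f g V(3)]
    show "lie X Y p (\<lambda>q. f q + g q) = lie X Y p f + lie X Y p g"
      using fg by (simp add: lie_def so hol_at_add)
    show "lie X Y p (\<lambda>q. c * f q) = c * lie X Y p f"
      using fg by (simp add: lie_def so hol_at_mult hol_at_const algebra_simps)
    show "lie X Y p (\<lambda>q. f q * g q) = lie X Y p f * g p + f p * lie X Y p g"
      using fg by (simp add: lie_def so hol_at_mult algebra_simps)
    assume "\<forall>\<^sub>F q in nhds p. f q = g q"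
    then obtain V1 where V1: "open V1" "p \<in> V1" "\<And>q. q \<in> V1 \<Longrightarrow> f q = g q"
      by (auto simp: eventually_nhds)
    define W where "W = V \<inter> V1"
    have W: "open W" "W \<subseteq> U" "p \<in> W" "f \<in> hol W" "g \<in> hol W" "\<And>q. q \<in> W \<Longrightarrow> f q = g q"
      using V V1 f g by (auto simp: W_def open_Int intro: hol_subset)
    show "lie X Y p f = lie X Y p g"
      using fg TP_second_order_cong[OF X Y W(1,2,4,5,6,3)] TP_second_order_cong[OF Y X W(1,2,4,5,6,3)]
      by (simp add: lie_def)
  qed
next
  fix p assume "p \<notin> U"
  then show "lie X Y p = (\<lambda>f. 0)"
    using TP_outside[OF X] TP_outside[OF Y] by (simp add: lie_def fun_eq_iff)
next
  fix V and f :: "'a proj \<Rightarrow> complex"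
  assume V: "open V \<and> V \<subseteq> U \<and> f \<in> hol V"
  have "(\<lambda>p. X p (\<lambda>q. Y q f) - Y p (\<lambda>q. X q f)) \<in> hol V"
    using V by (intro hol_diff TP_hol[OF X] TP_hol[OF Y]) auto
  then show "(\<lambda>p. lie X Y p f) \<in> hol V"
    by (rule hol_cong) (use V in \<open>auto simp: lie_def hol_at_def\<close>)
qed

section \<open>Linear projections and their relative tangent sheaves\<close>

lemma matrix_smult: "A *v (c *s x) = c *s (A *v (x :: complex ^ 'n))"
  by (simp add: matrix_vector_mult_def vec_eq_iff sum_distrib_left mult_ac)

lemma proj_center_abs_proj:
  assumes "x \<noteq> 0"
  shows "abs_proj x \<in> proj_center A \<longleftrightarrow> A *v x = 0"
proof -
  obtain c where "c \<noteq> 0" "rep_proj (abs_proj x) = c *s x"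
    using rep_abs_proj[OF assms] .
  then show ?thesis by (simp add: proj_center_def matrix_smult)
qed

lemma lin_proj_abs_proj:
  assumes "A *v x \<noteq> 0"
  shows "lin_proj A (abs_proj x) = abs_proj (A *v x)"
proof -
  have "x \<noteq> 0" using assms by auto
  then obtain c where "c \<noteq> 0" "rep_proj (abs_proj x) = c *s x"
    by (rule rep_abs_proj)
  then show ?thesis using assms by (simp add: lin_proj_def matrix_smult)
qed

lemma continuous_matrix_vector: "continuous_on S (\<lambda>x. A *v (x :: complex ^ 'n))"
  unfolding matrix_vector_mult_def by (intro continuous_intros)

lemma lin_proj_preimage:
  fixes A :: "complex ^ 'n::finite ^ 'm::finite"
  assumes V: "open V" and g: "g \<in> hol V"
  defines "W \<equiv> {q. q \<notin> proj_center A \<and> lin_proj A q \<in> V}"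
  shows "open W" "(\<lambda>q. g (lin_proj A q)) \<in> hol W"
proof -
  have cW: "cone W = (\<lambda>x. A *v x) -` cone V"
  proof (rule set_eqI)
    fix x
    show "x \<in> cone W \<longleftrightarrow> x \<in> (\<lambda>x. A *v x) -` cone V"
    proof (cases "A *v x = 0")
      case True
      then show ?thesis by (auto simp: W_def proj_center_abs_proj)
    next
      case False
      then have "x \<noteq> 0" by auto
      then show ?thesis using False by (simp add: W_def proj_center_abs_proj lin_proj_abs_proj)
    qed
  qed
  then have "open (cone W)"
    using open_vimage[OF open_cone[OF V] continuous_matrix_vector[of UNIV A]] by simp
  then show "open W" by (simp add: open_proj_def)
  have "cholomorphic_on (\<lambda>x. g (abs_proj (A *v x))) (cone W)"
  proof (rule cholomorphic_compose[where T="cone V" and f="\<lambda>y. g (abs_proj y)"])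
    show "cholomorphic_on (\<lambda>x. (A *v x) $ i) (cone W)" for i
      unfolding cholomorphic_on_iff using linfield_component by blast
    show "cholomorphic_on (\<lambda>y. g (abs_proj y)) (cone V)" using g by (simp add: hol_iff)
    show "(\<lambda>x. A *v x) ` cone W \<subseteq> cone V" using cW by blast
  qed
  moreover have "cholomorphic_on (\<lambda>x. g (abs_proj (A *v x))) (cone W) \<longleftrightarrow>
      cholomorphic_on (\<lambda>x. g (lin_proj A (abs_proj x))) (cone W)"
  proof (rule cholomorphic_on_cong[OF \<open>open (cone W)\<close>])
    fix x assume "x \<in> cone W"
    then have "A *v x \<noteq> 0" by (auto simp: W_def proj_center_abs_proj)
    then show "g (abs_proj (A *v x)) = g (lin_proj A (abs_proj x))"
      by (simp add: lin_proj_abs_proj)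
  qed
  ultimately show "(\<lambda>q. g (lin_proj A q)) \<in> hol W"
    by (simp add: hol_iff)
qed

lemma tv_lin_proj:
  fixes A :: "complex ^ 'n::finite ^ 'm::finite"
  assumes x: "A *v x \<noteq> 0" and V: "open V" "lin_proj A (abs_proj x) \<in> V" "g \<in> hol V"
  shows "tv x \<zeta> (\<lambda>q. g (lin_proj A q)) = tv (A *v x) (A *v \<zeta>) g"
proof -
  have x0: "x \<noteq> 0" using x by auto
  have p: "abs_proj (A *v x) \<in> V" using V x by (simp add: lin_proj_abs_proj)
  have g: "hol_at (abs_proj (A *v x)) g" by (rule hol_atI[OF V(3,1) p])
  let ?D = "cderiv (\<lambda>y. g (abs_proj y)) (A *v x)"
  have "has_cderiv (\<lambda>y. g (abs_proj (A *v y))) (\<lambda>v. ?D (\<chi> i. (A *v v) $ i)) x"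
    by (rule has_cderiv_vec[where f="\<lambda>y. g (abs_proj y)" and h="\<lambda>y. A *v y"])
      (rule linfield_component, rule hol_at_has_cderiv[OF g x])
  then have "has_cderiv (\<lambda>y. g (lin_proj A (abs_proj y))) (\<lambda>v. ?D (\<chi> i. (A *v v) $ i)) x"
  proof (rule has_cderiv_cong[where S="(\<lambda>y. A *v y) -` (- {0})"])
    show "open ((\<lambda>y. A *v y) -` (- {0}))"
      by (intro open_vimage continuous_matrix_vector) auto
  qed (use x in \<open>auto simp: lin_proj_abs_proj\<close>)
  moreover have "hol_at (abs_proj x) (\<lambda>q. g (lin_proj A q))"
    by (rule hol_atI[OF lin_proj_preimage(2,1)[OF V(1,3)]]) (use x x0 V in \<open>simp add: proj_center_abs_proj\<close>)
  ultimately have "tv x \<zeta> (\<lambda>q. g (lin_proj A q)) = ?D (\<chi> i. (A *v \<zeta>) $ i)"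
    by (rule tv_has_cderiv)
  then show ?thesis using g by (simp add: tv_def)
qed

text \<open>The differential of the projection sends the class of \<zeta> at [x] to the class of
  \<open>A *v \<zeta>\<close> at \<open>[A *v x]\<close>, which vanishes iff
  \<open>A *v \<zeta>\<close> is a multiple of \<open>A *v x\<close>. On the centre both sides hold
  trivially.\<close>

lemma relative_tangent_pointwise:
  fixes A :: "complex ^ 'n::finite ^ 'm::finite"
  assumes x: "x \<noteq> 0"
  shows "(abs_proj x \<notin> proj_center A \<longrightarrow> (\<forall>V g. open V \<and> lin_proj A (abs_proj x) \<in> V \<and> g \<in> hol V \<longrightarrow>
      tv x \<zeta> (\<lambda>q. g (lin_proj A q)) = 0)) \<longleftrightarrow>
    (\<forall>\<mu> \<nu>. (A *v \<zeta>) $ \<mu> * (A *v x) $ \<nu> = (A *v \<zeta>) $ \<nu> * (A *v x) $ \<mu>)" (is "?l \<longleftrightarrow> ?r")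
proof (cases "A *v x = 0")
  case True
  then show ?thesis using x by (simp add: proj_center_abs_proj)
next
  case False
  have c: "abs_proj x \<notin> proj_center A" using False x by (simp add: proj_center_abs_proj)
  show ?thesis
  proof
    assume l: ?l
    have *: "(A *v \<zeta>) $ \<mu> * (A *v x) $ \<nu> = (A *v \<zeta>) $ \<nu> * (A *v x) $ \<mu>" if nz: "(A *v x) $ \<nu> \<noteq> 0" for \<mu> \<nu>
    proof -
      have V: "open (chart \<nu>)" "lin_proj A (abs_proj x) \<in> chart \<nu>" "coord \<nu> \<mu> \<in> hol (chart \<nu>)"
        using nz False by (auto simp: lin_proj_abs_proj abs_proj_in_chart open_chart hol_coord)
      then have "tv x \<zeta> (\<lambda>q. coord \<nu> \<mu> (lin_proj A q)) = 0"
        using l c by blast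
      then have "tv (A *v x) (A *v \<zeta>) (coord \<nu> \<mu>) = 0"
        by (simp add: tv_lin_proj[OF False V])
      then show ?thesis
        using nz by (simp add: tv_coord mult.commute)
    qed
    show ?r
    proof (intro allI)
      fix \<mu> \<nu>
      show "(A *v \<zeta>) $ \<mu> * (A *v x) $ \<nu> = (A *v \<zeta>) $ \<nu> * (A *v x) $ \<mu>"
        using *[of \<nu> \<mu>] *[of \<mu> \<nu>, symmetric]
        by (cases "(A *v x) $ \<nu> = 0"; cases "(A *v x) $ \<mu> = 0") (blast | simp)+
    qed
  next
    assume r: ?r
    obtain \<nu> where \<nu>: "(A *v x) $ \<nu> \<noteq> 0" using False by (auto simp: vec_eq_iff)
    have "A *v \<zeta> = ((A *v \<zeta>) $ \<nu> / (A *v x) $ \<nu>) *s (A *v x)"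
    proof (subst vec_eq_iff, intro allI)
      fix \<mu>
      show "(A *v \<zeta>) $ \<mu> = (((A *v \<zeta>) $ \<nu> / (A *v x) $ \<nu>) *s (A *v x)) $ \<mu>"
        using r[THEN spec[of _ \<mu>], THEN spec[of _ \<nu>]] \<nu> by (simp add: field_simps)
    qed
    then obtain c where c: "A *v \<zeta> = c *s (A *v x)" ..
    show ?l
    proof (intro impI allI)
      fix V and g :: "'m proj \<Rightarrow> complex"
      assume V: "open V \<and> lin_proj A (abs_proj x) \<in> V \<and> g \<in> hol V"
      then have "tv x \<zeta> (\<lambda>q. g (lin_proj A q)) = tv (A *v x) (A *v \<zeta>) g"
        by (intro tv_lin_proj[OF False]) auto
      also have "\<dots> = 0"
        unfolding c by (simp add: tv_smult[OF False] tv_self[OF False])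
      finally show "tv x \<zeta> (\<lambda>q. g (lin_proj A q)) = 0" .
    qed
  qed
qed

text \<open>For \<omega> = w (a \<and> b), multiples of \<open>a\<close> and \<open>b\<close> drop
  out of \<zeta> \<and> x \<and> \<omega>; the right-hand side is y \<and> z \<and>
  \<omega>.\<close>

lemma ext4_bivector:
  assumes "\<And>k l. \<omega> k l = w * (a k * b l - a l * b k)"
    and "\<And>n. \<zeta> $ n = y n + s * a n + t * b n" and "\<And>n. x $ n = z n + u * a n + v * b n"
  shows "ext4 \<omega> x \<zeta> p q r m = (y p * z q - y q * z p) * \<omega> r m - (y p * z r - y r * z p) * \<omega> q m
    + (y p * z m - y m * z p) * \<omega> q r + (y q * z r - y r * z q) * \<omega> p m - (y q * z m - y m * z q) * \<omega> p r
    + (y r * z m - y m * z r) * \<omega> p q"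
  unfolding ext4_def sig_def assms by (simp add: algebra_simps)

context degree_zero_bivector
begin

text \<open>Subtracting multiples of \<open>a\<close> and \<open>b\<close> clears the coordinates i
  and j. The remaining coordinates form a projection whose kernel is spanned by \<open>a\<close> and
  \<open>b\<close>, and \<zeta> \<and> x \<and> a \<and> b = 0 iff the images of \<zeta> and
  \<open>x\<close> are dependent.\<close>

lemma projection_matrix:
  assumes plu: "\<And>a b c d. plu \<omega> a b c d = 0" and card': "CARD('m::finite) + 2 = CARD('n)"
  obtains A :: "complex ^ 'n ^ 'm" where "surj (\<lambda>x. A *v x)"
    "\<And>x \<zeta>. (\<forall>a b c d. ext4 \<omega> x \<zeta> a b c d = 0) \<longleftrightarrow>
      (\<forall>\<mu> \<nu>. (A *v \<zeta>) $ \<mu> * (A *v x) $ \<nu> = (A *v \<zeta>) $ \<nu> * (A *v x) $ \<mu>)"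
proof -
  obtain i j where ij: "\<omega> i j \<noteq> 0" using omega_nonzero by blast
  have diag: "\<omega> m m = 0" for m using anti[of m m] by simp
  have neq: "i \<noteq> j" using ij diag by auto
  \<comment> \<open>The column and the row of \<omega> through the pivot
    \<open>\<omega> i j\<close>; the Pluecker relations say that they determine the whole
    matrix.\<close>
  define a where "a m = \<omega> m j / \<omega> i j" for m
  define b where "b m = \<omega> i m / \<omega> i j" for m
  have ab: "a i = 1" "a j = 0" "b i = 0" "b j = 1"
    using ij by (auto simp: a_def b_def diag)
  have om: "\<omega> k l = \<omega> i j * (a k * b l - a l * b k)" for k l
  proof -
    have "\<omega> i j * \<omega> k l = \<omega> k j * \<omega> i l - \<omega> l j * \<omega> i k"
      using plu[of i j k l] anti[of k j] anti[of l j] by (simp add: plu_def algebra_simps)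
    then have "\<omega> k l = (\<omega> k j * \<omega> i l - \<omega> l j * \<omega> i k) / \<omega> i j"
      using ij by (simp add: nonzero_eq_divide_eq mult.commute)
    also have "\<dots> = \<omega> i j * (a k * b l - a l * b k)"
      using ij by (simp add: a_def b_def diff_divide_distrib right_diff_distrib)
    finally show ?thesis .
  qed
  define pr where "pr x n = x $ n - x $ i * a n - x $ j * b n" for x :: "complex ^ 'n" and n
  have pr0: "pr x i = 0" "pr x j = 0" for x
    by (simp_all add: pr_def ab)
  have "card (UNIV :: 'm set) = card (UNIV - {i, j})"
    using card' neq by (subst card_Diff_subset) auto
  then obtain \<pi> where \<pi>: "bij_betw \<pi> (UNIV :: 'm set) (UNIV - {i, j})"
    using finite_same_card_bij[of "UNIV :: 'm set" "UNIV - {i, j}"] by auto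
  define A :: "complex ^ 'n ^ 'm" where
    "A = (\<chi> \<mu> n. (if n = \<pi> \<mu> then 1 else 0) - (if n = i then a (\<pi> \<mu>) else 0) - (if n = j then b (\<pi> \<mu>) else 0))"
  have A: "(A *v x) $ \<mu> = pr x (\<pi> \<mu>)" for x \<mu>
    unfolding A_def matrix_vector_mult_def pr_def
    by (simp add: left_diff_distrib sum_subtractf if_distrib[of "\<lambda>c. c * _"] sum.delta cong: if_cong)
  have E: "ext4 \<omega> x \<zeta> p q r m = (pr \<zeta> p * pr x q - pr \<zeta> q * pr x p) * \<omega> r m - (pr \<zeta> p * pr x r - pr \<zeta> r * pr x p) * \<omega> q m
    + (pr \<zeta> p * pr x m - pr \<zeta> m * pr x p) * \<omega> q r + (pr \<zeta> q * pr x r - pr \<zeta> r * pr x q) * \<omega> p m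
    - (pr \<zeta> q * pr x m - pr \<zeta> m * pr x q) * \<omega> p r + (pr \<zeta> r * pr x m - pr \<zeta> m * pr x r) * \<omega> p q" for x \<zeta> p q r m
    by (rule ext4_bivector[where w="\<omega> i j" and a=a and b=b and s="\<zeta> $ i" and t="\<zeta> $ j" and u="x $ i" and v="x $ j"])
      (rule om, simp_all add: pr_def)
  show ?thesis
  proof (rule that[of A])
    show "surj (\<lambda>x. A *v x)"
    proof (rule surjI)
      fix y :: "complex ^ 'm"
      let ?x = "\<chi> n. if n = i \<or> n = j then 0 else y $ inv_into UNIV \<pi> n"
      show "A *v ?x = y"
      proof (subst vec_eq_iff, intro allI)
        fix \<mu>
        have "\<pi> \<mu> \<in> UNIV - {i, j}" using \<pi> by (rule bij_betw_apply) simp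
        moreover have "inv_into UNIV \<pi> (\<pi> \<mu>) = \<mu>"
          using \<pi> by (intro inv_into_f_f) (auto simp: bij_betw_def)
        ultimately show "(A *v ?x) $ \<mu> = y $ \<mu>"
          by (simp add: A pr_def)
      qed
    qed
    fix x \<zeta>
    show "(\<forall>a b c d. ext4 \<omega> x \<zeta> a b c d = 0) \<longleftrightarrow>
      (\<forall>\<mu> \<nu>. (A *v \<zeta>) $ \<mu> * (A *v x) $ \<nu> = (A *v \<zeta>) $ \<nu> * (A *v x) $ \<mu>)" (is "?l \<longleftrightarrow> ?r")
    proof
      assume l: ?l
      show ?r
      proof (intro allI)
        fix \<mu> \<nu>
        \<comment> \<open>As \<open>pr\<close> vanishes at i and j, only the term with the factor
          \<open>\<omega> i j\<close> survives in \<open>E\<close>.\<close>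
        have "ext4 \<omega> x \<zeta> (\<pi> \<mu>) (\<pi> \<nu>) i j = 0" using l by blast
        then show "(A *v \<zeta>) $ \<mu> * (A *v x) $ \<nu> = (A *v \<zeta>) $ \<nu> * (A *v x) $ \<mu>"
          using ij by (simp add: E pr0 A)
      qed
    next
      assume r: ?r
      have "pr \<zeta> k * pr x l - pr \<zeta> l * pr x k = 0" for k l
      proof (cases "k \<in> {i, j} \<or> l \<in> {i, j}")
        case True
        then show ?thesis by (auto simp: pr0)
      next
        case False
        then have "k \<in> \<pi> ` UNIV" "l \<in> \<pi> ` UNIV" using \<pi> by (auto simp: bij_betw_def)
        then obtain \<mu> \<nu> where "k = \<pi> \<mu>" "l = \<pi> \<nu>" by blast
        then show ?thesis using r[THEN spec[of _ \<mu>], THEN spec[of _ \<nu>]] by (simp add: A)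
      qed
      then show ?l by (simp add: E)
    qed
  qed
qed

lemma tangent_to_projection_case:
  assumes plu: "\<And>a b c d. plu \<omega> a b c d = 0" and card': "CARD('m::finite) + 2 = CARD('n)"
  obtains A :: "complex ^ 'n ^ 'm" where "tangent_to_projection T A"
proof -
  obtain A :: "complex ^ 'n ^ 'm" where surj: "surj (\<lambda>x. A *v x)" and
    A: "\<And>x \<zeta>. (\<forall>a b c d. ext4 \<omega> x \<zeta> a b c d = 0) \<longleftrightarrow>
      (\<forall>\<mu> \<nu>. (A *v \<zeta>) $ \<mu> * (A *v x) $ \<nu> = (A *v \<zeta>) $ \<nu> * (A *v x) $ \<mu>)"
    by (rule projection_matrix[OF plu card'], rule that)
  have "Z \<in> T U \<longleftrightarrow> Z \<in> relative_tangent A U" if U: "open U" for U Z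
  proof (cases "Z \<in> TP U")
    case Z: True
    have pw: "(\<forall>a b c d. ext4 \<omega> x \<zeta> a b c d = 0) \<longleftrightarrow>
        (abs_proj x \<notin> proj_center A \<longrightarrow> (\<forall>V g. open V \<and> lin_proj A (abs_proj x) \<in> V \<and> g \<in> hol V \<longrightarrow>
          Z (abs_proj x) (\<lambda>q. g (lin_proj A q)) = 0))" if "x \<noteq> 0" "Z (abs_proj x) = tv x \<zeta>" for x \<zeta>
      unfolding A that(2) by (rule relative_tangent_pointwise[OF that(1), symmetric])
    have "Z \<in> T U \<longleftrightarrow> (\<forall>x\<in>cone U. \<forall>\<zeta>. Z (abs_proj x) = tv x \<zeta> \<longrightarrow> (\<forall>a b c d. ext4 \<omega> x \<zeta> a b c d = 0))"
      using Z in_T_iff[OF U, of Z] by blast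
    also have "\<dots> \<longleftrightarrow> (\<forall>p\<in>U - proj_center A. \<forall>V g. open V \<and> lin_proj A p \<in> V \<and> g \<in> hol V \<longrightarrow>
        Z p (\<lambda>q. g (lin_proj A q)) = 0)" (is "?l \<longleftrightarrow> ?r")
    proof
      assume l: ?l
      show ?r
      proof
        fix p assume p: "p \<in> U - proj_center A"
        obtain x where x: "x \<noteq> 0" "p = abs_proj x" by (rule proj_cases)
        moreover obtain \<zeta> where \<zeta>: "Z (abs_proj x) = tv x \<zeta>" using TP_tv[OF Z] x p by auto
        moreover have "x \<in> cone U" using x p by simp
        ultimately have "\<forall>a b c d. ext4 \<omega> x \<zeta> a b c d = 0" using l by blast
        then show "\<forall>V g. open V \<and> lin_proj A p \<in> V \<and> g \<in> hol V \<longrightarrow> Z p (\<lambda>q. g (lin_proj A q)) = 0"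
          using pw[OF x(1) \<zeta>] p x by simp
      qed
    next
      assume r: ?r
      show ?l
      proof (intro ballI allI impI)
        fix x \<zeta> a b c d assume x: "x \<in> cone U" "Z (abs_proj x) = tv x \<zeta>"
        then have x0: "x \<noteq> 0" by simp
        have "abs_proj x \<notin> proj_center A \<longrightarrow> (\<forall>V g. open V \<and> lin_proj A (abs_proj x) \<in> V \<and> g \<in> hol V \<longrightarrow>
          Z (abs_proj x) (\<lambda>q. g (lin_proj A q)) = 0)"
        proof
          assume "abs_proj x \<notin> proj_center A"
          then have "abs_proj x \<in> U - proj_center A" using x(1) by simp
          then show "\<forall>V g. open V \<and> lin_proj A (abs_proj x) \<in> V \<and> g \<in> hol V \<longrightarrow>
              Z (abs_proj x) (\<lambda>q. g (lin_proj A q)) = 0"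
            by (rule r[THEN bspec])
        qed
        from pw[OF x0 x(2), THEN iffD2, OF this] show "ext4 \<omega> x \<zeta> a b c d = 0"
          by simp
      qed
    qed
    also have "\<dots> \<longleftrightarrow> Z \<in> relative_tangent A U"
      using Z by (simp add: relative_tangent_def)
    finally show ?thesis .
  next
    case False
    then show ?thesis
      using subsheaf_subset[OF sub U, of Z] by (auto simp: relative_tangent_def)
  qed
  then have "tangent_to_projection T A"
    unfolding tangent_to_projection_def using surj by blast
  then show ?thesis by (rule that)
qed

end

text \<open>If \<open>X\<close> and \<open>Y\<close> both kill a pulled back function on an open
  set, each iterated derivative in the bracket is the derivative of 0.\<close>

lemma tangent_to_projection_integrable:
  fixes A :: "complex ^ 'n::finite ^ 'm::finite"
  assumes "tangent_to_projection T A"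
  shows "integrable_dist T"
  unfolding integrable_dist_def
proof (intro allI impI ballI)
  fix U X Y assume U: "open U" and XY: "X \<in> T U" "Y \<in> T U"
  have TU: "T U = relative_tangent A U"
    using assms U by (simp add: tangent_to_projection_def)
  have X: "X \<in> TP U" and Y: "Y \<in> TP U"
    using XY by (simp_all add: TU relative_tangent_def)
  have kill: "Z p (\<lambda>q. g (lin_proj A q)) = 0"
    if "Z \<in> T U" "p \<in> U - proj_center A" "open V" "lin_proj A p \<in> V" "g \<in> hol V" for Z p V g
    using that unfolding TU relative_tangent_def by blast
  show "lie X Y \<in> T U"
    unfolding TU relative_tangent_def
  proof (intro CollectI conjI ballI allI impI)
    show "lie X Y \<in> TP U" by (rule lie_TP[OF X Y U])
    fix p V g
    assume p: "p \<in> U - proj_center A" and V: "open V \<and> lin_proj A p \<in> V \<and> g \<in> hol V"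
    define G where "G q = g (lin_proj A q)" for q
    define W where "W = U \<inter> {q. q \<notin> proj_center A \<and> lin_proj A q \<in> V}"
    have W: "open W" "p \<in> W" "W \<subseteq> U" and G: "G \<in> hol W"
      using lin_proj_preimage[of V g A] V U p by (auto simp: W_def G_def[abs_def] intro: hol_subset)
    have z: "Z q G = 0" if "Z \<in> T U" "q \<in> W" for Z q
      unfolding G_def[abs_def] using that V by (intro kill[where V=V]) (auto simp: W_def)
    have "X p (\<lambda>q. Y q G) = X p (\<lambda>q. 0)"
      by (rule TP_eq_on_open[OF X W(1,3) TP_hol[OF Y W(1,3) G] hol_const z[OF XY(2)] W(2)])
    moreover have "Y p (\<lambda>q. X q G) = Y p (\<lambda>q. 0)"
      by (rule TP_eq_on_open[OF Y W(1,3) TP_hol[OF X W(1,3) G] hol_const z[OF XY(1)] W(2)])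
    moreover have "tangent_vector p (X p)" "tangent_vector p (Y p)"
      using TP_tangent_vector X Y p by auto
    ultimately have "lie X Y p G = 0"
      by (simp add: lie_def tangent_vector_const)
    then show "lie X Y p (\<lambda>q. g (lin_proj A q)) = 0"
      by (simp add: G_def[abs_def])
  qed
qed

section \<open>Contact structures\<close>

lemma ext4_add: "ext4 \<omega> x (u + v) i j k l = ext4 \<omega> x u i j k l + ext4 \<omega> x v i j k l"
  by (simp add: ext4_def algebra_simps)

lemma ext4_diff: "ext4 \<omega> x (u - v) i j k l = ext4 \<omega> x u i j k l - ext4 \<omega> x v i j k l"
  by (simp add: ext4_def algebra_simps)

lemma ext4_smult: "ext4 \<omega> x (c *s u) i j k l = c * ext4 \<omega> x u i j k l"
  by (simp add: ext4_def algebra_simps)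

lemma ext4_swap: "ext4 \<omega> x u i j k l = - ext4 \<omega> u x i j k l"
  by (simp add: ext4_def sig_def algebra_simps)

lemma ext4_self: "ext4 \<omega> x x i j k l = 0"
  by (simp add: ext4_def sig_def algebra_simps)

lemma ext4_smult_left: "ext4 \<omega> (c *s x) u i j k l = c * ext4 \<omega> x u i j k l"
  by (simp add: ext4_def sig_def algebra_simps)

text \<open>\<open>ext4\<close> depends only on the tangent vector, and this only on the affine
  coordinates of one chart; brackets thus need to be computed on coordinates only.\<close>

lemma ext4_tv_cong:
  assumes k: "x $ k \<noteq> 0" and eq: "\<And>m. tv x \<zeta> (coord k m) = tv x \<zeta>' (coord k m)"
  shows "ext4 \<omega> x \<zeta> a b c d = ext4 \<omega> x \<zeta>' a b c d"
proof -
  have "ext4 \<omega> x (\<zeta> - \<zeta>') a b c d = 0"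
  proof (rule ext4_all_zero[OF k])
    show "ext4 \<omega> x (\<zeta> - \<zeta>') a b c k = 0" for a b c
      unfolding ext4_diff ext4_tv_coord[OF k] eq by simp
  qed
  then show ?thesis by (simp add: ext4_diff)
qed

lemma clinI:
  fixes D :: "complex ^ 'n \<Rightarrow> complex"
  assumes "\<And>x y. D (x + y) = D x + D y" "\<And>c x. D (c *s x) = c * D x"
  shows "clin D"
  unfolding clin_def
proof
  fix x
  have lin: "linear D"
    by (rule linearI) (simp_all add: assms scaleR_eq_smult scaleR_conv_of_real)
  have "D x = D (\<Sum>i\<in>UNIV. x $ i *s axis i 1)"
    by (simp add: basis_expansion)
  also have "\<dots> = (\<Sum>i\<in>UNIV. D (x $ i *s axis i 1))"
    by (rule linear_sum[OF lin])
  finally show "D x = (\<Sum>i\<in>UNIV. x $ i * D (axis i 1))"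
    by (simp add: assms)
qed

lemma linear_map_matrix:
  fixes f :: "complex ^ 'n \<Rightarrow> complex ^ 'n"
  assumes "\<And>a. clin (\<lambda>x. f x $ a)"
  obtains B :: "complex ^ 'n ^ 'n" where "\<And>x. B *v x = f x"
proof
  fix x
  show "(\<chi> a b. f (axis b 1) $ a) *v x = f x"
  proof (subst vec_eq_iff, intro allI)
    fix a
    have "f x $ a = (\<Sum>i\<in>UNIV. x $ i * f (axis i 1) $ a)"
      using assms[of a] unfolding clin_def by blast
    also have "\<dots> = ((\<chi> a b. f (axis b 1) $ a) *v x) $ a"
      unfolding matrix_vector_mult_def vec_lambda_beta by (rule sum.cong) (simp_all add: mult.commute)
    finally show "((\<chi> a b. f (axis b 1) $ a) *v x) $ a = f x $ a" ..
  qed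
qed

lemma TP_vdiff_vscale:
  assumes X: "X \<in> TP V" and Y: "Y \<in> TP V" and h: "h \<in> hol V"
  shows "vdiff X (vscale h Y) \<in> TP V"
  unfolding TP_def
proof (intro CollectI conjI ballI allI impI)
  fix p assume p: "p \<in> V"
  obtain x where x: "x \<noteq> 0" "p = abs_proj x" by (rule proj_cases)
  obtain \<xi> \<eta> where t: "X p = tv x \<xi>" "Y p = tv x \<eta>"
    using TP_tv[OF X] TP_tv[OF Y] p x by metis
  have "vdiff X (vscale h Y) p f = tv x (\<xi> + (- h p) *s \<eta>) f" for f
    unfolding tv_add[OF x(1)] tv_smult[OF x(1)] by (simp add: vdiff_def vscale_def t)
  then have "vdiff X (vscale h Y) p = tv x (\<xi> + (- h p) *s \<eta>)" by (rule ext)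
  then show "tangent_vector p (vdiff X (vscale h Y) p)"
    using tangent_vector_tv[OF x(1)] x(2) by simp
next
  fix p assume "p \<notin> V"
  then show "vdiff X (vscale h Y) p = (\<lambda>f. 0)"
    using TP_outside[OF X] TP_outside[OF Y] by (simp add: vdiff_def vscale_def)
next
  fix W f assume "open W \<and> W \<subseteq> V \<and> f \<in> hol W"
  then have W: "open W" "W \<subseteq> V" "f \<in> hol W" by auto
  show "(\<lambda>p. vdiff X (vscale h Y) p f) \<in> hol W"
    unfolding vdiff_def vscale_def
    by (intro hol_diff hol_mult TP_hol[OF X W] TP_hol[OF Y W] hol_subset[OF h W(2)])
qed

section \<open>Brackets of linear vector fields\<close>

lemma linfield_coord_has_cderiv:
  assumes x: "x $ k \<noteq> 0"
  shows "has_cderiv (\<lambda>y. linfield C (abs_proj y) (coord k a))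
    (\<lambda>v. (((C *v v) $ a * x $ k + (C *v x) $ a * v $ k - (v $ a * (C *v x) $ k + x $ a * (C *v v) $ k)) * (x $ k)\<^sup>2
      - ((C *v x) $ a * x $ k - x $ a * (C *v x) $ k) * (2 * x $ k * v $ k)) / ((x $ k)\<^sup>2)\<^sup>2) x"
proof -
  have "has_cderiv (\<lambda>y. ((C *v y) $ a * y $ k - y $ a * (C *v y) $ k) / (y $ k * y $ k))
    (\<lambda>v. ((((C *v x) $ a * v $ k + (C *v v) $ a * x $ k) - (x $ a * (C *v v) $ k + v $ a * (C *v x) $ k)) * (x $ k * x $ k)
      - ((C *v x) $ a * x $ k - x $ a * (C *v x) $ k) * (x $ k * v $ k + v $ k * x $ k)) / (x $ k * x $ k)\<^sup>2) x"
    using x by (intro has_cderiv_divide has_cderiv_diff has_cderiv_mult linfield_component has_cderiv_component) auto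
  then have "has_cderiv (\<lambda>y. linfield C (abs_proj y) (coord k a))
    (\<lambda>v. ((((C *v x) $ a * v $ k + (C *v v) $ a * x $ k) - (x $ a * (C *v v) $ k + v $ a * (C *v x) $ k)) * (x $ k * x $ k)
      - ((C *v x) $ a * x $ k - x $ a * (C *v x) $ k) * (x $ k * v $ k + v $ k * x $ k)) / (x $ k * x $ k)\<^sup>2) x"
  proof (rule has_cderiv_cong[where S="cone (chart k)"])
    show "open (cone (chart k :: 'a proj set))" by (intro open_cone open_chart)
    show "x \<in> cone (chart k)" using x by (simp add: cone_chart del: cone_iff)
    fix y assume "y \<in> cone (chart k)"
    then have y: "y $ k \<noteq> 0" "y \<noteq> 0" by (auto simp add: cone_chart simp del: cone_iff)
    show "((C *v y) $ a * y $ k - y $ a * (C *v y) $ k) / (y $ k * y $ k) =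
        linfield C (abs_proj y) (coord k a)"
      by (simp add: linfield_abs_proj[OF y(2)] tv_coord[OF y(1)] power2_eq_square)
  qed
  then show ?thesis
    by (simp add: power2_eq_square algebra_simps)
qed

text \<open>On the cone, the derivative of \<open>C *v x\<close> in the direction
  \<open>B *v x\<close> is \<open>C *v (B *v x)\<close>; the radial parts introduced by affine
  coordinates cancel.\<close>

lemma lie_linfield_coord:
  assumes x: "x $ k \<noteq> 0"
  shows "lie (linfield B) (linfield C) (abs_proj x) (coord k a) = tv x (C *v (B *v x) - B *v (C *v x)) (coord k a)"
proof -
  have x0: "x \<noteq> 0" using x by auto
  have p: "abs_proj x \<in> chart k" using x x0 by (simp add: abs_proj_in_chart)
  have "linfield E \<in> TP UNIV" for E :: "complex ^ 'a ^ 'a"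
    using vres_linfield_TP[of UNIV E] by (simp add: vres_def)
  then have hat: "hol_at (abs_proj x) (\<lambda>q. linfield E q (coord k a))" for E :: "complex ^ 'a ^ 'a"
    by (intro hol_atI[OF TP_hol[OF _ open_chart _ hol_coord] open_chart p]) auto
  have d: "linfield E (abs_proj x) (\<lambda>q. linfield F q (coord k a)) =
    (((F *v (E *v x)) $ a * x $ k + (F *v x) $ a * (E *v x) $ k - ((E *v x) $ a * (F *v x) $ k + x $ a * (F *v (E *v x)) $ k)) * (x $ k)\<^sup>2
      - ((F *v x) $ a * x $ k - x $ a * (F *v x) $ k) * (2 * x $ k * (E *v x) $ k)) / ((x $ k)\<^sup>2)\<^sup>2" for E F
    unfolding linfield_abs_proj[OF x0] by (rule tv_has_cderiv[OF linfield_coord_has_cderiv[OF x] hat])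
  have "lie (linfield B) (linfield C) (abs_proj x) (coord k a) =
     linfield B (abs_proj x) (\<lambda>q. linfield C q (coord k a)) - linfield C (abs_proj x) (\<lambda>q. linfield B q (coord k a))"
    using hol_at_coord[OF p] by (simp add: lie_def)
  also have "\<dots> = ((C *v (B *v x) - B *v (C *v x)) $ a * x $ k - x $ a * (C *v (B *v x) - B *v (C *v x)) $ k)
      * (x $ k)\<^sup>2 / ((x $ k)\<^sup>2)\<^sup>2"
    unfolding d diff_divide_distrib[symmetric]
    by (rule arg_cong[where f="\<lambda>z. z / _"]) (simp add: algebra_simps power2_eq_square)
  also have "\<dots> = tv x (C *v (B *v x) - B *v (C *v x)) (coord k a)"
    unfolding tv_coord[OF x] using x by (simp add: power2_eq_square)
  finally show ?thesis .
qed

section \<open>The contact form on projective three-space\<close>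

locale contact_case = degree_zero_bivector T \<Phi> \<omega> for T :: "('n::finite) subsheaf" and \<Phi> \<omega> +
  fixes i j k l :: 'n
  assumes plu_nz: "plu \<omega> i j k l \<noteq> 0"
begin

lemma UNIV_eq: "UNIV = {i, j, k, l}"
  using plu_zero plu_nz by blast

lemma distinct: "distinct [i, j, k, l]"
proof -
  have "card (set [i, j, k, l]) = length [i, j, k, l]"
    using card card_length[of "[i, j, k, l]"] by (simp add: UNIV_eq)
  then show ?thesis by (rule card_distinct)
qed

lemma card_eq_4: "CARD('n) = 4"
  using distinct by (simp add: UNIV_eq)

text \<open>With four coordinates, \<zeta> \<and> x \<and> \<omega> has a single component up to
  sign. It is an alternating bilinear form, which gives the contact form.\<close>

definition eta :: "complex ^ 'n \<Rightarrow> complex ^ 'n \<Rightarrow> complex" where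
  "eta x \<zeta> = ext4 \<omega> x \<zeta> i j k l"

lemma eta_add: "eta x (u + v) = eta x u + eta x v"
  and eta_diff: "eta x (u - v) = eta x u - eta x v"
  and eta_smult: "eta x (c *s u) = c * eta x u"
  and eta_smult_left: "eta (c *s x) u = c * eta x u"
  and eta_swap: "eta x u = - eta u x"
  and eta_self: "eta x x = 0"
  unfolding eta_def
  by (rule ext4_add ext4_diff ext4_smult ext4_smult_left ext4_swap ext4_self)+

lemma eta_diff_left: "eta (u - v) x = eta u x - eta v x"
  using eta_swap[of "u - v" x] eta_swap[of u x] eta_swap[of v x] by (simp add: eta_diff)

lemma eta_add_left: "eta (u + v) x = eta u x + eta v x"
  using eta_swap[of "u + v" x] eta_swap[of u x] eta_swap[of v x] by (simp add: eta_add)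

lemma ext4_zero_iff: "(\<forall>a b c d. ext4 \<omega> x \<zeta> a b c d = 0) \<longleftrightarrow> eta x \<zeta> = 0"
proof
  assume 0: "eta x \<zeta> = 0"
  define P where "P a b c d \<longleftrightarrow> ext4 \<omega> x \<zeta> a b c d = 0" for a b c d
  have s1: "sig \<omega> x b a c = - sig \<omega> x a b c" for a b c
    using anti[of b a] by (simp add: sig_def)
  have s2: "sig \<omega> x a c b = - sig \<omega> x a b c" for a b c
    using anti[of c b] by (simp add: sig_def)
  have e1: "ext4 \<omega> x \<zeta> b a c d = - ext4 \<omega> x \<zeta> a b c d" for a b c d
    using s1[of b a c] s1[of b a d] by (simp add: ext4_def)
  have e2: "ext4 \<omega> x \<zeta> a c b d = - ext4 \<omega> x \<zeta> a b c d" for a b c d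
    using s1[of c b d] s2[of a c b] by (simp add: ext4_def)
  have e3: "ext4 \<omega> x \<zeta> a b d c = - ext4 \<omega> x \<zeta> a b c d" for a b c d
    using s2[of b d c] s2[of a d c] by (simp add: ext4_def)
  \<comment> \<open>As ordered rewrite rules these sort the four indices, so that repeated ones
    become adjacent and fall under \<open>eq\<close>.\<close>
  have perm: "P b a c d = P a b c d" "P a c b d = P a b c d" "P a b d c = P a b c d" for a b c d
    using e1[of b a c d] e2[of a c b d] e3[of a b d c] by (simp_all add: P_def)
  have eq: "P a a c d" "P a b b d" "P a b c c" for a b c d
    using e1[of a a c d] e2[of a b b d] e3[of a b c c] by (simp_all add: P_def)
  have "P i j k l" using 0 by (simp add: P_def eta_def)
  have "P a b c d" for a b c d
  proof -
    have "a \<in> {i, j, k, l}" "b \<in> {i, j, k, l}" "c \<in> {i, j, k, l}" "d \<in> {i, j, k, l}"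
      using UNIV_eq by auto
    then show ?thesis
      using \<open>P i j k l\<close> by (elim insertE emptyE) (simp_all add: perm eq)
  qed
  then show "\<forall>a b c d. ext4 \<omega> x \<zeta> a b c d = 0" by (simp add: P_def)
qed (simp add: eta_def)

lemma in_T_iff_eta:
  assumes "open U"
  shows "Z \<in> T U \<longleftrightarrow> Z \<in> TP U \<and> (\<forall>x\<in>cone U. \<forall>\<zeta>. Z (abs_proj x) = tv x \<zeta> \<longrightarrow> eta x \<zeta> = 0)"
  unfolding in_T_iff[OF assms] ext4_zero_iff ..

lemma eta_tv_cong:
  assumes "x \<noteq> 0" "tv x \<zeta> = tv x \<zeta>'"
  shows "eta x \<zeta> = eta x \<zeta>'"
proof -
  obtain m where "x $ m \<noteq> 0" using assms(1) by (auto simp: vec_eq_iff)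
  then show ?thesis
    unfolding eta_def by (rule ext4_tv_cong) (simp add: assms(2))
qed

lemma in_T_if_eta:
  assumes "open U" "Z \<in> TP U" "\<And>x. x \<in> cone U \<Longrightarrow> \<exists>\<zeta>. Z (abs_proj x) = tv x \<zeta> \<and> eta x \<zeta> = 0"
  shows "Z \<in> T U"
  unfolding in_T_iff_eta[OF assms(1)]
proof (intro conjI assms(2) ballI allI impI)
  fix x \<zeta> assume x: "x \<in> cone U" "Z (abs_proj x) = tv x \<zeta>"
  then obtain \<zeta>' where "Z (abs_proj x) = tv x \<zeta>'" "eta x \<zeta>' = 0"
    using assms(3) by blast
  then show "eta x \<zeta> = 0"
    using x eta_tv_cong[of x \<zeta> \<zeta>'] by simp
qed

lemma axis_simps: "axis a (1::complex) $ b = (if a = b then 1 else 0)"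
  by (simp add: axis_def)

lemma eta_axis:
  "eta x (axis i 1) = sig \<omega> x j k l" "eta x (axis j 1) = - sig \<omega> x i k l"
  "eta x (axis k 1) = sig \<omega> x i j l" "eta x (axis l 1) = - sig \<omega> x i j k"
  using distinct by (auto simp: eta_def ext4_def axis_simps)

text \<open>Up to sign, the product of the matrices of \<omega> and \<open>eta\<close> is the
  Pfaffian \<open>plu \<omega> i j k l\<close> times the identity. The four identities in the proof
  recover the coordinates of \<open>x\<close> from its values on the axes.\<close>

lemma eta_nondegenerate:
  assumes "x \<noteq> 0"
  obtains m where "eta x (axis m 1) \<noteq> 0"
proof (rule ccontr)
  assume "\<not> thesis"
  then have 0: "eta x (axis m 1) = 0" for m using that by blast
  have s: "sig \<omega> x j k l = 0" "sig \<omega> x i k l = 0" "sig \<omega> x i j l = 0" "sig \<omega> x i j k = 0"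
    using 0[of i] 0[of j] 0[of k] 0[of l] by (simp_all add: eta_axis)
  have "plu \<omega> i j k l * x $ i = \<omega> i j * sig \<omega> x i k l - \<omega> i k * sig \<omega> x i j l + \<omega> i l * sig \<omega> x i j k"
    "plu \<omega> i j k l * x $ j = \<omega> i j * sig \<omega> x j k l - \<omega> j k * sig \<omega> x i j l + \<omega> j l * sig \<omega> x i j k"
    "plu \<omega> i j k l * x $ k = \<omega> i k * sig \<omega> x j k l - \<omega> j k * sig \<omega> x i k l + \<omega> k l * sig \<omega> x i j k"
    "plu \<omega> i j k l * x $ l = \<omega> i l * sig \<omega> x j k l - \<omega> j l * sig \<omega> x i k l + \<omega> k l * sig \<omega> x i j l"
    by (simp_all add: plu_def sig_def algebra_simps)
  then have "x $ i = 0" "x $ j = 0" "x $ k = 0" "x $ l = 0"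
    using plu_nz by (simp_all add: s)
  then have "\<forall>m\<in>{i, j, k, l}. x $ m = 0" by simp
  then have "x = 0" unfolding UNIV_eq[symmetric] by (simp add: vec_eq_iff)
  then show False using assms by simp
qed

text \<open>Near \<open>p\<close> some field \<open>Y\<close> has nonzero value under
  \<open>eta\<close>. Subtracting the right multiple of \<open>Y\<close> puts any field into the
  kernel, and no nonzero multiple of \<open>Y\<close> lies there, so the class of \<open>Y\<close>
  is a basis of the quotient.\<close>

lemma nonsingular: "nonsingular_dist 2 T"
  unfolding nonsingular_dist_def
proof
  fix p :: "'n proj"
  obtain x0 where x0: "x0 \<noteq> 0" "p = abs_proj x0" by (rule proj_cases)
  obtain m where m: "eta x0 (axis m 1) \<noteq> 0" using eta_nondegenerate[OF x0(1)] .
  obtain r where r: "x0 $ r \<noteq> 0" using x0 by (auto simp: vec_eq_iff)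
  let ?w = "axis m 1 :: complex ^ 'n"
  \<comment> \<open>A constant lift is not homogeneous of degree 1. Multiplying by the coordinate
    \<open>x $ r\<close>, nonzero near \<open>p\<close>, makes it linear.\<close>
  define B :: "complex ^ 'n ^ 'n" where "B = (\<chi> a b. if b = r then ?w $ a else 0)"
  have B: "B *v x = x $ r *s ?w" for x
    by (simp add: B_def matrix_vector_mult_def vec_eq_iff if_distrib[of "\<lambda>c. c * _"] sum.delta cong: if_cong)
  define U where "U = {q. eta (rep_proj q) ?w \<noteq> 0 \<and> q \<in> chart r}"
  have cU: "cone U = {x. eta x ?w \<noteq> 0 \<and> x $ r \<noteq> 0}"
  proof (rule set_eqI)
    fix x
    show "x \<in> cone U \<longleftrightarrow> x \<in> {x. eta x ?w \<noteq> 0 \<and> x $ r \<noteq> 0}"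
    proof (cases "x = 0")
      case False
      then obtain c where "c \<noteq> 0" "rep_proj (abs_proj x) = c *s x"
        by (rule rep_abs_proj)
      then show ?thesis using False by (simp add: U_def eta_smult_left abs_proj_in_chart)
    qed simp
  qed
  have "open (cone U)"
  proof -
    have "cone U = (\<lambda>x. eta x ?w) -` (- {0}) \<inter> (\<lambda>x. x $ r) -` (- {0})"
      by (auto simp: cU simp del: cone_iff)
    moreover have "continuous_on UNIV (\<lambda>x. eta x ?w)"
      unfolding eta_def ext4_def sig_def by (intro continuous_intros)
    ultimately show ?thesis
      by (auto intro!: open_Int open_vimage continuous_intros)
  qed
  then have U: "open U" by (simp add: open_proj_def)
  have pU: "p \<in> U"
    using cU m r x0 by (metis (mono_tags, lifting) cone_iff mem_Collect_eq)
  define Y where "Y = vres U (linfield B)"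
  have Y: "Y \<in> TP U" unfolding Y_def by (rule vres_linfield_TP[OF U])
  have Yx: "Y (abs_proj x) = tv x (x $ r *s ?w)" if "x \<in> cone U" for x
    using that linfield_abs_proj[of x B] by (auto simp: Y_def vres_def B)
  show "\<exists>U Ys. open U \<and> p \<in> U \<and> length Ys = CARD('n) - 1 - 2 \<and> set Ys \<subseteq> TP U \<and>
      (\<forall>V. open V \<and> V \<subseteq> U \<longrightarrow>
         (\<forall>X\<in>TP V. \<exists>hs. length hs = length Ys \<and> set hs \<subseteq> hol V \<and> vdiff X (vres V (lincomb hs Ys)) \<in> T V) \<and>
         (\<forall>hs. length hs = length Ys \<and> set hs \<subseteq> hol V \<and> vres V (lincomb hs Ys) \<in> T V \<longrightarrow>
            (\<forall>h\<in>set hs. \<forall>q\<in>V. h q = 0)))"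
  proof (intro exI[of _ U] exI[of _ "[Y]"] conjI U pU allI impI ballI)
    show "length [Y] = CARD('n) - 1 - 2" by (simp add: card_eq_4)
    show "set [Y] \<subseteq> TP U" using Y by simp
  next
    fix V X assume VU: "open V \<and> V \<subseteq> U" and X: "X \<in> TP V"
    then have V: "open V" "V \<subseteq> U" by auto
    have Vr: "V \<subseteq> chart r" using V by (auto simp: U_def)
    have cV: "x \<in> cone U" if "x \<in> cone V" for x using that V by auto
    \<comment> \<open>The quotient of the values of the contact form on \<open>X\<close> and on
      \<open>?w\<close>, written in affine coordinates so that it is a function on \<open>V\<close>;
      \<open>hx\<close> identifies it on the cone.\<close>
    define h where "h q = ext4 \<omega> (\<chi> a. coord r a q) (\<chi> a. X q (coord r a)) i j k l /
       ext4 \<omega> (\<chi> a. coord r a q) ?w i j k l" for q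
    have cx: "(\<chi> a. coord r a (abs_proj x)) = (1 / x $ r) *s x" if "x \<noteq> 0" for x
      using that by (simp add: vec_eq_iff coord_abs_proj)
    have hx: "h (abs_proj x) = eta x \<xi> / (x $ r * eta x ?w)" if x: "x \<in> cone V" "X (abs_proj x) = tv x \<xi>" for x \<xi>
    proof -
      have nz: "x \<noteq> 0" "x $ r \<noteq> 0" "eta x ?w \<noteq> 0"
        using cV[OF x(1)] x(1) unfolding cU by auto
      have "(\<chi> a. X (abs_proj x) (coord r a)) = (1 / x $ r) *s \<xi> - (\<xi> $ r / (x $ r)\<^sup>2) *s x"
        using nz by (simp add: vec_eq_iff x(2) tv_coord field_simps power2_eq_square)
      then have "h (abs_proj x) = (1 / x $ r * (1 / x $ r * eta x \<xi>)) / (1 / x $ r * eta x ?w)"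
        by (simp add: h_def cx[OF nz(1)] eta_def[symmetric] eta_diff eta_smult eta_smult_left eta_self)
      then show ?thesis using nz by (simp add: field_simps)
    qed
    have h: "h \<in> hol V"
    proof -
      have c: "coord r a \<in> hol V" for a using hol_coord Vr by (rule hol_subset)
      have d: "(\<lambda>q. X q (coord r a)) \<in> hol V" for a
        by (rule TP_coord_hol[OF X V(1) order_refl Vr])
      have nz: "ext4 \<omega> (\<chi> a. coord r a q) ?w i j k l \<noteq> 0" if "q \<in> V" for q
      proof -
        obtain x where x: "x \<noteq> 0" "q = abs_proj x" by (rule proj_cases)
        then have "x \<in> cone U" using that V by auto
        then have "x $ r \<noteq> 0" "eta x ?w \<noteq> 0" unfolding cU by auto
        then show ?thesis
          using x by (simp add: cx eta_def[symmetric] eta_smult_left)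
      qed
      have "(\<lambda>q. ext4 \<omega> (\<chi> a. coord r a q) (\<chi> a. X q (coord r a)) i j k l) \<in> hol V"
        unfolding ext4_def sig_def vec_lambda_beta by (intro hol_add hol_diff hol_mult hol_const c d)
      moreover have "(\<lambda>q. ext4 \<omega> (\<chi> a. coord r a q) ?w i j k l) \<in> hol V"
        unfolding ext4_def sig_def vec_lambda_beta by (intro hol_add hol_diff hol_mult hol_const c)
      ultimately show ?thesis
        unfolding h_def[abs_def] using nz by (rule hol_divide)
    qed
    have "vdiff X (vres V (lincomb [h] [Y])) = vdiff X (vscale h (vres V Y))"
      by (auto simp: vdiff_def vres_def vscale_def lincomb_1 fun_eq_iff)
    moreover have "vdiff X (vscale h (vres V Y)) \<in> T V"
    proof (rule in_T_if_eta[OF V(1) TP_vdiff_vscale[OF X vres_TP[OF Y V] h]])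
      fix x assume x: "x \<in> cone V"
      then obtain \<xi> where \<xi>: "X (abs_proj x) = tv x \<xi>" using TP_tv[OF X] by auto
      have nz: "x \<noteq> 0" "x $ r \<noteq> 0" "eta x ?w \<noteq> 0"
        using cV[OF x] x unfolding cU by auto
      let ?\<zeta> = "\<xi> + (- h (abs_proj x) * x $ r) *s ?w"
      have "vdiff X (vscale h (vres V Y)) (abs_proj x) = tv x ?\<zeta>"
      proof
        fix f
        show "vdiff X (vscale h (vres V Y)) (abs_proj x) f = tv x ?\<zeta> f"
          unfolding tv_add[OF nz(1)] tv_smult[OF nz(1)] using x Yx[OF cV[OF x]]
          by (simp add: vdiff_def vscale_def vres_def \<xi> tv_smult[OF nz(1)])
      qed
      moreover have "eta x ?\<zeta> = 0"
        unfolding eta_add eta_smult hx[OF x \<xi>] using nz by simp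
      ultimately show "\<exists>\<zeta>. vdiff X (vscale h (vres V Y)) (abs_proj x) = tv x \<zeta> \<and> eta x \<zeta> = 0"
        by blast
    qed
    ultimately show "\<exists>hs. length hs = length [Y] \<and> set hs \<subseteq> hol V \<and> vdiff X (vres V (lincomb hs [Y])) \<in> T V"
      using h by (intro exI[of _ "[h]"]) simp
  next
    fix V hs h q
    assume VU: "open V \<and> V \<subseteq> U" and hs: "length hs = length [Y] \<and> set hs \<subseteq> hol V \<and> vres V (lincomb hs [Y]) \<in> T V"
      and h: "h \<in> set hs" and q: "q \<in> V"
    have hs1: "hs = [h]" using hs h by (cases hs) auto
    obtain x where x: "x \<noteq> 0" "q = abs_proj x" by (rule proj_cases)
    have xV: "x \<in> cone V" "x \<in> cone U" using x q VU by auto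
    then have nz: "x $ r \<noteq> 0" "eta x ?w \<noteq> 0" unfolding cU by auto
    have "vres V (lincomb hs [Y]) (abs_proj x) = tv x ((h q * x $ r) *s ?w)"
      using x q Yx[OF xV(2)] by (simp add: vres_def hs1 lincomb_1 tv_smult fun_eq_iff)
    moreover have "vres V (lincomb hs [Y]) \<in> T V" "open V" using hs VU by auto
    ultimately have "eta x ((h q * x $ r) *s ?w) = 0"
      using in_T_iff_eta[of V] xV(1) by blast
    then show "h q = 0" using nz by (simp add: eta_smult)
  qed
qed

text \<open>The right-hand side has rank two as a form in \<open>u\<close> and \<open>v\<close>, while \<open>eta\<close> has nonzero Pfaffian.\<close>

lemma eta_indecomposable:
  obtains u v where "eta u v \<noteq> eta x v * eta u w + eta x u * eta w v"
proof (rule ccontr)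
  assume "\<not> thesis"
  then have e: "eta u v = eta x v * eta u w + eta x u * eta w v" for u v
    using that by blast
  define \<alpha> \<beta> where "\<alpha> a = eta x (axis a 1)" and "\<beta> a = eta (axis a 1) w" for a
  have M: "eta (axis a 1) (axis b 1) = \<alpha> b * \<beta> a - \<alpha> a * \<beta> b" for a b
    using e[of "axis a 1" "axis b 1"] eta_swap[of w "axis b 1"] by (simp add: \<alpha>_def \<beta>_def)
  have ne: "i \<noteq> j" "i \<noteq> k" "i \<noteq> l" "j \<noteq> k" "j \<noteq> l" "k \<noteq> l"
    using distinct by auto
  \<comment> \<open>Up to sign an entry of \<open>eta\<close> is the entry of \<omega> at the
    complementary pair. All entries of \<omega> thus become two by two minors of \<alpha> and
    \<beta>, which satisfy the Pluecker relation.\<close>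
  have o': "- \<omega> k l = \<alpha> j * \<beta> i - \<alpha> i * \<beta> j" "\<omega> j l = \<alpha> k * \<beta> i - \<alpha> i * \<beta> k"
    "- \<omega> j k = \<alpha> l * \<beta> i - \<alpha> i * \<beta> l" "- \<omega> i l = \<alpha> k * \<beta> j - \<alpha> j * \<beta> k"
    "\<omega> i k = \<alpha> l * \<beta> j - \<alpha> j * \<beta> l" "- \<omega> i j = \<alpha> l * \<beta> k - \<alpha> k * \<beta> l"
    using M[of i j] M[of i k] M[of i l] M[of j k] M[of j l] M[of k l] ne ne[symmetric]
    by (simp_all add: eta_axis sig_def axis_simps)
  note o = o'(2,5) o'(1,3,4,6)[unfolded minus_equation_iff[of "\<omega> _ _"], symmetric]
  have "plu \<omega> i j k l = 0"
    unfolding plu_def o by (simp add: algebra_simps)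
  then show False using plu_nz by simp
qed

text \<open>
  The linear fields \<open>y \<mapsto> \<eta>(y, w) u - \<eta>(y, u) w\<close> lie in the kernel of the contact form.
\<close>

lemma nonintegrable: "everywhere_nonintegrable T"
  unfolding everywhere_nonintegrable_def
proof
  fix p :: "'n proj"
  obtain x where x: "x \<noteq> 0" "p = abs_proj x" by (rule proj_cases)
  obtain m where m: "eta x (axis m 1) \<noteq> 0" using eta_nondegenerate[OF x(1)] .
  obtain r where r: "x $ r \<noteq> 0" using x by (auto simp: vec_eq_iff)
  \<comment> \<open>The normalisation \<open>eta x w = 1\<close> gives the two fields the values
    \<open>u - eta x u *s w\<close> and \<open>v - eta x v *s w\<close> at \<open>x\<close>.\<close>
  define w where "w = (1 / eta x (axis m 1)) *s (axis m 1 :: complex ^ 'n)"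
  have w: "eta x w = 1" using m by (simp add: w_def eta_smult)
  obtain u v where uv: "eta u v \<noteq> eta x v * eta u w + eta x u * eta w v"
    by (rule eta_indecomposable)
  have field: "\<exists>B. \<forall>y. B *v y = eta y w *s u - eta y u *s w" for u
  proof -
    have "clin (\<lambda>y. (eta y w *s u - eta y u *s w) $ a)" for a
      by (rule clinI) (simp_all add: eta_add_left eta_smult_left algebra_simps)
    then show ?thesis
      by (rule linear_map_matrix) blast
  qed
  obtain B where B: "\<And>y. B *v y = eta y w *s u - eta y u *s w" using field by blast
  obtain C where C: "\<And>y. C *v y = eta y w *s v - eta y v *s w" using field by blast
  have inT: "linfield E \<in> T UNIV" if E: "\<And>y. E *v y = eta y w *s u' - eta y u' *s w" for E u'
  proof (rule in_T_if_eta[OF open_UNIV])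
    show "linfield E \<in> TP UNIV"
      using vres_linfield_TP[of UNIV E] by (simp add: vres_def)
    fix y assume "y \<in> cone (UNIV :: 'n proj set)"
    then have "linfield E (abs_proj y) = tv y (E *v y)"
      by (simp add: linfield_abs_proj)
    moreover have "eta y (E *v y) = 0"
      by (simp add: E eta_diff eta_smult mult.commute)
    ultimately show "\<exists>\<zeta>. linfield E (abs_proj y) = tv y \<zeta> \<and> eta y \<zeta> = 0" by blast
  qed
  let ?b = "C *v (B *v x) - B *v (C *v x)"
  \<comment> \<open>Differentiating \<open>eta y (C *v y) = 0\<close> along \<open>B *v x\<close>
    gives \<open>eta x (C *v (B *v x)) = - eta (B *v x) (C *v x)\<close>, and likewise with B and C
    exchanged. The bracket thus has the value \<open>- 2 * eta (B *v x) (C *v x)\<close>, here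
    expanded.\<close>
  have bracket: "eta x ?b = - 2 * (eta u v - (eta x v * eta u w + eta x u * eta w v))"
    unfolding B C eta_diff eta_smult eta_diff_left eta_smult_left eta_self w
    using eta_swap[of v u] eta_swap[of w u] eta_swap[of v w] by (simp add: algebra_simps)
  have "lie (linfield B) (linfield C) p \<notin> fibre_at T p"
  proof
    assume "lie (linfield B) (linfield C) p \<in> fibre_at T p"
    then obtain Z V where Z: "lie (linfield B) (linfield C) p = Z p" "open V" "p \<in> V" "Z \<in> T V"
      unfolding fibre_at_def by blast
    have xV: "x \<in> cone V" using Z x by simp
    obtain \<zeta> where \<zeta>: "Z (abs_proj x) = tv x \<zeta>"
      using TP_tv[OF subsheaf_subset[OF sub Z(2,4)], of x] Z x by metis
    have "eta x \<zeta> = 0"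
      using Z(4)[unfolded in_T_iff_eta[OF Z(2)]] xV \<zeta> by blast
    moreover have "eta x \<zeta> = eta x ?b"
      unfolding eta_def
    proof (rule ext4_tv_cong[OF r])
      fix a
      show "tv x \<zeta> (coord r a) = tv x ?b (coord r a)"
        using lie_linfield_coord[OF r, of B C a] Z(1) \<zeta> x by simp
    qed
    ultimately have "- 2 * (eta u v - (eta x v * eta u w + eta x u * eta w v)) = 0"
      unfolding bracket by (simp only:)
    then have "eta u v - (eta x v * eta u w + eta x u * eta w v) = 0"
      by (metis mult_eq_0_iff neg_equal_0_iff_equal zero_neq_numeral)
    then show False
      using uv by simp
  qed
  then show "\<exists>U X Y. open U \<and> p \<in> U \<and> X \<in> T U \<and> Y \<in> T U \<and> lie X Y p \<notin> fibre_at T p"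
    using inT[OF B] inT[OF C] by blast
qed

end

theorem proposition2:
  fixes n :: nat and T :: "('n::finite) subsheaf"
  assumes "n \<ge> 3"
    and "CARD('n) = n + 1"
    and "CARD('m::finite) = (n - 2) + 1"
    and "distribution 2 T"
    and "has_degree 2 T 0"
  shows "(integrable_dist T \<and> (\<exists>A :: complex ^ 'n ^ 'm. tangent_to_projection T A)) \<or>
         (n = 3 \<and> contact_structure T)"
proof -
  \<comment> \<open>The equation \<open>0 = 2 - c\<close> gives c = 2, whence the twist by -2
    below.\<close>
  have "has_c1 2 T 2"
    using assms(5) by (auto simp: has_degree_def)
  then obtain \<Phi> :: "'n proj set \<Rightarrow> (complex ^ 'n \<Rightarrow> complex) \<Rightarrow> 'n altform" where
    "\<forall>U. open U \<longrightarrow> bij_betw (\<Phi> U) (twist (- 2) U) (alt_forms 2 T U) \<and>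
      (\<forall>g\<in>twist (- 2) U. \<forall>g'\<in>twist (- 2) U.
        \<Phi> U (\<lambda>x. g x + g' x) = (\<lambda>V Xs p. \<Phi> U g V Xs p + \<Phi> U g' V Xs p)) \<and>
      (\<forall>h\<in>hol U. \<forall>g\<in>twist (- 2) U. \<Phi> U (\<lambda>x. h (abs_proj x) * g x) = (\<lambda>V Xs p. h p * \<Phi> U g V Xs p)) \<and>
      (\<forall>V. open V \<and> V \<subseteq> U \<longrightarrow> (\<forall>g\<in>twist (- 2) U. \<Phi> V (twist_res V g) = altform_res V (\<Phi> U g)))"
    unfolding has_c1_def ..
  note \<Phi> = this[THEN spec, THEN mp]
  interpret degree_zero T \<Phi>
  proof
    show "subsheaf_TP T" "has_rank T 2" "torsion_free_quotient T" "CARD('n) \<ge> 4"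
      using assms by (simp_all add: distribution_def)
  next
    fix U :: "'n proj set" assume U: "open U"
    show "bij_betw (\<Phi> U) (twist (- 2) U) (alt_forms 2 T U)"
      by (rule \<Phi>[OF U, THEN conjunct1])
    show "\<Phi> U (\<lambda>x. g x + g' x) = (\<lambda>V Xs p. \<Phi> U g V Xs p + \<Phi> U g' V Xs p)"
      if "g \<in> twist (- 2) U" "g' \<in> twist (- 2) U" for g g'
      by (rule \<Phi>[OF U, THEN conjunct2, THEN conjunct1, THEN bspec, THEN bspec, OF that])
    show "\<Phi> U (\<lambda>x. h (abs_proj x) * g x) = (\<lambda>V Xs p. h p * \<Phi> U g V Xs p)"
      if "h \<in> hol U" "g \<in> twist (- 2) U" for h g
      by (rule \<Phi>[OF U, THEN conjunct2, THEN conjunct2, THEN conjunct1, THEN bspec, THEN bspec, OF that])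
    show "\<Phi> V (twist_res V g) = altform_res V (\<Phi> U g)"
      if "open V" "V \<subseteq> U" "g \<in> twist (- 2) U" for V g
      using \<Phi>[OF U, THEN conjunct2, THEN conjunct2, THEN conjunct2, THEN spec, THEN mp, of V] that by simp
  qed
  obtain \<omega> where \<omega>: "\<And>i j. \<omega> i j = - \<omega> j i"
    "\<And>i j k x. x $ k \<noteq> 0 \<Longrightarrow> hsec k i j x = sig \<omega> x i j k"
    by (rule hsec_omega, rule that)
  interpret degree_zero_bivector T \<Phi> \<omega>
    by unfold_locales (rule \<omega>(1), rule \<omega>(2))
  show ?thesis
  proof (cases "\<forall>i j k l. plu \<omega> i j k l = 0")
    case True
    have "CARD('m) + 2 = CARD('n)" using assms(1-3) by simp
    then obtain A :: "complex ^ 'n ^ 'm" where A: "tangent_to_projection T A"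
      using tangent_to_projection_case True by blast
    then show ?thesis
      using tangent_to_projection_integrable[OF A] by blast
  next
    case False
    then obtain i j k l where "plu \<omega> i j k l \<noteq> 0" by blast
    then interpret contact_case T \<Phi> \<omega> i j k l
      by unfold_locales
    show ?thesis
      using nonsingular nonintegrable card_eq_4 assms by (simp add: contact_structure_def)
  qed
qed

end
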